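(* Let $\bar A$ be the (completed) free graded Lie algebra over $\mathbb{Q}$ on generators $a,b,c$ of degree $-1$, $e,f,g$ of degree $0$ and $h$ of degree $1$, let $\partial$ on $a,b,c,e,f,g$ be as given in the context, and let $\alpha\in A_0$ and $x=u_\alpha(a)\in A_{-1}$ be the elements constructed in the context. Then $$\partial h=\mathrm{BCH}(-\alpha,g,e,f,\alpha)-[x,h]$$ defines a symmetric model of the triangle $\bar\Delta$. That is, the derivation $\partial$ of $\bar A$ so determined makes $\bar A$ into a DGLA model of $\bar\Delta$, and $\partial$ commutes with the action of $S_3$ (the symmetries of the triangle) on $\bar A$.
   Context: **DGLAs.** All vector spaces are over $\mathbb{Q}$. A DGLA is a $\mathbb{Z}$-graded vector space $V=\bigoplus_n V_n$ with a grading-preserving bilinear bracket and a linear map $\partial$ of degree $-1$ such that $\partial^2=0$, $[v,u]=-(-1)^{|u||v|}[u,v]$, the graded Jacobi identity $\mathrm{ad}_{[u,v]}=[\mathrm{ad}_u,\mathrm{ad}_v]$ holds (with $\mathrm{ad}_u(v)=[u,v]$), and $\partial[u,v]=[\partial u,v]+(-1)^{|u|}[u,\partial v]$. Free graded Lie algebras are completed with respect to the number of brackets: in each degree $n$, $V_n=\prod_{m\ge 0}V_n^{[m]}$, where $V_n^{[m]}$ is the (finite-dimensional) span of Lie words in the generators with exactly $m$ brackets. A derivation is specified by its values on generators and extended continuously. **Triangle.** $\bar\Delta$ is the cell complex with vertices $a,b,c$, edges $e$ (from $b$ to $c$), $f$ (from $c$ to $a$), $g$ (from $a$ to $b$), and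 one 2-cell $h$ with topological boundary $e+f+g$. $\Delta$ is $\bar\Delta$ with the 2-cell removed. The model $A$ of $\Delta$ is the (completed) free graded Lie algebra on $a,b,c$ (degree $-1$) and $e,f,g$ (degree $0$), a subalgebra of $\bar A$, with $$\partial a=-\tfrac12[a,a],\quad \partial b=-\tfrac12[b,b],\quad \partial c=-\tfrac12[c,c],$$ $$\partial e=\frac{E}{1-e^{E}}b+\frac{E}{1-e^{-E}}c,\quad \partial f=\frac{F}{1-e^{F}}c+\frac{F}{1-e^{-F}}a,\quad \partial g=\frac{G}{1-e^{G}}a+\frac{G}{1-e^{-G}}b,$$ where $E=\mathrm{ad}_e$, $F=\mathrm{ad}_f$, $G=\mathrm{ad}_g$ and the operators are formal power series (in $e^{E}$ etc. the letter $e$ is the base of the exponential). In particular $A_0$ is the completed free Lie algebra on $e,f,g$. **BCH.** For degree-$0$ elements, $\mathrm{BCH}(x_1,\dots,x_n)=\log(\exp x_1\cdots\exp x_n)$, computed in the completed universal enveloping algebra. **Flow.** For $y\in A_0$ and $z\in A_{-1}$, $u_y(z)$ is the value at $t=1$ of the solution of $\frac{dw}{dt}=\partial y-\mathrm{ad}_y(w)$, $w(0)=z$; that is, $u_y(z)=\exp(-\mathrm{ad}_y)z+\frac{1-\exp(-\mathrm{ad}_y)}{\mathrm{ad}_y}(\partial y)$. **Construction of $\alpha$.** Define $$e_0=\mathrm{BCH}(-\tfrac13\mathrm{BCH}(e,f,g),e),\quad f_0=\mathrm{BCH}(-\tfrac13\mathrm{BCH}(f,g,e),f),\quad g_0=\mathrm{BCH}(-\tfrac13\mathrm{BCH}(g,e,f),g),$$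 and for $n\ge 0$ $$e_{n+1}=\mathrm{BCH}(\tfrac12 f_n,\tfrac12 g_n),\quad f_{n+1}=\mathrm{BCH}(\tfrac12 g_n,\tfrac12 e_n),\quad g_{n+1}=\mathrm{BCH}(\tfrac12 e_n,\tfrac12 f_n).$$ Let $\Gamma_0$ be the triangle graph with vertices $a_0=a$, $b_0=b$, $c_0=c$ and directed edges labelled $e_0$ ($b_0\to c_0$), $f_0$ ($c_0\to a_0$), $g_0$ ($a_0\to b_0$). Inductively, $\Gamma_{n+1}$ is obtained from $\Gamma_n$ by adding to its innermost triangle (with edges $e_n:b_n\to c_n$, $f_n:c_n\to a_n$, $g_n:a_n\to b_n$) the midpoints $a_{n+1}$ of $b_nc_n$, $b_{n+1}$ of $c_na_n$, $c_{n+1}$ of $a_nb_n$, splitting each edge into two edges each labelled by half the original label, and adding edges labelled $e_{n+1}:b_{n+1}\to c_{n+1}$, $f_{n+1}:c_{n+1}\to a_{n+1}$, $g_{n+1}:a_{n+1}\to b_{n+1}$. Then $\alpha_n\in A_0$ is the BCH of the successive edge labels (negated when an edge is traversed backwards) along any path in $\Gamma_n$ from $a_0$ to $a_n$; this is independent of the path because the BCH around every loop vanishes. Explicitly, $\alpha_0=0$ and $\alpha_{n+1}=\mathrm{BCH}(\alpha_n,\tfrac12 g_n,f_{n+1})$. The sequence $(\alpha_n)$ converges in $A_0$ (i.e. for each $m$ its component in $A_0^{[m]}$ converges), and $\alpha:=\lim_n\alpha_n$. Set $x:=u_\alpha(a)\in A_{-1}$. **Model of $\bar\Delta$.** A DGLA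 structure on $\bar A$ is a model of $\bar\Delta$ if: (i) as a graded Lie algebra it is (completed) freely generated by one generator for each cell, of degree one less than the dimension of the cell; (ii) each vertex generator $v$ satisfies $\partial v+\tfrac12[v,v]=0$; (iii) for each cell generator of positive dimension, the bracket-free part of $\partial$ of it is the geometric boundary, i.e. the bracket-free parts of $\partial e,\partial f,\partial g,\partial h$ are $c-b$, $a-c$, $b-a$, $e+f+g$; (iv) for each cell, $\partial$ of its generator lies in the (completed) Lie subalgebra generated by the generators of the cells in its closure. **$S_3$ action.** $S_3$ acts on $\bar A$ by (continuous) graded Lie algebra automorphisms: $\pi\in S_3$ permutes $a,b,c$; it permutes $e,f,g$ (the edges opposite $a,b,c$ respectively) in the same way with the added sign $\mathrm{sgn}(\pi)$; and it sends $h$ to $\mathrm{sgn}(\pi)h$. For example, the rotation is $a\to b\to c\to a$, $e\to f\to g\to e$, $h\to h$, and the reflection fixing $a$ is $b\leftrightarrow c$, $e\to -e$, $f\to -g$, $g\to -f$, $h\to -h$. The model is symmetric if $\partial$ commutes with this action. *)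

theory Defs
  imports
    "HOL-Analysis.Analysis"
    "HOL-Combinatorics.Permutations"
    "HOL-Computational_Algebra.Formal_Power_Series"
begin

section \<open>Graded Lie algebras and DGLAs over the rationals\<close>

definition koszul_sign :: "int \<Rightarrow> int \<Rightarrow> rat" where
  "koszul_sign p q = (if even (p * q) then 1 else - 1)"

text \<open>The graded vector space is the internal direct sum of the subspaces \<open>V n\<close> of an ambient
  vector space; nothing is said about the operations outside this direct sum (\<open>total\<close>).\<close>

locale graded_lie_algebra = vector_space scale
  for scale :: "rat \<Rightarrow> 'v::ab_group_add \<Rightarrow> 'v" +
  fixes V :: "int \<Rightarrow> 'v set" and br :: "'v \<Rightarrow> 'v \<Rightarrow> 'v"
  assumes subspace_V: "subspace (V n)"
    and independent_V:
      "\<lbrakk>finite N; \<And>n. n \<in> N \<Longrightarrow> c n \<in> V n; (\<Sum>n\<in>N. c n) = 0; k \<in> N\<rbrakk> \<Longrightarrow> c k = 0"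
    and br_add_left:
      "\<lbrakk>u \<in> span (\<Union>n. V n); u' \<in> span (\<Union>n. V n); v \<in> span (\<Union>n. V n)\<rbrakk>
        \<Longrightarrow> br (u + u') v = br u v + br u' v"
    and br_add_right:
      "\<lbrakk>u \<in> span (\<Union>n. V n); v \<in> span (\<Union>n. V n); v' \<in> span (\<Union>n. V n)\<rbrakk>
        \<Longrightarrow> br u (v + v') = br u v + br u v'"
    and br_scale_left:
      "\<lbrakk>u \<in> span (\<Union>n. V n); v \<in> span (\<Union>n. V n)\<rbrakk> \<Longrightarrow> br (scale r u) v = scale r (br u v)"
    and br_scale_right:
      "\<lbrakk>u \<in> span (\<Union>n. V n); v \<in> span (\<Union>n. V n)\<rbrakk> \<Longrightarrow> br u (scale r v) = scale r (br u v)"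
    and br_degree: "\<lbrakk>u \<in> V p; v \<in> V q\<rbrakk> \<Longrightarrow> br u v \<in> V (p + q)"
    and br_antisym: "\<lbrakk>u \<in> V p; v \<in> V q\<rbrakk> \<Longrightarrow> br v u = - scale (koszul_sign p q) (br u v)"
    and br_jacobi:
      "\<lbrakk>u \<in> V p; v \<in> V q; w \<in> V s\<rbrakk>
        \<Longrightarrow> br (br u v) w = br u (br v w) - scale (koszul_sign p q) (br v (br u w))"
begin

definition total :: "'v set" where
  "total = span (\<Union>n. V n)"

end

locale lie_derivation = graded_lie_algebra scale V br
  for scale :: "rat \<Rightarrow> 'v::ab_group_add \<Rightarrow> 'v" and V and br +
  fixes d :: "'v \<Rightarrow> 'v"
  assumes d_add: "\<lbrakk>u \<in> total; v \<in> total\<rbrakk> \<Longrightarrow> d (u + v) = d u + d v"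
    and d_scale: "u \<in> total \<Longrightarrow> d (scale r u) = scale r (d u)"
    and d_degree: "u \<in> V n \<Longrightarrow> d u \<in> V (n - 1)"
    and d_br: "\<lbrakk>u \<in> V p; v \<in> V q\<rbrakk>
        \<Longrightarrow> d (br u v) = br (d u) v + scale (if even p then 1 else - 1) (br u (d v))"

locale dgla = lie_derivation +
  assumes d_d: "u \<in> total \<Longrightarrow> d (d u) = 0"


section \<open>Lie words and freeness\<close>

datatype 'i lie_word = Gen 'i | Br "'i lie_word" "'i lie_word"

primrec brackets :: "'i lie_word \<Rightarrow> nat" where
  "brackets (Gen i) = 0"
| "brackets (Br s t) = Suc (brackets s + brackets t)"

primrec word_degree :: "('i \<Rightarrow> int) \<Rightarrow> 'i lie_word \<Rightarrow> int" where
  "word_degree \<delta> (Gen i) = \<delta> i"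
| "word_degree \<delta> (Br s t) = word_degree \<delta> s + word_degree \<delta> t"

primrec eval_word :: "('v \<Rightarrow> 'v \<Rightarrow> 'v) \<Rightarrow> ('i \<Rightarrow> 'v) \<Rightarrow> 'i lie_word \<Rightarrow> 'v" where
  "eval_word br x (Gen i) = x i"
| "eval_word br x (Br s t) = br (eval_word br x s) (eval_word br x t)"

definition graded_lie_hom ::
  "(rat \<Rightarrow> 'v::ab_group_add \<Rightarrow> 'v) \<Rightarrow> (int \<Rightarrow> 'v set) \<Rightarrow> ('v \<Rightarrow> 'v \<Rightarrow> 'v) \<Rightarrow>
   (rat \<Rightarrow> 'w::ab_group_add \<Rightarrow> 'w) \<Rightarrow> (int \<Rightarrow> 'w set) \<Rightarrow> ('w \<Rightarrow> 'w \<Rightarrow> 'w) \<Rightarrow> ('v \<Rightarrow> 'w) \<Rightarrow> bool" where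
  "graded_lie_hom sc V br sc' W br' \<psi> \<longleftrightarrow>
     (let T = graded_lie_algebra.total sc V in
       (\<forall>u\<in>T. \<forall>v\<in>T. \<psi> (u + v) = \<psi> u + \<psi> v \<and> \<psi> (br u v) = br' (\<psi> u) (\<psi> v)) \<and>
       (\<forall>q. \<forall>u\<in>T. \<psi> (sc q u) = sc' q (\<psi> u)) \<and>
       (\<forall>n. \<forall>u\<in>V n. \<psi> u \<in> W n))"

text \<open>The universal property of the (uncompleted) free graded Lie algebra, with test objects ranging
  over all graded Lie algebras in the type \<open>'m\<close>.\<close>

definition free_graded_lie_algebra ::
  "'m::ab_group_add itself \<Rightarrow> (rat \<Rightarrow> 'v::ab_group_add \<Rightarrow> 'v) \<Rightarrow> (int \<Rightarrow> 'v set) \<Rightarrow>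
   ('v \<Rightarrow> 'v \<Rightarrow> 'v) \<Rightarrow> ('i \<Rightarrow> int) \<Rightarrow> ('i \<Rightarrow> 'v) \<Rightarrow> bool" where
  "free_graded_lie_algebra _ sc V br \<delta> x \<longleftrightarrow>
     graded_lie_algebra sc V br \<and> (\<forall>i. x i \<in> V (\<delta> i)) \<and>
     (\<forall>(sc' :: rat \<Rightarrow> 'm \<Rightarrow> 'm) W br' \<phi>.
        graded_lie_algebra sc' W br' \<and> (\<forall>i. \<phi> i \<in> W (\<delta> i)) \<longrightarrow>
        (\<exists>!\<psi>. \<psi> \<in> extensional (graded_lie_algebra.total sc V) \<and>
              graded_lie_hom sc V br sc' W br' \<psi> \<and> (\<forall>i. \<psi> (x i) = \<phi> i)))"


section \<open>Noncommutative formal power series\<close>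

text \<open>The completed free associative algebra on the alphabet \<open>'x\<close>: a series is given by its
  coefficients at the words over \<open>'x\<close>, and the product is concatenation.\<close>

datatype 'x ncseries = NCSeries (coeff: "'x list \<Rightarrow> rat")

lemma ncseries_eqI: "(\<And>w. coeff x w = coeff y w) \<Longrightarrow> x = y"
  by (simp add: ncseries.expand ext)

instantiation ncseries :: (type) ring_1
begin

definition "0 = NCSeries (\<lambda>w. 0)"
definition "1 = NCSeries (\<lambda>w. if w = [] then 1 else 0)"
definition "x + y = NCSeries (\<lambda>w. coeff x w + coeff y w)"
definition "x - y = NCSeries (\<lambda>w. coeff x w - coeff y w)"
definition "- x = NCSeries (\<lambda>w. - coeff x w)"
definition "x * y = NCSeries (\<lambda>w. \<Sum>i\<le>length w. coeff x (take i w) * coeff y (drop i w))"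

instance
proof
  fix x y z :: "'a ncseries"
  show "x * y * z = x * (y * z)"
  proof (rule ncseries_eqI)
    fix w :: "'a list"
    let ?n = "length w"
    let ?t = "\<lambda>i j. coeff x (take i w) * coeff y (take (j - i) (drop i w)) * coeff z (drop j w)"
    have "coeff (x * y * z) w = (\<Sum>j\<le>?n. \<Sum>i\<le>j. ?t i j)"
      unfolding times_ncseries_def
      by (auto simp: sum_distrib_right drop_take min_def intro!: sum.cong)
    also have "\<dots> = (\<Sum>i\<le>?n. \<Sum>k\<le>?n - i. ?t i (i + k))"
      by (subst sum.Sigma, simp, simp, subst sum.Sigma, simp, simp)
        (rule sum.reindex_bij_witness[where i = "\<lambda>(i, k). (i + k, i)" and j = "\<lambda>(j, i). (i, j - i)"],
          auto)
    also have "\<dots> = coeff (x * (y * z)) w"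
      unfolding times_ncseries_def
      by (auto simp: sum_distrib_left add.commute mult.assoc intro!: sum.cong)
    finally show "coeff (x * y * z) w = coeff (x * (y * z)) w" .
  qed
  show "1 * x = x"
  proof (rule ncseries_eqI)
    fix w
    have "coeff (1 * x) w = (\<Sum>i\<le>length w. if i = 0 then coeff x w else 0)"
      unfolding times_ncseries_def one_ncseries_def ncseries.sel by (rule sum.cong) auto
    thus "coeff (1 * x) w = coeff x w" by simp
  qed
  show "x * 1 = x"
  proof (rule ncseries_eqI)
    fix w
    have "coeff (x * 1) w = (\<Sum>i\<le>length w. if i = length w then coeff x w else 0)"
      unfolding times_ncseries_def one_ncseries_def ncseries.sel by (rule sum.cong) auto
    thus "coeff (x * 1) w = coeff x w" by simp
  qed
  have "coeff (0 :: 'a ncseries) [] \<noteq> coeff 1 []"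
    by (simp add: zero_ncseries_def one_ncseries_def)
  thus "(0 :: 'a ncseries) \<noteq> 1" by metis
qed (auto intro!: ncseries_eqI simp: zero_ncseries_def plus_ncseries_def minus_ncseries_def
       uminus_ncseries_def times_ncseries_def algebra_simps sum.distrib)

end

definition scaleQ :: "rat \<Rightarrow> 'x ncseries \<Rightarrow> 'x ncseries" (infixr "*\<^sub>Q" 75) where
  "q *\<^sub>Q x = NCSeries (\<lambda>w. q * coeff x w)"

interpretation ncs: vector_space "scaleQ :: rat \<Rightarrow> 'x ncseries \<Rightarrow> 'x ncseries"
  by standard (auto intro!: ncseries_eqI simp: scaleQ_def plus_ncseries_def algebra_simps)

definition gen :: "'x \<Rightarrow> 'x ncseries" where
  "gen i = NCSeries (\<lambda>w. if w = [i] then 1 else 0)"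

definition length_part :: "nat \<Rightarrow> 'x ncseries \<Rightarrow> 'x ncseries" where
  "length_part k x = NCSeries (\<lambda>w. if length w = k then coeff x w else 0)"

text \<open>Coefficientwise convergence, for the usual (Euclidean) topology on the rationals.\<close>

definition ncs_tendsto :: "(nat \<Rightarrow> 'x ncseries) \<Rightarrow> 'x ncseries \<Rightarrow> bool" where
  "ncs_tendsto s x \<longleftrightarrow>
     (\<forall>w. (\<lambda>n. real_of_rat (coeff (s n) w)) \<longlonglongrightarrow> real_of_rat (coeff x w))"

text \<open>For \<open>F = (\<Sum>k. c\<^sub>k X\<^sup>k)\<close> and an operator \<open>T\<close>, this is \<open>(\<Sum>k. c\<^sub>k T\<^sup>k y)\<close>. It is used only for
  operators \<open>T\<close> that strictly raise the lengths of words, so that \<open>T\<^sup>k y\<close> has no words of length less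
  than \<open>k\<close> and the truncated sum below is the full sum.\<close>

definition fps_op :: "rat fps \<Rightarrow> ('x ncseries \<Rightarrow> 'x ncseries) \<Rightarrow> 'x ncseries \<Rightarrow> 'x ncseries" where
  "fps_op F T y = NCSeries (\<lambda>w. \<Sum>k\<le>length w. fps_nth F k * coeff ((T ^^ k) y) w)"

definition ncs_exp :: "'x ncseries \<Rightarrow> 'x ncseries" where
  "ncs_exp x = fps_op (fps_exp 1) ((*) x) 1"

definition ncs_log :: "'x ncseries \<Rightarrow> 'x ncseries" where
  "ncs_log y = fps_op (fps_ln 1) ((*) (y - 1)) 1"
    \<comment> \<open>\<^term>\<open>fps_ln 1\<close> is the series of \<open>log (1 + X)\<close>.\<close>

definition BCH :: "'x ncseries list \<Rightarrow> 'x ncseries" where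
  "BCH xs = ncs_log (prod_list (map ncs_exp xs))"


section \<open>The cells of the triangle\<close>

datatype vertex = Va | Vb | Vc

text \<open>\<open>Edge v\<close> is the edge opposite to the vertex \<open>v\<close>.\<close>

datatype cell = Vert vertex | Edge vertex | Face

primrec cell_dim :: "cell \<Rightarrow> nat" where
  "cell_dim (Vert v) = 0"
| "cell_dim (Edge v) = 1"
| "cell_dim Face = 2"

definition cell_deg :: "cell \<Rightarrow> int" where
  "cell_deg s = int (cell_dim s) - 1"

fun closure_cells :: "cell \<Rightarrow> cell set" where
  "closure_cells (Vert v) = {Vert v}"
| "closure_cells (Edge v) = insert (Edge v) (Vert ` (- {v}))"
| "closure_cells Face = UNIV"

abbreviation "a_gen \<equiv> gen (Vert Va)"
abbreviation "b_gen \<equiv> gen (Vert Vb)"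
abbreviation "c_gen \<equiv> gen (Vert Vc)"
abbreviation "e_gen \<equiv> gen (Edge Va)"
abbreviation "f_gen \<equiv> gen (Edge Vb)"
abbreviation "g_gen \<equiv> gen (Edge Vc)"
abbreviation "h_gen \<equiv> gen Face"

fun geometric_boundary :: "cell \<Rightarrow> cell ncseries" where
  "geometric_boundary (Vert v) = 0"
| "geometric_boundary (Edge Va) = c_gen - b_gen"
| "geometric_boundary (Edge Vb) = a_gen - c_gen"
| "geometric_boundary (Edge Vc) = b_gen - a_gen"
| "geometric_boundary Face = e_gen + f_gen + g_gen"


section \<open>The completed free graded Lie algebra on the cells\<close>

text \<open>The completed free graded Lie algebra is realised inside its completed universal enveloping
  algebra, the completed free associative algebra on the cells, with the graded commutator as
  bracket. Freeness is not built into this realisation; it is a condition in \<open>triangle_model\<close>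
  below.\<close>

definition list_deg :: "cell list \<Rightarrow> int" where
  "list_deg w = sum_list (map cell_deg w)"

definition gbr :: "cell ncseries \<Rightarrow> cell ncseries \<Rightarrow> cell ncseries" where
  "gbr x y = NCSeries (\<lambda>w. \<Sum>i\<le>length w.
     (let u = take i w; v = drop i w in
       coeff x u * coeff y v - koszul_sign (list_deg u) (list_deg v) * (coeff y u * coeff x v)))"

lemma gbr_homogeneous:
  assumes "\<And>w. coeff x w \<noteq> 0 \<Longrightarrow> list_deg w = p" and "\<And>w. coeff y w \<noteq> 0 \<Longrightarrow> list_deg w = q"
  shows "gbr x y = x * y - koszul_sign p q *\<^sub>Q (y * x)"
proof (rule ncseries_eqI)
  fix w
  have *: "koszul_sign (list_deg u) (list_deg v) * (coeff y u * coeff x v)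
          = koszul_sign p q * (coeff y u * coeff x v)" for u v
    using assms(1)[of v] assms(2)[of u]
    by (cases "coeff y u = 0 \<or> coeff x v = 0") (auto simp: koszul_sign_def)
  show "coeff (gbr x y) w = coeff (x * y - koszul_sign p q *\<^sub>Q (y * x)) w"
    unfolding gbr_def times_ncseries_def minus_ncseries_def scaleQ_def Let_def ncseries.sel *
    by (simp add: sum_subtractf sum_distrib_left)
qed

text \<open>The span of the Lie words of degree \<open>n\<close> with \<open>m\<close> brackets in the generators from \<open>S\<close>. A Lie word
  with \<open>m\<close> brackets is a combination of associative words of length \<open>m + 1\<close>.\<close>

definition lie_part :: "cell set \<Rightarrow> int \<Rightarrow> nat \<Rightarrow> cell ncseries set" where
  "lie_part S n m = ncs.span {eval_word gbr gen t | t.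
     set_lie_word t \<subseteq> S \<and> word_degree cell_deg t = n \<and> brackets t = m}"

definition free_lie :: "int \<Rightarrow> cell ncseries set" where
  "free_lie n = ncs.span (\<Union>m. lie_part UNIV n m)"

text \<open>The product over \<open>m\<close> of the spaces \<open>lie_part S n m\<close>: the degree \<open>n\<close> part of the completed Lie
  subalgebra generated by \<open>S\<close>.\<close>

definition completed_lie :: "cell set \<Rightarrow> int \<Rightarrow> cell ncseries set" where
  "completed_lie S n =
     {x. coeff x [] = 0 \<and> (\<forall>m. length_part (Suc m) x \<in> lie_part S n m)}"

definition completed_lie_total :: "cell set \<Rightarrow> cell ncseries set" where
  "completed_lie_total S = ncs.span (\<Union>n. completed_lie S n)"

definition Abar :: "int \<Rightarrow> cell ncseries set" where
  "Abar = completed_lie UNIV"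

definition Abar_total :: "cell ncseries set" where
  "Abar_total = completed_lie_total UNIV"

text \<open>Continuity of a linear map for the product topologies on the spaces \<open>Abar n\<close>.\<close>

definition continuous_on_Abar :: "(cell ncseries \<Rightarrow> cell ncseries) \<Rightarrow> bool" where
  "continuous_on_Abar d \<longleftrightarrow>
     (\<forall>n M. \<exists>N. \<forall>x\<in>Abar n. (\<forall>k\<le>N. length_part k x = 0) \<longrightarrow> (\<forall>k\<le>M. length_part k (d x) = 0))"


section \<open>The element \<open>\<alpha>\<close>\<close>

text \<open>The triple \<open>(e\<^sub>n, f\<^sub>n, g\<^sub>n)\<close>.\<close>

primrec edges :: "nat \<Rightarrow> cell ncseries \<times> cell ncseries \<times> cell ncseries" where
  "edges 0 =
     (BCH [(- 1/3) *\<^sub>Q BCH [e_gen, f_gen, g_gen], e_gen],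
      BCH [(- 1/3) *\<^sub>Q BCH [f_gen, g_gen, e_gen], f_gen],
      BCH [(- 1/3) *\<^sub>Q BCH [g_gen, e_gen, f_gen], g_gen])"
| "edges (Suc n) =
     (case edges n of (e, f, g) \<Rightarrow>
       (BCH [(1/2) *\<^sub>Q f, (1/2) *\<^sub>Q g],
        BCH [(1/2) *\<^sub>Q g, (1/2) *\<^sub>Q e],
        BCH [(1/2) *\<^sub>Q e, (1/2) *\<^sub>Q f]))"

definition f_seq :: "nat \<Rightarrow> cell ncseries" where
  "f_seq n = fst (snd (edges n))"

definition g_seq :: "nat \<Rightarrow> cell ncseries" where
  "g_seq n = snd (snd (edges n))"

text \<open>The path from \<open>a\<^sub>n\<close> to \<open>a\<^sub>n\<^sub>+\<^sub>1\<close> used here runs through the midpoint \<open>c\<^sub>n\<^sub>+\<^sub>1\<close> of the edge \<open>g\<^sub>n\<close>.\<close>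

primrec alpha_seq :: "nat \<Rightarrow> cell ncseries" where
  "alpha_seq 0 = 0"
| "alpha_seq (Suc n) = BCH [alpha_seq n, (1/2) *\<^sub>Q g_seq n, f_seq (Suc n)]"

definition alpha :: "cell ncseries" where
  "alpha = (THE x. ncs_tendsto alpha_seq x)"


section \<open>The differential\<close>

definition flow :: "(cell ncseries \<Rightarrow> cell ncseries) \<Rightarrow> cell ncseries \<Rightarrow> cell ncseries \<Rightarrow> cell ncseries" where
  "flow d y z = fps_op (fps_exp (- 1)) (gbr y) z
              + fps_op ((1 - fps_exp (- 1)) / fps_X) (gbr y) (d y)"

text \<open>The differential of an edge \<open>y\<close> running from \<open>p\<close> to \<open>q\<close>.\<close>

definition edge_differential :: "cell ncseries \<Rightarrow> cell ncseries \<Rightarrow> cell ncseries \<Rightarrow> cell ncseries" where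
  "edge_differential y p q = fps_op (fps_X / (1 - fps_exp 1)) (gbr y) p
                           + fps_op (fps_X / (1 - fps_exp (- 1))) (gbr y) q"

text \<open>\<open>x = u\<^sub>\<alpha>(a)\<close> is formed with \<open>d\<close> itself; this is not circular, because \<open>\<alpha>\<close> lies in the completed
  Lie subalgebra generated by the edges, where \<open>d\<close> is determined by the other equations.\<close>

definition triangle_differential :: "(cell ncseries \<Rightarrow> cell ncseries) \<Rightarrow> bool" where
  "triangle_differential d \<longleftrightarrow>
     lie_derivation scaleQ Abar gbr d \<and> continuous_on_Abar d \<and>
     (\<forall>v. d (gen (Vert v)) = (- 1/2) *\<^sub>Q gbr (gen (Vert v)) (gen (Vert v))) \<and>
     d e_gen = edge_differential e_gen b_gen c_gen \<and>
     d f_gen = edge_differential f_gen c_gen a_gen \<and>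
     d g_gen = edge_differential g_gen a_gen b_gen \<and>
     d h_gen = BCH [- alpha, g_gen, e_gen, f_gen, alpha] - gbr (flow d alpha a_gen) h_gen"


section \<open>Symmetric models of the triangle\<close>

text \<open>Only the freeness of \<open>free_lie\<close> is stated: \<open>Abar n\<close> is by definition the completion of
  \<open>free_lie n\<close> with respect to the number of brackets.\<close>

definition triangle_model :: "'m::ab_group_add itself \<Rightarrow> (cell ncseries \<Rightarrow> cell ncseries) \<Rightarrow> bool" where
  "triangle_model M d \<longleftrightarrow>
     dgla scaleQ Abar gbr d \<and>
     free_graded_lie_algebra M scaleQ free_lie gbr cell_deg gen \<and>
     (\<forall>v. d (gen (Vert v)) + (1/2) *\<^sub>Q gbr (gen (Vert v)) (gen (Vert v)) = 0) \<and>
     (\<forall>s. cell_dim s > 0 \<longrightarrow> length_part 1 (d (gen s)) = geometric_boundary s) \<and>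
     (\<forall>s. d (gen s) \<in> completed_lie_total (closure_cells s))"

primrec cell_perm :: "(vertex \<Rightarrow> vertex) \<Rightarrow> cell \<Rightarrow> cell" where
  "cell_perm \<pi> (Vert v) = Vert (\<pi> v)"
| "cell_perm \<pi> (Edge v) = Edge (\<pi> v)"
| "cell_perm \<pi> Face = Face"

primrec cell_sign :: "(vertex \<Rightarrow> vertex) \<Rightarrow> cell \<Rightarrow> rat" where
  "cell_sign \<pi> (Vert v) = 1"
| "cell_sign \<pi> (Edge v) = of_int (sign \<pi>)"
| "cell_sign \<pi> Face = of_int (sign \<pi>)"

text \<open>The continuous algebra automorphism with \<open>gen s \<mapsto> cell_sign \<pi> s *\<^sub>Q gen (cell_perm \<pi> s)\<close>.\<close>

definition S3_act :: "(vertex \<Rightarrow> vertex) \<Rightarrow> cell ncseries \<Rightarrow> cell ncseries" where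
  "S3_act \<pi> x = NCSeries (\<lambda>w. prod_list (map (cell_sign \<pi>) w) * coeff x (map (cell_perm (inv \<pi>)) w))"

lemma cell_perm_inv:
  assumes "bij \<pi>"
  shows "cell_perm (inv \<pi>) (cell_perm \<pi> s) = s" "cell_perm \<pi> (cell_perm (inv \<pi>) s) = s"
  using assms by (cases s; simp add: bij_is_inj bij_is_surj surj_f_inv_f)+

lemma cell_sign_perm: "cell_sign \<pi> (cell_perm \<rho> s) = cell_sign \<pi> s"
  by (cases s) auto

lemma S3_act_gen:
  assumes "bij \<pi>"
  shows "S3_act \<pi> (gen s) = cell_sign \<pi> s *\<^sub>Q gen (cell_perm \<pi> s)"
proof (rule ncseries_eqI)
  fix w
  have "map (cell_perm (inv \<pi>)) w = [s] \<longleftrightarrow> w = [cell_perm \<pi> s]"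
    using cell_perm_inv[OF assms] by (auto simp: map_eq_Cons_conv)
  thus "coeff (S3_act \<pi> (gen s)) w = coeff (cell_sign \<pi> s *\<^sub>Q gen (cell_perm \<pi> s)) w"
    by (auto simp: S3_act_def gen_def scaleQ_def cell_sign_perm)
qed

lemma S3_act_add: "S3_act \<pi> (x + y) = S3_act \<pi> x + S3_act \<pi> y"
  by (auto intro!: ncseries_eqI simp: S3_act_def plus_ncseries_def algebra_simps)

lemma S3_act_scale: "S3_act \<pi> (q *\<^sub>Q x) = q *\<^sub>Q S3_act \<pi> x"
  by (auto intro!: ncseries_eqI simp: S3_act_def scaleQ_def)

lemma S3_act_gbr: "S3_act \<pi> (gbr x y) = gbr (S3_act \<pi> x) (S3_act \<pi> y)"
proof (rule ncseries_eqI)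
  fix w :: "cell list"
  have deg: "list_deg (map (cell_perm (inv \<pi>)) u) = list_deg u" for u
  proof -
    have "cell_deg (cell_perm (inv \<pi>) s) = cell_deg s" for s
      by (cases s) (auto simp: cell_deg_def)
    thus ?thesis by (simp add: list_deg_def comp_def)
  qed
  have split: "prod_list (map (cell_sign \<pi>) w)
      = prod_list (map (cell_sign \<pi>) (take i w)) * prod_list (map (cell_sign \<pi>) (drop i w))" for i
    by (metis append_take_drop_id map_append prod_list.append)
  show "coeff (S3_act \<pi> (gbr x y)) w = coeff (gbr (S3_act \<pi> x) (S3_act \<pi> y)) w"
    unfolding S3_act_def gbr_def Let_def ncseries.sel length_map sum_distrib_left
  proof (rule sum.cong[OF refl])
    fix i
    let ?s = "\<lambda>w. prod_list (map (cell_sign \<pi>) w)" and ?p = "map (cell_perm (inv \<pi>))"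
    let ?u = "take i w" and ?v = "drop i w"
    show "?s w * (coeff x (take i (?p w)) * coeff y (drop i (?p w))
          - koszul_sign (list_deg (take i (?p w))) (list_deg (drop i (?p w)))
            * (coeff y (take i (?p w)) * coeff x (drop i (?p w))))
        = ?s ?u * coeff x (?p ?u) * (?s ?v * coeff y (?p ?v))
          - koszul_sign (list_deg ?u) (list_deg ?v)
            * (?s ?u * coeff y (?p ?u) * (?s ?v * coeff x (?p ?v)))"
      unfolding split[of i] take_map drop_map deg by (simp add: algebra_simps)
  qed
qed

definition triangle_symmetric :: "(cell ncseries \<Rightarrow> cell ncseries) \<Rightarrow> bool" where
  "triangle_symmetric d \<longleftrightarrow>
     (\<forall>\<pi>. bij \<pi> \<longrightarrow> (\<forall>x\<in>Abar_total. d (S3_act \<pi> x) = S3_act \<pi> (d x)))"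

end

theory Submission
  imports Defs
begin

text \<open>
  Everything takes place in the completed free associative algebra on the cells, in which the graded
  bracket is the supercommutator. A derivation of the completed free Lie algebra extends to a signed
  derivation \<open>D\<close> of this algebra (\<open>der\<close>), and exponentials of elements of degree \<open>0\<close> become actual
  elements. The flow \<open>u\<^sub>y\<close> is then the gauge transformation \<open>p \<mapsto> P\<^sup>-\<^sup>1 p P + P\<^sup>-\<^sup>1 D P\<close> with \<open>P = exp y\<close>
  (\<open>transports_flow\<close>). The relation \<open>D P = P q - p P\<close> (\<open>transports\<close>) composes along paths, so that
  the identities of the theorem are read off from the graph of triangles. The differential of an edge
  is chosen so that its exponential transports one end point to the other
  (\<open>transports_iff_edge_differential\<close>).

  \<^emph>\<open>The square of the differential.\<close> Transport carries the curvature \<open>D p + p p\<close> of \<open>p\<close> to that of \<open>q\<close>,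
  up to \<open>D\<^sup>2 P\<close> (\<open>DD_transports\<close>). Vertices are flat, hence \<open>D\<^sup>2\<close> vanishes on the edges; therefore it
  vanishes on \<open>\<alpha>\<close>, and \<open>x = u\<^sub>\<alpha>(a)\<close> is flat. The boundary of the triangle, conjugated by \<open>\<alpha>\<close>, is a
  loop \<open>l\<close> at \<open>x\<close>, which means \<open>D l = [l, x]\<close> (\<open>full_D_loop\<close>). With \<open>D h = l - [x, h]\<close> and
  \<open>D x = - x x\<close> this gives \<open>D\<^sup>2 h = 0\<close> (\<open>full_DD\<close>).

  \<^emph>\<open>Symmetry.\<close> All triangles of the subdivision are closed (\<open>edge_loop\<close>), so a path to the \<open>n\<close>-th
  triangle may be deformed. In the limit \<open>exp \<alpha> = exp g\<^sub>0 * exp \<rho>(\<alpha>)\<close> for the rotation \<open>\<rho>\<close>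
  (\<open>exp_alpha_rot\<close>), and the reflection fixes \<open>\<alpha>\<close> (\<open>mirror_alpha\<close>). Hence both fix \<open>x\<close>, and
  the loop is fixed by the rotation and inverted by the reflection. These two generate the group.

  \<^emph>\<open>Convergence.\<close> Modulo products of shorter parts, \<open>e\<^sub>n + f\<^sub>n + g\<^sub>n = 0\<close> and \<open>e\<^sub>n\<^sub>+\<^sub>1 = - e\<^sub>n / 2\<close>.
  By induction on length each coefficient of the edges is a sum of geometric sequences with ratios
  \<open>\<plusminus> 2\<^sup>-\<^sup>k\<close>, \<open>k \<ge> 1\<close> (\<open>small_edges\<close>). So the edges tend to \<open>0\<close> and the coefficients of \<open>\<alpha>\<^sub>n\<close> have
  rational limits (\<open>alpha_tendsto\<close>).

  \<^emph>\<open>Lie elements.\<close> That \<open>log (exp x exp y)\<close> is a Lie element follows by applying the derivation that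
  multiplies words by their lengths (\<open>BCH2_cl\<close>). Freeness, and the closedness of the Lie elements under
  limits, both follow from the identity that right-normed bracketing multiplies a Lie word by its
  length (\<open>dyn_eval_word\<close>).
\<close>


section \<open>Series filtered by word length\<close>

lemma coeff_0 [simp]: "coeff 0 w = 0"
  and coeff_1: "coeff 1 w = (if w = [] then 1 else 0)"
  and coeff_add [simp]: "coeff (x + y) w = coeff x w + coeff y w"
  and coeff_diff [simp]: "coeff (x - y) w = coeff x w - coeff y w"
  and coeff_uminus [simp]: "coeff (- x) w = - coeff x w"
  and coeff_scaleQ [simp]: "coeff (q *\<^sub>Q x) w = q * coeff x w"
  and coeff_gen: "coeff (gen s) w = (if w = [s] then 1 else 0)"
  and coeff_times: "coeff (x * y) w = (\<Sum>i\<le>length w. coeff x (take i w) * coeff y (drop i w))"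
  and coeff_length_part: "coeff (length_part k x) w = (if length w = k then coeff x w else 0)"
  by (simp_all add: zero_ncseries_def one_ncseries_def plus_ncseries_def minus_ncseries_def
      uminus_ncseries_def scaleQ_def gen_def times_ncseries_def length_part_def)

lemma coeff_sum [simp]: "coeff (sum f A) w = (\<Sum>i\<in>A. coeff (f i) w)"
  by (induction A rule: infinite_finite_induct) auto

lemma coeff_1_Nil [simp]: "coeff 1 [] = 1" "coeff (gen s) [] = 0"
  by (simp_all add: coeff_1 coeff_gen)

lemma coeff_times_Nil [simp]: "coeff (x * y) [] = coeff x [] * coeff y []"
  by (simp add: coeff_times)

lemma scaleQ_mult_left [simp]: "(q *\<^sub>Q x) * y = q *\<^sub>Q (x * y)"
  and scaleQ_mult_right [simp]: "x * (q *\<^sub>Q y) = q *\<^sub>Q (x * y)"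
  by (rule ncseries_eqI, simp add: coeff_times sum_distrib_left algebra_simps)+

lemma scaleQ_simps [simp]:
  "1 *\<^sub>Q x = x" "0 *\<^sub>Q x = 0" "q *\<^sub>Q 0 = 0" "(- 1) *\<^sub>Q x = - x"
  "p *\<^sub>Q (q *\<^sub>Q x) = (p * q) *\<^sub>Q x" "(- q) *\<^sub>Q x = - (q *\<^sub>Q x)" "q *\<^sub>Q (- x) = - (q *\<^sub>Q x)"
  by (rule ncseries_eqI, simp)+

lemma scaleQ_add: "q *\<^sub>Q (x + y) = q *\<^sub>Q x + q *\<^sub>Q y" "(p + q) *\<^sub>Q x = p *\<^sub>Q x + q *\<^sub>Q x"
  and scaleQ_diff: "q *\<^sub>Q (x - y) = q *\<^sub>Q x - q *\<^sub>Q y" "(p - q) *\<^sub>Q x = p *\<^sub>Q x - q *\<^sub>Q x"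
  by (rule ncseries_eqI, simp add: algebra_simps)+

definition ncfilt :: "nat \<Rightarrow> 'x ncseries set" where
  "ncfilt k = {x. \<forall>w. length w < k \<longrightarrow> coeff x w = 0}"

lemma ncfiltI: "(\<And>w. length w < k \<Longrightarrow> coeff x w = 0) \<Longrightarrow> x \<in> ncfilt k"
  by (simp add: ncfilt_def)

lemma ncfiltD: "x \<in> ncfilt k \<Longrightarrow> length w < k \<Longrightarrow> coeff x w = 0"
  by (simp add: ncfilt_def)

lemma ncfilt_0 [simp]: "x \<in> ncfilt 0" by (simp add: ncfilt_def)

lemma ncfilt_1: "x \<in> ncfilt (Suc 0) \<longleftrightarrow> coeff x [] = 0"
  by (auto simp: ncfilt_def)

lemma ncfilt_zero [simp]: "0 \<in> ncfilt k"
  and ncfilt_add: "x \<in> ncfilt k \<Longrightarrow> y \<in> ncfilt k \<Longrightarrow> x + y \<in> ncfilt k"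
  and ncfilt_diff: "x \<in> ncfilt k \<Longrightarrow> y \<in> ncfilt k \<Longrightarrow> x - y \<in> ncfilt k"
  by (auto simp: ncfilt_def)

lemma ncfilt_mult:
  assumes "x \<in> ncfilt j" "y \<in> ncfilt k" shows "x * y \<in> ncfilt (j + k)"
proof (rule ncfiltI)
  fix w :: "'a list" assume w: "length w < j + k"
  have "coeff x (take i w) * coeff y (drop i w) = 0" if "i \<le> length w" for i
    using ncfiltD[OF assms(1), of "take i w"] ncfiltD[OF assms(2), of "drop i w"] w that
    by (cases "i < j") auto
  thus "coeff (x * y) w = 0" unfolding coeff_times by (intro sum.neutral) blast
qed

text \<open>Raising the filtration is the form in which the continuity of operators is used: such a map may
  be applied term by term to a series whose terms have growing order.\<close>

definition filt_lin :: "nat \<Rightarrow> ('x ncseries \<Rightarrow> 'y ncseries) \<Rightarrow> bool" where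
  "filt_lin r T \<longleftrightarrow> (\<forall>x y. T (x + y) = T x + T y) \<and> (\<forall>q x. T (q *\<^sub>Q x) = q *\<^sub>Q T x) \<and>
     (\<forall>k. \<forall>x\<in>ncfilt k. T x \<in> ncfilt (k + r))"

lemma filt_linI:
  assumes "\<And>x y. T (x + y) = T x + T y" "\<And>q x. T (q *\<^sub>Q x) = q *\<^sub>Q T x"
    "\<And>k x. x \<in> ncfilt k \<Longrightarrow> T x \<in> ncfilt (k + r)"
  shows "filt_lin r T"
  using assms by (auto simp: filt_lin_def)

lemma
  assumes "filt_lin r T"
  shows filt_lin_add: "T (x + y) = T x + T y"
    and filt_lin_scale: "T (q *\<^sub>Q x) = q *\<^sub>Q T x"
    and filt_lin_filt: "x \<in> ncfilt k \<Longrightarrow> T x \<in> ncfilt (k + r)"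
  using assms by (auto simp: filt_lin_def)

lemma filt_lin_zero: "filt_lin r T \<Longrightarrow> T 0 = 0"
  using filt_lin_scale[of r T 0 0] by simp

lemma filt_lin_uminus: "filt_lin r T \<Longrightarrow> T (- x) = - T x"
  using filt_lin_scale[of r T "-1" x] by simp

lemma filt_lin_diff: "filt_lin r T \<Longrightarrow> T (x - y) = T x - T y"
  using filt_lin_add[of r T x "- y"] by (simp add: filt_lin_uminus)

lemma filt_lin_sum: "filt_lin r T \<Longrightarrow> T (sum f A) = (\<Sum>i\<in>A. T (f i))"
  by (induction A rule: infinite_finite_induct) (auto simp: filt_lin_zero filt_lin_add)

lemma filt_lin_id [intro]: "filt_lin 0 (\<lambda>x. x)"
  by (simp add: filt_lin_def)

lemma filt_lin_comp:
  "filt_lin r S \<Longrightarrow> filt_lin s T \<Longrightarrow> filt_lin (r + s) (\<lambda>x. S (T x))"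
  by (auto simp: filt_lin_def add.assoc[symmetric] add.commute[of r])

lemma filt_lin_minus:
  "filt_lin r S \<Longrightarrow> filt_lin r T \<Longrightarrow> filt_lin r (\<lambda>x. S x - T x)"
  by (auto simp: filt_lin_def scaleQ_diff algebra_simps intro: ncfilt_diff)

lemma filt_lin_weaken: "filt_lin r S \<Longrightarrow> filt_lin 0 S"
  by (auto simp: filt_lin_def ncfilt_def)

lemma filt_lin_pow:
  fixes T :: "'x ncseries \<Rightarrow> 'x ncseries"
  shows "filt_lin 1 T \<Longrightarrow> filt_lin k (T ^^ k)"
proof (induction k)
  case 0 show ?case using filt_lin_id by (simp add: filt_lin_def)
next
  case (Suc k)
  from filt_lin_comp[OF Suc.prems Suc.IH[OF Suc.prems]] show ?case by (simp add: o_def)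
qed

lemma filt_lin_mult_left: "coeff x [] = 0 \<Longrightarrow> filt_lin 1 ((*) x)"
  by (intro filt_linI) (auto simp: distrib_left dest: ncfilt_mult[of x 1, unfolded ncfilt_1 One_nat_def])

lemma filt_lin_mult_left0: "filt_lin 0 ((*) x)"
  by (intro filt_linI) (auto simp: distrib_left dest: ncfilt_mult[OF ncfilt_0])

lemma filt_lin_mult_right: "filt_lin 0 (\<lambda>y. y * x)"
  by (intro filt_linI) (auto simp: distrib_right dest: ncfilt_mult[OF _ ncfilt_0])


subsection \<open>Formal power series in an operator\<close>

text \<open>Since \<open>T\<^sup>k y\<close> has order at least \<open>k\<close>, a longer truncation only adds zeros. A truncation that does
  not depend on the word is what allows series to be multiplied and exchanged with linear maps.\<close>

lemma coeff_fps_op: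
  assumes "filt_lin 1 T" "length w \<le> n"
  shows "coeff (fps_op F T y) w = (\<Sum>k\<le>n. fps_nth F k * coeff ((T ^^ k) y) w)"
  unfolding fps_op_def ncseries.sel
proof (rule sum.mono_neutral_left)
  have "(T ^^ k) y \<in> ncfilt k" for k
    using filt_lin_filt[OF filt_lin_pow[OF assms(1)] ncfilt_0, of k y] by simp
  thus "\<forall>i\<in>{..n} - {..length w}. fps_nth F i * coeff ((T ^^ i) y) w = 0"
    by (auto simp: ncfilt_def)
qed (use assms in auto)

lemma fps_op_approx:
  assumes "filt_lin 1 T"
  shows "fps_op F T y - (\<Sum>k\<le>n. fps_nth F k *\<^sub>Q (T ^^ k) y) \<in> ncfilt (Suc n)"
  by (rule ncfiltI) (simp add: coeff_fps_op[OF assms])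

lemma coeff_filt_lin_fps_op:
  assumes "filt_lin 1 T" "filt_lin 0 Q" "length w \<le> n"
  shows "coeff (Q (fps_op F T y)) w = (\<Sum>k\<le>n. fps_nth F k * coeff (Q ((T ^^ k) y)) w)"
proof -
  have "Q (fps_op F T y) - Q (\<Sum>k\<le>n. fps_nth F k *\<^sub>Q (T ^^ k) y) \<in> ncfilt (Suc n)"
    using filt_lin_filt[OF assms(2) fps_op_approx[OF assms(1), of F y n]]
    by (simp add: filt_lin_diff[OF assms(2)])
  from ncfiltD[OF this, of w] assms(3) show ?thesis
    by (simp add: filt_lin_sum[OF assms(2)] filt_lin_scale[OF assms(2)])
qed

text \<open>Every compatibility of \<open>exp\<close> and of series in \<open>ad y\<close> with homomorphisms, multiplications and
  conjugations is an instance of this.\<close>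

lemma filt_lin_fps_op_commute:
  assumes "filt_lin 1 T" "filt_lin 1 T'" "filt_lin 0 Q" "\<And>v. Q (T v) = T' (Q v)"
  shows "Q (fps_op F T y) = fps_op F T' (Q y)"
proof (rule ncseries_eqI)
  fix w
  have "Q ((T ^^ k) y) = (T' ^^ k) (Q y)" for k by (induction k) (auto simp: assms(4))
  thus "coeff (Q (fps_op F T y)) w = coeff (fps_op F T' (Q y)) w"
    by (simp add: coeff_filt_lin_fps_op[OF assms(1,3) order.refl] coeff_fps_op[OF assms(2) order.refl])
qed

lemma fps_op_linear:
  assumes "filt_lin 1 T"
  shows "fps_op F T (x + y) = fps_op F T x + fps_op F T y"
    and "fps_op F T (q *\<^sub>Q x) = q *\<^sub>Q fps_op F T x"
    and "fps_op F T (x - y) = fps_op F T x - fps_op F T y"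
    and "fps_op F T (- x) = - fps_op F T x"
    and "fps_op F T 0 = 0"
proof -
  note p = filt_lin_pow[OF assms]
  show "fps_op F T (x + y) = fps_op F T x + fps_op F T y"
    by (rule ncseries_eqI) (simp add: fps_op_def filt_lin_add[OF p] distrib_left sum.distrib)
  show s: "fps_op F T (q *\<^sub>Q x) = q *\<^sub>Q fps_op F T x" for q x
    by (rule ncseries_eqI) (simp add: fps_op_def filt_lin_scale[OF p] sum_distrib_left algebra_simps)
  show "fps_op F T (x - y) = fps_op F T x - fps_op F T y"
    by (rule ncseries_eqI) (simp add: fps_op_def filt_lin_diff[OF p] right_diff_distrib sum_subtractf)
  show "fps_op F T (- x) = - fps_op F T x" using s[of "-1" x] by simp
  show "fps_op F T 0 = 0" using s[of 0 0] by simp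
qed

lemma fps_op_add: "fps_op (F + G) T y = fps_op F T y + fps_op G T y"
  and fps_op_diff: "fps_op (F - G) T y = fps_op F T y - fps_op G T y"
  and fps_op_uminus: "fps_op (- F) T y = - fps_op F T y"
  by (rule ncseries_eqI, simp add: fps_op_def algebra_simps sum.distrib sum_subtractf sum_negf)+

text \<open>Power series in one operator multiply like power series; identities between functions of \<open>ad y\<close>
  therefore reduce to identities between rational power series.\<close>

lemma fps_op_mult:
  assumes "filt_lin 1 T"
  shows "fps_op (F * G) T y = fps_op F T (fps_op G T y)"
proof (rule ncseries_eqI)
  fix w :: "'a list"
  let ?n = "length w"
  let ?t = "\<lambda>k j. fps_nth F k * fps_nth G j * coeff ((T ^^ (k + j)) y) w"
  have z: "coeff ((T ^^ (k + j)) y) w = 0" if "\<not> k + j \<le> ?n" for k j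
    using ncfiltD[OF filt_lin_filt[OF filt_lin_pow[OF assms] ncfilt_0, of "k + j" y], of w] that by simp
  have "coeff (fps_op F T (fps_op G T y)) w = (\<Sum>k\<le>?n. \<Sum>j\<le>?n. ?t k j)"
    unfolding coeff_fps_op[OF assms order.refl]
      coeff_filt_lin_fps_op[OF assms filt_lin_weaken[OF filt_lin_pow[OF assms]] order.refl]
    by (simp add: funpow_add sum_distrib_left algebra_simps)
  also have "\<dots> = (\<Sum>(k, j)\<in>{..?n} \<times> {..?n}. ?t k j)"
    by (simp add: sum.cartesian_product)
  also have "\<dots> = (\<Sum>(k, j)\<in>{(k, j). k + j \<le> ?n}. ?t k j)"
    by (rule sum.mono_neutral_right) (auto intro!: z)
  also have "\<dots> = (\<Sum>k\<le>?n. \<Sum>i\<le>k. ?t i (k - i))"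
    by (rule sum.triangle_reindex_eq)
  also have "\<dots> = coeff (fps_op (F * G) T y) w"
    by (simp add: fps_op_def fps_mult_nth sum_distrib_right atLeast0AtMost)
  finally show "coeff (fps_op (F * G) T y) w = coeff (fps_op F T (fps_op G T y)) w" by simp
qed

lemma fps_op_const [simp]: "fps_op (fps_const c) T y = c *\<^sub>Q y"
proof (rule ncseries_eqI)
  fix w
  have "coeff (fps_op (fps_const c) T y) w = (\<Sum>k\<in>{0}. fps_nth (fps_const c) k * coeff ((T ^^ k) y) w)"
    unfolding fps_op_def ncseries.sel by (rule sum.mono_neutral_right) auto
  thus "coeff (fps_op (fps_const c) T y) w = coeff (c *\<^sub>Q y) w" by simp
qed

lemma fps_op_1 [simp]: "fps_op 1 T y = y"
  using fps_op_const[of 1 T y] by simp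

lemma fps_op_X:
  assumes "filt_lin 1 T" shows "fps_op fps_X T y = T y"
proof (rule ncseries_eqI)
  fix w
  have "coeff (fps_op fps_X T y) w = (\<Sum>k\<in>{1}. fps_nth fps_X k * coeff ((T ^^ k) y) w)"
    unfolding coeff_fps_op[OF assms le_SucI[OF order.refl]]
    by (rule sum.mono_neutral_right) auto
  thus "coeff (fps_op fps_X T y) w = coeff (T y) w" by simp
qed

lemma fps_op_filt:
  assumes "filt_lin 1 T" "y \<in> ncfilt k" shows "fps_op F T y \<in> ncfilt k"
proof (rule ncfiltI)
  fix w :: "'a list" assume w: "length w < k"
  have "(T ^^ j) y \<in> ncfilt k" for j
    using filt_lin_filt[OF filt_lin_weaken[OF filt_lin_pow[OF assms(1)]] assms(2)] by simp
  thus "coeff (fps_op F T y) w = 0" using w by (simp add: fps_op_def ncfilt_def)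
qed

lemma fps_op_invertible:
  assumes "filt_lin 1 T" "fps_nth F 0 \<noteq> 0" "fps_op F T y = 0" shows "y = 0"
  using assms fps_op_mult[OF assms(1), of "inverse F" F y]
  by (simp add: inverse_mult_eq_1 fps_op_linear)


subsection \<open>Substitution of a series into a power series; exponential and logarithm\<close>

text \<open>Evaluation at \<open>x\<close> is a ring homomorphism that respects composition of power series, so the
  functional equations of \<open>exp\<close> and \<open>log\<close> are inherited from the commutative case.\<close>

definition nceval :: "'x ncseries \<Rightarrow> rat fps \<Rightarrow> 'x ncseries" where
  "nceval x F = fps_op F ((*) x) 1"

lemma ncs_exp_eq: "ncs_exp x = nceval x (fps_exp 1)"
  and ncs_log_eq: "ncs_log y = nceval (y - 1) (fps_ln 1)"
  by (simp_all add: nceval_def ncs_exp_def ncs_log_def)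

lemma mult_pow_one: "(((*) x) ^^ k) 1 = (x :: 'x ncseries) ^ k"
  by (induction k) auto

lemma coeff_nceval_Nil [simp]: "coeff (nceval x F) [] = fps_nth F 0"
  by (simp add: nceval_def fps_op_def)

lemma coeff_nceval:
  "coeff x [] = 0 \<Longrightarrow> length w \<le> n \<Longrightarrow> coeff (nceval x F) w = (\<Sum>k\<le>n. fps_nth F k * coeff (x ^ k) w)"
  unfolding nceval_def by (subst coeff_fps_op[OF filt_lin_mult_left, of x w n]) (auto simp: mult_pow_one)

lemma fps_op_mult_left:
  assumes "coeff x [] = 0" shows "fps_op F ((*) x) y = nceval x F * y"
  unfolding nceval_def
  using filt_lin_fps_op_commute[OF filt_lin_mult_left[OF assms] filt_lin_mult_left[OF assms]
      filt_lin_mult_right[of y], of F 1]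
  by (simp add: mult.assoc)

lemma nceval_mult: "coeff x [] = 0 \<Longrightarrow> nceval x (F * G) = nceval x F * nceval x G"
  using fps_op_mult[OF filt_lin_mult_left, of x F G 1] fps_op_mult_left[of x F "nceval x G"]
  by (simp add: nceval_def)

lemma nceval_add: "nceval x (F + G) = nceval x F + nceval x G"
  and nceval_diff: "nceval x (F - G) = nceval x F - nceval x G"
  and nceval_1 [simp]: "nceval x 1 = 1"
  by (simp_all add: nceval_def fps_op_add fps_op_diff)

lemma nceval_const [simp]: "nceval x (fps_const c) = c *\<^sub>Q 1"
  by (simp add: nceval_def)

lemma nceval_X [simp]: "coeff x [] = 0 \<Longrightarrow> nceval x fps_X = x"
  unfolding nceval_def by (subst fps_op_X[OF filt_lin_mult_left]) auto

lemma nceval_power: "coeff x [] = 0 \<Longrightarrow> nceval x (F ^ k) = nceval x F ^ k"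
  by (induction k) (simp_all add: nceval_mult)

lemma nceval_compose:
  assumes "coeff x [] = 0" "fps_nth G 0 = 0"
  shows "nceval (nceval x G) F = nceval x (F oo G)"
proof (rule ncseries_eqI)
  fix w :: "'a list"
  let ?n = "length w"
  have *: "fps_nth (G ^ i) k = 0" if "k < i" for i k
    using assms(2) that startsby_zero_power_prefix by blast
  have "coeff (nceval (nceval x G) F) w = (\<Sum>i\<le>?n. fps_nth F i * coeff (nceval x (G ^ i)) w)"
    using assms by (subst coeff_nceval[where n = ?n]) (simp_all add: nceval_power)
  also have "\<dots> = (\<Sum>i\<le>?n. \<Sum>k\<le>?n. fps_nth F i * (fps_nth (G ^ i) k * coeff (x ^ k) w))"
    by (simp add: coeff_nceval[OF assms(1), of w ?n] sum_distrib_left)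
  also have "\<dots> = (\<Sum>k\<le>?n. \<Sum>i\<le>?n. fps_nth F i * (fps_nth (G ^ i) k * coeff (x ^ k) w))"
    by (rule sum.swap)
  also have "\<dots> = (\<Sum>k\<le>?n. fps_nth (F oo G) k * coeff (x ^ k) w)"
  proof (rule sum.cong[OF refl])
    fix k assume "k \<in> {..?n}"
    hence "(\<Sum>i\<le>?n. fps_nth F i * (fps_nth (G ^ i) k * coeff (x ^ k) w))
        = (\<Sum>i\<in>{0..k}. fps_nth F i * (fps_nth (G ^ i) k * coeff (x ^ k) w))"
      by (intro sum.mono_neutral_right) (auto simp: *)
    thus "(\<Sum>i\<le>?n. fps_nth F i * (fps_nth (G ^ i) k * coeff (x ^ k) w))
        = fps_nth (F oo G) k * coeff (x ^ k) w"
      by (simp add: fps_compose_nth sum_distrib_right mult.assoc)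
  qed
  also have "\<dots> = coeff (nceval x (F oo G)) w" by (simp add: coeff_nceval[OF assms(1) order.refl])
  finally show "coeff (nceval (nceval x G) F) w = coeff (nceval x (F oo G)) w" .
qed

lemma fps_ln_1_eq: "fps_ln (1 :: rat) = fps_inv (fps_exp 1 - 1)"
  by (rule fps_ln_fps_exp_inv) simp

lemma coeff_exp_Nil [simp]: "coeff (ncs_exp x) [] = 1"
  and coeff_log_Nil [simp]: "coeff (ncs_log x) [] = 0"
  by (simp_all add: ncs_exp_eq ncs_log_eq fps_ln_nth)

lemma exp_log:
  assumes "coeff y [] = 1" shows "ncs_exp (ncs_log y) = y"
proof -
  have "(fps_exp 1 oo fps_ln 1 :: rat fps) = ((fps_exp 1 - 1) oo fps_ln 1) + (1 oo fps_ln 1)"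
    by (subst fps_compose_add_distrib[symmetric]) simp
  also have "\<dots> = fps_X + 1" by (simp add: fps_ln_1_eq fps_inv_fps_exp_compose)
  finally show ?thesis
    unfolding ncs_exp_eq ncs_log_eq using assms
    by (subst nceval_compose) (simp_all add: fps_ln_nth nceval_add)
qed

lemma log_exp:
  assumes "coeff x [] = 0" shows "ncs_log (ncs_exp x) = x"
proof -
  have "ncs_exp x - 1 = nceval x (fps_exp 1 - 1)" by (simp add: ncs_exp_eq nceval_diff)
  hence "ncs_log (ncs_exp x) = nceval x (fps_ln 1 oo (fps_exp 1 - 1))"
    unfolding ncs_log_eq using assms by (simp add: nceval_compose)
  thus ?thesis using assms by (simp add: fps_ln_1_eq fps_inv_fps_exp_compose)
qed

lemma exp_scale:
  assumes "coeff x [] = 0" shows "ncs_exp (c *\<^sub>Q x) = nceval x (fps_exp c)"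
proof -
  have "c *\<^sub>Q x = nceval x (fps_const c * fps_X)" using assms by (simp add: nceval_mult)
  thus ?thesis unfolding ncs_exp_eq using assms by (simp add: nceval_compose)
qed

lemma exp_scale_add:
  "coeff x [] = 0 \<Longrightarrow> ncs_exp ((c + d) *\<^sub>Q x) = ncs_exp (c *\<^sub>Q x) * ncs_exp (d *\<^sub>Q x)"
  by (simp add: exp_scale fps_exp_add_mult nceval_mult)

lemma exp_zero [simp]: "ncs_exp 0 = 1"
  using exp_scale[of 0 0] by simp

lemma exp_minus_mult [simp]: "coeff x [] = 0 \<Longrightarrow> ncs_exp (- x) * ncs_exp x = 1"
  using exp_scale_add[of x "-1" 1] by simp

lemma exp_mult_minus [simp]: "coeff x [] = 0 \<Longrightarrow> ncs_exp x * ncs_exp (- x) = 1"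
  using exp_scale_add[of x 1 "-1"] by simp

lemma exp_minus_mult2 [simp]: "coeff x [] = 0 \<Longrightarrow> ncs_exp (- x) * (ncs_exp x * y) = y"
  "coeff x [] = 0 \<Longrightarrow> ncs_exp x * (ncs_exp (- x) * y) = y"
  by (simp_all flip: mult.assoc)

lemma exp_half_half: "coeff x [] = 0 \<Longrightarrow> ncs_exp ((1/2) *\<^sub>Q x) * ncs_exp ((1/2) *\<^sub>Q x) = ncs_exp x"
  using exp_scale_add[of x "1/2" "1/2"] by simp

lemma exp_eqD:
  "ncs_exp x = ncs_exp y \<Longrightarrow> coeff x [] = 0 \<Longrightarrow> coeff y [] = 0 \<Longrightarrow> x = y"
  by (metis log_exp)

lemma coeff_prod_list_exp: "coeff (prod_list (map ncs_exp xs)) [] = 1"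
  by (induction xs) auto

lemma coeff_BCH_Nil [simp]: "coeff (BCH xs) [] = 0"
  by (simp add: BCH_def)

lemma exp_BCH: "ncs_exp (BCH xs) = prod_list (map ncs_exp xs)"
  by (simp add: BCH_def exp_log coeff_prod_list_exp)


section \<open>Derivations and exponentials\<close>

text \<open>Applied to \<open>ad y\<close>, this series gives the logarithmic derivative of the exponential at \<open>y\<close>.\<close>

definition psi :: "rat fps" where "psi = (1 - fps_exp (- 1)) / fps_X"

lemma psi_nth: "fps_nth psi k = (- 1) ^ k / fact (Suc k)"
  by (simp add: psi_def algebra_simps)

lemma psi_X: "psi * fps_X = 1 - fps_exp (- 1)"
  by (rule fps_ext) (auto simp: psi_def)

definition comm :: "'x ncseries \<Rightarrow> 'x ncseries \<Rightarrow> 'x ncseries" where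
  "comm y v = y * v - v * y"

lemma filt_lin_comm:
  assumes "coeff y [] = 0" shows "filt_lin 1 (comm y)"
proof (rule filt_linI)
  fix k and x :: "'a ncseries" assume x: "x \<in> ncfilt k"
  have y: "y \<in> ncfilt 1" using assms by (simp add: ncfilt_1)
  from ncfilt_mult[OF x y] ncfilt_mult[OF y x] show "comm y x \<in> ncfilt (k + 1)"
    by (auto simp: comm_def intro: ncfilt_diff)
qed (simp_all add: comm_def algebra_simps scaleQ_diff)

text \<open>Left and right multiplication by \<open>y\<close> commute and their difference is \<open>ad y\<close>, so this is the
  binomial theorem for \<open>R = L - ad y\<close>.\<close>

lemma mult_pow_right:
  "v * y ^ n = (\<Sum>k\<le>n. (of_nat (n choose k) * (- 1) ^ k) *\<^sub>Q (y ^ (n - k) * (comm y ^^ k) v))"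
proof (induction n)
  case 0 show ?case by simp
next
  case (Suc n)
  define t where "t = (\<lambda>m k. y ^ m * (comm y ^^ k) v)"
  define b where "b = (\<lambda>n k. of_nat (n choose k) * (- 1) ^ k :: rat)"
  have t: "t m k * y = t (Suc m) k - t m (Suc k)" for m k
    by (simp add: t_def comm_def power_Suc2 right_diff_distrib mult.assoc del: power_Suc)
  have "v * y ^ Suc n = v * y ^ n * y"
    by (simp add: power_Suc2 mult.assoc del: power_Suc)
  also have "\<dots> = (\<Sum>k\<le>n. b n k *\<^sub>Q t (n - k) k) * y"
    unfolding Suc t_def b_def ..
  also have "\<dots> = (\<Sum>k\<le>n. b n k *\<^sub>Q t (Suc n - k) k) - (\<Sum>k\<le>n. b n k *\<^sub>Q t (n - k) (Suc k))"
    by (simp add: sum_distrib_right t scaleQ_diff sum_subtractf Suc_diff_le)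
  also have "(\<Sum>k\<le>n. b n k *\<^sub>Q t (Suc n - k) k) = (\<Sum>k\<le>Suc n. b n k *\<^sub>Q t (Suc n - k) k)"
    by (simp add: b_def)
  also have "\<dots> = t (Suc n) 0 + (\<Sum>k\<le>n. b n (Suc k) *\<^sub>Q t (n - k) (Suc k))"
    by (subst sum.atMost_Suc_shift) (simp add: b_def)
  also have "\<dots> - (\<Sum>k\<le>n. b n k *\<^sub>Q t (n - k) (Suc k))
      = t (Suc n) 0 + (\<Sum>k\<le>n. b (Suc n) (Suc k) *\<^sub>Q t (n - k) (Suc k))"
  proof -
    have "b n (Suc k) - b n k = b (Suc n) (Suc k)" for k by (simp add: b_def algebra_simps)
    thus ?thesis by (simp only: add_diff_eq[symmetric] sum_subtractf[symmetric] scaleQ_diff(2)[symmetric])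
  qed
  also have "\<dots> = (\<Sum>k\<le>Suc n. b (Suc n) k *\<^sub>Q t (Suc n - k) k)"
    by (subst sum.atMost_Suc_shift) (simp add: b_def)
  finally show ?case unfolding t_def b_def .
qed

text \<open>In \<open>Q (y\<^sup>n\<^sup>+\<^sup>1) = Q y * y\<^sup>n + y * Q (y\<^sup>n)\<close> the first term is expanded by the previous lemma; the two
  sums combine by the rule of Pascal.\<close>

lemma leibniz_pow:
  assumes Q: "filt_lin r Q" "Q 1 = 0" and leib: "\<And>z. Q (y * z) = Q y * z + y * Q z"
  shows "Q (y ^ Suc n)
    = (\<Sum>k\<le>n. (of_nat (Suc n choose Suc k) * (- 1) ^ k) *\<^sub>Q (y ^ (n - k) * (comm y ^^ k) (Q y)))"
proof (induction n)
  case 0 show ?case using leib[of 1] Q(2) by simp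
next
  case (Suc n)
  define t where "t = (\<lambda>m k. y ^ m * (comm y ^^ k) (Q y))"
  define b where "b = (\<lambda>n k. of_nat (n choose Suc k) * (- 1) ^ k :: rat)"
  have "Q (y ^ Suc (Suc n)) = Q y * y ^ Suc n + y * Q (y ^ Suc n)"
    by (simp add: leib)
  also have "y * Q (y ^ Suc n) = (\<Sum>k\<le>n. b (Suc n) k *\<^sub>Q t (Suc n - k) k)"
    unfolding Suc b_def t_def by (simp add: sum_distrib_left Suc_diff_le mult.assoc)
  also have "\<dots> = (\<Sum>k\<le>Suc n. b (Suc n) k *\<^sub>Q t (Suc n - k) k)"
    using binomial_eq_0[of "Suc n" "Suc (Suc n)"] by (simp add: b_def del: binomial_Suc_Suc)
  also have "Q y * y ^ Suc n
      = (\<Sum>k\<le>Suc n. (of_nat (Suc n choose k) * (- 1) ^ k) *\<^sub>Q t (Suc n - k) k)"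
    unfolding mult_pow_right t_def by simp
  also have "\<dots> + (\<Sum>k\<le>Suc n. b (Suc n) k *\<^sub>Q t (Suc n - k) k)
      = (\<Sum>k\<le>Suc n. b (Suc (Suc n)) k *\<^sub>Q t (Suc n - k) k)"
    unfolding sum.distrib[symmetric] scaleQ_add(2)[symmetric] b_def
      binomial_Suc_Suc[of "Suc n"] of_nat_add distrib_right ..
  finally show ?case unfolding t_def b_def .
qed

text \<open>By the binomial expansion above, \<open>Q (y\<^sup>n) / n!\<close> is the part of degree \<open>n - 1\<close> of a Cauchy product
  of \<open>exp y\<close> with \<open>psi (ad y) (Q y)\<close>. The Leibniz rule is required only for left multiplication by
  this \<open>y\<close>: so \<open>Q\<close> may be a derivation, an odd derivation when \<open>y\<close> is even, the commutator with a
  fixed element, or a difference of two of these.\<close>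

theorem exp_deriv:
  assumes y: "coeff y [] = 0" and Q: "filt_lin 0 Q" "Q 1 = 0"
    and leib: "\<And>z. Q (y * z) = Q y * z + y * Q z"
  shows "Q (ncs_exp y) = ncs_exp y * fps_op psi (comm y) (Q y)"
proof (rule ncseries_eqI)
  fix w :: "'a list"
  let ?n = "length w" and ?A = "comm y" and ?v = "Q y"
  note A = filt_lin_comm[OF y] and L = filt_lin_mult_left[OF y]
  let ?t = "\<lambda>j k. (1 / fact j) * fps_nth psi k * coeff (y ^ j * (?A ^^ k) ?v) w"
  have z: "coeff (y ^ j * (?A ^^ k) ?v) w = 0" if "\<not> j + k \<le> ?n" for j k
  proof -
    have "y ^ j \<in> ncfilt j"
      using filt_lin_filt[OF filt_lin_pow[OF L] ncfilt_0, of j 1] by (simp add: mult_pow_one)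
    moreover have "(?A ^^ k) ?v \<in> ncfilt k"
      using filt_lin_filt[OF filt_lin_pow[OF A] ncfilt_0, of k ?v] by simp
    ultimately show ?thesis using ncfiltD[OF ncfilt_mult, of "y ^ j" j _ k w] that by simp
  qed
  have pl: "((*) y ^^ j) u = y ^ j * u" for j u by (induction j) (simp_all add: mult.assoc)
  have "coeff (ncs_exp y * fps_op psi ?A ?v) w = coeff (fps_op (fps_exp 1) ((*) y) (fps_op psi ?A ?v)) w"
    by (simp add: fps_op_mult_left[OF y] ncs_exp_eq)
  also have "\<dots> = (\<Sum>j\<le>?n. \<Sum>k\<le>?n. ?t j k)"
    unfolding coeff_fps_op[OF L order.refl] pl
      coeff_filt_lin_fps_op[OF A filt_lin_mult_left0 order.refl]
    by (simp add: sum_distrib_left algebra_simps)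
  also have "\<dots> = (\<Sum>(j, k)\<in>{..?n} \<times> {..?n}. ?t j k)"
    by (simp add: sum.cartesian_product)
  also have "\<dots> = (\<Sum>(j, k)\<in>{(j, k). j + k \<le> ?n}. ?t j k)"
    by (rule sum.mono_neutral_right) (auto intro!: z)
  also have "\<dots> = (\<Sum>(k, j)\<in>{(k, j). k + j \<le> ?n}. ?t j k)"
    by (rule sum.reindex_bij_witness[where i = "\<lambda>(a, b). (b, a)" and j = "\<lambda>(a, b). (b, a)"]) auto
  also have "\<dots> = (\<Sum>n\<le>?n. \<Sum>k\<le>n. ?t (n - k) k)"
    by (rule sum.triangle_reindex_eq)
  also have "\<dots> = (\<Sum>n\<le>?n. (1 / fact (Suc n)) * coeff (Q (y ^ Suc n)) w)"
  proof (rule sum.cong[OF refl])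
    fix n
    have "?t (n - k) k = (1 / fact (Suc n)) * ((of_nat (Suc n choose Suc k) * (- 1) ^ k)
        * coeff (y ^ (n - k) * (?A ^^ k) ?v) w)" if "k \<le> n" for k
    proof -
      have "of_nat (Suc n choose Suc k) = fact (Suc n) / (fact (Suc k) * fact (n - k) :: rat)"
        using binomial_fact[of "Suc k" "Suc n", where ?'a = rat] that by (simp only: diff_Suc_Suc Suc_le_mono)
      thus ?thesis by (simp add: psi_nth del: binomial_Suc_Suc fact_Suc)
    qed
    thus "(\<Sum>k\<le>n. ?t (n - k) k) = (1 / fact (Suc n)) * coeff (Q (y ^ Suc n)) w"
      unfolding leibniz_pow[OF Q leib] coeff_sum coeff_scaleQ sum_distrib_left by (intro sum.cong) auto
  qed
  also have "\<dots> = (\<Sum>n\<le>Suc ?n. fps_nth (fps_exp 1) n * coeff (Q (y ^ n)) w)"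
    by (subst sum.atMost_Suc_shift) (simp add: Q algebra_simps)
  also have "\<dots> = coeff (Q (ncs_exp y)) w"
    unfolding ncs_exp_def coeff_filt_lin_fps_op[OF L Q(1) le_SucI[OF order.refl]] mult_pow_one ..
  finally show "coeff (Q (ncs_exp y)) w = coeff (ncs_exp y * fps_op psi ?A ?v) w" by simp
qed

text \<open>The constant term of \<open>psi\<close> is \<open>1\<close>, so \<open>psi (ad y)\<close> is invertible.\<close>

lemma exp_deriv_eq_zero_iff:
  assumes y: "coeff y [] = 0" and Q: "filt_lin 0 Q" "Q 1 = 0"
    and leib: "\<And>z. Q (y * z) = Q y * z + y * Q z"
  shows "Q (ncs_exp y) = 0 \<longleftrightarrow> Q y = 0"
proof
  assume "Q (ncs_exp y) = 0"
  hence "ncs_exp (- y) * (ncs_exp y * fps_op psi (comm y) (Q y)) = 0"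
    using exp_deriv[OF assms] by simp
  hence "fps_op psi (comm y) (Q y) = 0" using y by simp
  thus "Q y = 0" by (rule fps_op_invertible[OF filt_lin_comm[OF y], rotated]) (simp add: psi_nth)
qed (simp add: exp_deriv[OF assms] fps_op_linear(5)[OF filt_lin_comm[OF y]])

text \<open>The previous theorem for \<open>D z = z v - v z\<close>.\<close>

lemma exp_ad:
  assumes y: "coeff y [] = 0"
  shows "fps_op (fps_exp (- 1)) (comm y) v = ncs_exp (- y) * v * ncs_exp y"
proof -
  let ?Q = "\<lambda>z. z * v - v * z"
  note A = filt_lin_comm[OF y]
  have "?Q (ncs_exp y) = ncs_exp y * fps_op psi (comm y) (comm y v)"
    unfolding comm_def[of y v]
    by (rule exp_deriv[OF y filt_lin_minus[OF filt_lin_mult_right filt_lin_mult_left0]])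
      (simp_all add: algebra_simps)
  also have "fps_op psi (comm y) (comm y v) = v - fps_op (fps_exp (- 1)) (comm y) v"
    using fps_op_mult[OF A, of psi fps_X v]
    by (simp add: psi_X fps_op_X[OF A] fps_op_diff)
  finally have "ncs_exp (- y) * (v * ncs_exp y)
      = ncs_exp (- y) * (ncs_exp y * fps_op (fps_exp (- 1)) (comm y) v)"
    by (simp add: algebra_simps)
  thus ?thesis using y by (simp add: mult.assoc)
qed


section \<open>Maps determined by their values on the letters\<close>

definition lquot :: "'x \<Rightarrow> 'x ncseries \<Rightarrow> 'x ncseries" where
  "lquot s z = NCSeries (\<lambda>w. coeff z (s # w))"

lemma coeff_lquot [simp]: "coeff (lquot s z) w = coeff z (s # w)"
  by (simp add: lquot_def)

lemma lquot_linear [simp]: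
  "lquot s (x + y) = lquot s x + lquot s y" "lquot s (x - y) = lquot s x - lquot s y"
  "lquot s (q *\<^sub>Q x) = q *\<^sub>Q lquot s x" "lquot s 0 = 0" "lquot s 1 = 0"
  by (rule ncseries_eqI, simp add: coeff_1)+

lemma lquot_sum: "lquot s (sum f A) = (\<Sum>i\<in>A. lquot s (f i))"
  by (rule ncseries_eqI) simp

lemma lquot_gen: "lquot s (gen t) = (if s = t then 1 else 0)"
  by (rule ncseries_eqI) (auto simp: coeff_gen coeff_1)

lemma lquot_mult: "lquot s (x * y) = lquot s x * y + coeff x [] *\<^sub>Q lquot s y"
  by (rule ncseries_eqI) (simp add: coeff_times sum.atMost_Suc_shift del: sum.atMost_Suc)

lemma lquot_filt: "z \<in> ncfilt (Suc k) \<Longrightarrow> lquot s z \<in> ncfilt k"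
  by (auto simp: ncfilt_def)

lemma lquot_eqI: "coeff x [] = coeff y [] \<Longrightarrow> (\<And>s. lquot s x = lquot s y) \<Longrightarrow> x = y"
  by (rule ncseries_eqI) (metis coeff_lquot neq_Nil_conv)

lemma lquot_decomp:
  fixes z :: "'x::finite ncseries"
  shows "z = coeff z [] *\<^sub>Q 1 + (\<Sum>s\<in>UNIV. gen s * lquot s z)"
proof (rule lquot_eqI)
  fix t
  have "(if t = s then 1 else 0) * lquot s z = (if s = t then lquot t z else 0)" for s by auto
  thus "lquot t z = lquot t (coeff z [] *\<^sub>Q 1 + (\<Sum>s\<in>UNIV. gen s * lquot s z))"
    by (simp add: lquot_sum lquot_mult lquot_gen)
qed simp

text \<open>A twisted derivation that vanishes on the letters vanishes. No continuity is needed: the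
  decomposition of a series by first letters shows that \<open>Q z\<close> has order at least \<open>n\<close> for all \<open>n\<close>.\<close>

lemma twisted_derivation_zero:
  fixes Q :: "'x::finite ncseries \<Rightarrow> 'y ncseries"
  assumes add: "\<And>x y. Q (x + y) = Q x + Q y" and one: "\<And>q. Q (q *\<^sub>Q 1) = 0"
    and step: "\<And>s z. Q (gen s * z) = c s * Q z" and c: "\<And>s. coeff (c s) [] = 0"
  shows "Q z = 0"
proof -
  have zero: "Q 0 = 0" using one[of 0] by simp
  have sum: "Q (sum f A) = (\<Sum>i\<in>A. Q (f i))" if "finite A" for f and A :: "'x set"
    using that by (induction A rule: finite_induct) (simp_all add: zero add)
  have "\<forall>z. Q z \<in> ncfilt n" for n
  proof (induction n)
    case (Suc n)
    show ?case
    proof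
      fix z
      have "Q z = (\<Sum>s\<in>UNIV. c s * Q (lquot s z))"
        by (subst lquot_decomp) (simp add: add one sum step)
      moreover have "c s * Q (lquot s z) \<in> ncfilt (1 + n)" for s
        by (rule ncfilt_mult) (use Suc c in \<open>simp_all add: ncfilt_1\<close>)
      ultimately show "Q z \<in> ncfilt (Suc n)" by (auto simp: ncfilt_def)
    qed
  qed simp
  hence "coeff (Q z) w = 0" for w by (rule_tac ncfiltD[of _ "Suc (length w)"]) auto
  thus ?thesis by (intro ncseries_eqI) simp
qed

text \<open>Both the action of the symmetric group and the parity automorphism, which produces the signs of an
  odd derivation, are of this form.\<close>

definition monom_act :: "('x \<Rightarrow> rat) \<Rightarrow> ('x \<Rightarrow> 'x) \<Rightarrow> 'x ncseries \<Rightarrow> 'x ncseries" where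
  "monom_act \<sigma> p z = NCSeries (\<lambda>w. prod_list (map \<sigma> w) * coeff z (map p w))"

lemma coeff_monom_act: "coeff (monom_act \<sigma> p z) w = prod_list (map \<sigma> w) * coeff z (map p w)"
  by (simp add: monom_act_def)

lemma filt_lin_monom_act: "filt_lin 0 (monom_act \<sigma> p)"
  by (rule filt_linI) (auto intro!: ncseries_eqI simp: coeff_monom_act algebra_simps ncfilt_def)

lemma monom_act_mult: "monom_act \<sigma> p (x * y) = monom_act \<sigma> p x * monom_act \<sigma> p y"
proof (rule ncseries_eqI)
  fix w
  have "prod_list (map \<sigma> w) = prod_list (map \<sigma> (take i w)) * prod_list (map \<sigma> (drop i w))" for i
    by (metis append_take_drop_id map_append prod_list.append)
  thus "coeff (monom_act \<sigma> p (x * y)) w = coeff (monom_act \<sigma> p x * monom_act \<sigma> p y) w"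
    unfolding coeff_monom_act coeff_times sum_distrib_left
    by (intro sum.cong) (simp_all add: take_map drop_map algebra_simps)
qed

lemma monom_act_1 [simp]: "monom_act \<sigma> p 1 = 1"
  by (rule ncseries_eqI) (auto simp: coeff_monom_act coeff_1)

lemma coeff_monom_act_Nil [simp]: "coeff (monom_act \<sigma> p z) [] = coeff z []"
  by (simp add: coeff_monom_act)

lemma monom_act_exp:
  assumes "coeff x [] = 0" shows "monom_act \<sigma> p (ncs_exp x) = ncs_exp (monom_act \<sigma> p x)"
  unfolding ncs_exp_def
  by (subst filt_lin_fps_op_commute[where T' = "(*) (monom_act \<sigma> p x)"])
    (use assms in \<open>simp_all add: filt_lin_mult_left[unfolded One_nat_def] filt_lin_monom_act monom_act_mult\<close>)

lemma monom_act_prod_list: "monom_act \<sigma> p (prod_list xs) = prod_list (map (monom_act \<sigma> p) xs)"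
  by (induction xs) (simp_all add: monom_act_mult)

lemma monom_act_BCH:
  assumes "\<And>x. x \<in> set xs \<Longrightarrow> coeff x [] = 0"
  shows "monom_act \<sigma> p (BCH xs) = BCH (map (monom_act \<sigma> p) xs)"
proof (rule exp_eqD)
  show "ncs_exp (monom_act \<sigma> p (BCH xs)) = ncs_exp (BCH (map (monom_act \<sigma> p) xs))"
    using assms
    by (simp add: monom_act_exp[symmetric] exp_BCH monom_act_prod_list comp_def cong: map_cong)
qed simp_all


subsection \<open>Signed derivations\<close>

text \<open>The derivation with values \<open>\<delta> s\<close> on the letters, with the sign \<open>\<epsilon> s\<close> when it passes the
  letter \<open>s\<close>; the definition follows the decomposition of a series by its first letter.\<close>

primrec der_coeff :: "('x \<Rightarrow> rat) \<Rightarrow> ('x \<Rightarrow> 'x ncseries) \<Rightarrow> 'x list \<Rightarrow> 'x ncseries \<Rightarrow> rat" where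
  "der_coeff \<epsilon> \<delta> [] z = 0"
| "der_coeff \<epsilon> \<delta> (t # w) z
    = coeff (\<Sum>s\<in>UNIV. \<delta> s * lquot s z) (t # w) + \<epsilon> t * der_coeff \<epsilon> \<delta> w (lquot t z)"

definition der :: "('x \<Rightarrow> rat) \<Rightarrow> ('x \<Rightarrow> 'x ncseries) \<Rightarrow> 'x ncseries \<Rightarrow> 'x ncseries" where
  "der \<epsilon> \<delta> z = NCSeries (\<lambda>w. der_coeff \<epsilon> \<delta> w z)"

lemma coeff_der_Nil [simp]: "coeff (der \<epsilon> \<delta> z) [] = 0"
  by (simp add: der_def)

lemma lquot_der:
  "lquot t (der \<epsilon> \<delta> z) = lquot t (\<Sum>s\<in>UNIV. \<delta> s * lquot s z) + \<epsilon> t *\<^sub>Q der \<epsilon> \<delta> (lquot t z)"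
  by (rule ncseries_eqI) (simp add: der_def)

lemma filt_lin_der:
  assumes "\<And>s. coeff (\<delta> s) [] = 0" shows "filt_lin 0 (der \<epsilon> \<delta>)"
proof (rule filt_linI)
  fix x y :: "'a ncseries"
  have "der_coeff \<epsilon> \<delta> w (x + y) = der_coeff \<epsilon> \<delta> w x + der_coeff \<epsilon> \<delta> w y" for w
    by (induction w arbitrary: x y) (simp_all add: algebra_simps sum.distrib)
  thus "der \<epsilon> \<delta> (x + y) = der \<epsilon> \<delta> x + der \<epsilon> \<delta> y" by (intro ncseries_eqI) (simp add: der_def)
next
  fix q and x :: "'a ncseries"
  have "der_coeff \<epsilon> \<delta> w (q *\<^sub>Q x) = q * der_coeff \<epsilon> \<delta> w x" for w
    by (induction w arbitrary: x) (simp_all add: algebra_simps sum_distrib_left)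
  thus "der \<epsilon> \<delta> (q *\<^sub>Q x) = q *\<^sub>Q der \<epsilon> \<delta> x" by (intro ncseries_eqI) (simp add: der_def)
next
  fix k and x :: "'a ncseries" assume x: "x \<in> ncfilt k"
  have "der_coeff \<epsilon> \<delta> w x = 0" if "length w < k" "x \<in> ncfilt k" for w
    using that
  proof (induction w arbitrary: x k)
    case (Cons t w)
    then obtain j where k: "k = Suc j" by (cases k) auto
    have "\<delta> s * lquot s x \<in> ncfilt (1 + j)" for s
      by (rule ncfilt_mult) (use assms Cons.prems k in \<open>simp_all add: ncfilt_1 lquot_filt\<close>)
    hence "coeff (\<delta> s * lquot s x) (t # w) = 0" for s
      using Cons.prems k by (intro ncfiltD[of _ "1 + j"]) auto
    moreover have "der_coeff \<epsilon> \<delta> w (lquot t x) = 0"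
      using Cons.prems k by (intro Cons.IH[of j]) (auto simp: lquot_filt)
    ultimately show ?case by simp
  qed simp
  thus "der \<epsilon> \<delta> x \<in> ncfilt (k + 0)" using x by (auto simp: der_def ncfilt_def)
qed

lemma der_mult:
  assumes \<delta>: "\<And>s. coeff (\<delta> s) [] = 0"
  shows "der \<epsilon> \<delta> (x * y) = der \<epsilon> \<delta> x * y + monom_act \<epsilon> (\<lambda>s. s) x * der \<epsilon> \<delta> y"
proof -
  note lin = filt_lin_der[OF \<delta>, where \<epsilon> = \<epsilon>]
  have S: "lquot t (monom_act \<epsilon> (\<lambda>s. s) x) = \<epsilon> t *\<^sub>Q monom_act \<epsilon> (\<lambda>s. s) (lquot t x)" for t x
    by (rule ncseries_eqI) (simp add: coeff_monom_act)
  have "coeff (der \<epsilon> \<delta> (x * y)) w = coeff (der \<epsilon> \<delta> x * y + monom_act \<epsilon> (\<lambda>s. s) x * der \<epsilon> \<delta> y) w" for w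
  proof (induction w arbitrary: x)
    case (Cons t w)
    let ?T = "\<lambda>z. \<Sum>s\<in>UNIV. \<delta> s * lquot s z"
    have T: "?T (x * y) = ?T x * y + coeff x [] *\<^sub>Q ?T y"
      by (simp add: lquot_mult algebra_simps sum.distrib sum_distrib_right ncs.scale_sum_right)
    have T0: "coeff (?T x) [] = 0" for x by (simp add: \<delta>)
    have "coeff (der \<epsilon> \<delta> (x * y)) (t # w) = coeff (lquot t (der \<epsilon> \<delta> (x * y))) w" by simp
    also have "\<dots> = coeff (lquot t (?T x * y + coeff x [] *\<^sub>Q ?T y)) w
        + \<epsilon> t * (coeff (der \<epsilon> \<delta> (lquot t x * y)) w + coeff x [] * coeff (der \<epsilon> \<delta> (lquot t y)) w)"
      unfolding lquot_der T by (simp add: lquot_mult filt_lin_add[OF lin] filt_lin_scale[OF lin])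
    also have "\<dots> = coeff (lquot t (der \<epsilon> \<delta> x * y + monom_act \<epsilon> (\<lambda>s. s) x * der \<epsilon> \<delta> y)) w"
      unfolding Cons.IH
      by (simp add: lquot_mult lquot_der S T0 algebra_simps del: coeff_sum coeff_lquot)
    finally show ?case by simp
  qed simp
  thus ?thesis by (rule ncseries_eqI)
qed

lemma der_0 [simp]: "der \<epsilon> \<delta> 0 = 0"
proof (rule ncseries_eqI)
  fix w show "coeff (der \<epsilon> \<delta> 0) w = coeff 0 w"
    unfolding der_def ncseries.sel by (induction w) simp_all
qed

lemma der_1 [simp]: "der \<epsilon> \<delta> 1 = 0"
proof (rule lquot_eqI)
  show "lquot s (der \<epsilon> \<delta> 1) = lquot s 0" for s by (simp add: lquot_der)
qed simp

lemma der_gen: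
  fixes \<delta> :: "'x::finite \<Rightarrow> 'x ncseries"
  assumes \<delta>: "coeff (\<delta> s) [] = 0" shows "der \<epsilon> \<delta> (gen s) = \<delta> s"
proof (rule lquot_eqI)
  fix t
  have "\<delta> u * (if u = s then 1 else 0) = (if u = s then \<delta> s else 0)" for u by simp
  moreover have "der \<epsilon> \<delta> (if t = s then 1 else 0) = 0" by simp
  ultimately show "lquot t (der \<epsilon> \<delta> (gen s)) = lquot t (\<delta> s)"
    by (simp add: lquot_der lquot_gen)
qed (simp add: \<delta>)

lemma der_cong:
  assumes "\<And>w. \<not> set w \<subseteq> U \<Longrightarrow> coeff z w = 0" "\<And>s. s \<in> U \<Longrightarrow> \<delta> s = \<delta>' s"
  shows "der \<epsilon> \<delta> z = der \<epsilon> \<delta>' z"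
proof -
  have "der_coeff \<epsilon> \<delta> w z = der_coeff \<epsilon> \<delta>' w z" for w
    using assms(1)
  proof (induction w arbitrary: z)
    case (Cons t w)
    have "\<delta> s * lquot s z = \<delta>' s * lquot s z" for s
    proof (cases "s \<in> U")
      case False
      hence "lquot s z = 0" by (intro ncseries_eqI) (simp add: Cons.prems)
      thus ?thesis by simp
    qed (simp add: assms(2))
    moreover have "der_coeff \<epsilon> \<delta> w (lquot t z) = der_coeff \<epsilon> \<delta>' w (lquot t z)"
    proof (rule Cons.IH)
      fix w' assume "\<not> set w' \<subseteq> U"
      thus "coeff (lquot t z) w' = 0" using Cons.prems[of "t # w'"] by auto
    qed
    ultimately show ?case by simp
  qed simp
  thus ?thesis by (simp add: der_def)
qed


section \<open>The completed free graded Lie algebra on the cells\<close>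

instance vertex :: finite
proof
  have "x \<in> {Va, Vb, Vc}" for x by (cases x) auto
  hence "(UNIV :: vertex set) \<subseteq> {Va, Vb, Vc}" by blast
  thus "finite (UNIV :: vertex set)" by (rule finite_subset) simp
qed

instance cell :: finite
proof
  have "x \<in> insert Face (range Vert \<union> range Edge)" for x by (cases x) auto
  hence "(UNIV :: cell set) \<subseteq> insert Face (range Vert \<union> range Edge)" by blast
  thus "finite (UNIV :: cell set)" by (rule finite_subset) simp
qed

subsection \<open>Supports\<close>

definition ncsupp :: "'x ncseries \<Rightarrow> 'x list set" where
  "ncsupp x = {w. coeff x w \<noteq> 0}"

lemma ncsupp_subset: "ncsupp x \<subseteq> A \<longleftrightarrow> (\<forall>w. w \<notin> A \<longrightarrow> coeff x w = 0)"
  by (auto simp: ncsupp_def)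

lemma ncsupp_mult:
  assumes "ncsupp x \<subseteq> A" "ncsupp y \<subseteq> B" "\<And>u v. u \<in> A \<Longrightarrow> v \<in> B \<Longrightarrow> u @ v \<in> C"
  shows "ncsupp (x * y) \<subseteq> C"
proof
  fix w assume w: "w \<in> ncsupp (x * y)"
  have "\<exists>i. coeff x (take i w) * coeff y (drop i w) \<noteq> 0"
  proof (rule ccontr)
    assume "\<not> ?thesis"
    hence "coeff (x * y) w = 0" unfolding coeff_times by (intro sum.neutral) blast
    thus False using w by (simp add: ncsupp_def)
  qed
  then obtain i where "take i w \<in> A" "drop i w \<in> B" using assms by (auto simp: ncsupp_def)
  from assms(3)[OF this] show "w \<in> C" by simp
qed

lemma ncsupp_gbr:
  assumes "ncsupp x \<subseteq> A" "ncsupp y \<subseteq> B"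
    "\<And>u v. u \<in> A \<Longrightarrow> v \<in> B \<Longrightarrow> u @ v \<in> C \<and> v @ u \<in> C"
  shows "ncsupp (gbr x y) \<subseteq> C"
proof
  fix w assume w: "w \<in> ncsupp (gbr x y)"
  have "\<exists>i. coeff x (take i w) * coeff y (drop i w)
      - koszul_sign (list_deg (take i w)) (list_deg (drop i w))
        * (coeff y (take i w) * coeff x (drop i w)) \<noteq> 0"
  proof (rule ccontr)
    assume "\<not> ?thesis"
    hence "coeff (gbr x y) w = 0" by (simp add: gbr_def Let_def)
    thus False using w by (simp add: ncsupp_def)
  qed
  then obtain i where i: "coeff x (take i w) * coeff y (drop i w)
      - koszul_sign (list_deg (take i w)) (list_deg (drop i w))
        * (coeff y (take i w) * coeff x (drop i w)) \<noteq> 0" ..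
  have "coeff x (take i w) \<noteq> 0 \<and> coeff y (drop i w) \<noteq> 0
      \<or> coeff y (take i w) \<noteq> 0 \<and> coeff x (drop i w) \<noteq> 0"
    by (rule ccontr) (use i in auto)
  hence "take i w \<in> A \<and> drop i w \<in> B \<or> take i w \<in> B \<and> drop i w \<in> A"
    using assms(1,2) by (auto simp: ncsupp_def)
  thus "w \<in> C" using assms(3)[of "take i w" "drop i w"] assms(3)[of "drop i w" "take i w"] by auto
qed

lemma subspace_ncsupp: "ncs.subspace {x. ncsupp x \<subseteq> A}"
  by (rule ncs.subspaceI) (simp_all add: ncsupp_subset)

abbreviation homog :: "int \<Rightarrow> cell ncseries \<Rightarrow> bool" where
  "homog n x \<equiv> ncsupp x \<subseteq> {w. list_deg w = n}"

lemma list_deg_simps [simp]: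
  "list_deg [] = 0" "list_deg (s # w) = cell_deg s + list_deg w" "list_deg (u @ v) = list_deg u + list_deg v"
  by (simp_all add: list_deg_def)

lemma homog_gen: "homog (cell_deg s) (gen s)"
  by (auto simp: ncsupp_def coeff_gen)

lemma homog_mult: "homog p x \<Longrightarrow> homog q y \<Longrightarrow> homog (p + q) (x * y)"
  by (rule ncsupp_mult) auto

lemma homog_gbr: "homog p x \<Longrightarrow> homog q y \<Longrightarrow> homog (p + q) (gbr x y)"
  by (rule ncsupp_gbr) auto

lemma homog_scale: "homog p x \<Longrightarrow> homog p (q *\<^sub>Q x)"
  by (simp add: ncsupp_subset)

lemma gbr_homog:
  "homog p x \<Longrightarrow> homog q y \<Longrightarrow> gbr x y = x * y - koszul_sign p q *\<^sub>Q (y * x)"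
  by (rule gbr_homogeneous) (auto simp: ncsupp_def)

lemma gbr_even: "homog 0 y \<Longrightarrow> gbr y v = comm y v"
proof (rule ncseries_eqI)
  fix w assume y: "homog 0 y"
  have "koszul_sign (list_deg u) (list_deg v') * (coeff v u * coeff y v') = coeff v u * coeff y v'" for u v'
    using y by (auto simp: ncsupp_def koszul_sign_def)
  thus "coeff (gbr y v) w = coeff (comm y v) w"
    unfolding gbr_def Let_def comm_def coeff_diff coeff_times ncseries.sel
    by (simp only: sum_subtractf)
qed

lemma gbr_linear:
  "gbr (x + x') y = gbr x y + gbr x' y" "gbr x (y + y') = gbr x y + gbr x y'"
  "gbr (q *\<^sub>Q x) y = q *\<^sub>Q gbr x y" "gbr x (q *\<^sub>Q y) = q *\<^sub>Q gbr x y"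
  by (rule ncseries_eqI, simp add: gbr_def Let_def algebra_simps sum.distrib sum_subtractf sum_distrib_left)+

lemma filt_lin_gbr_left: "filt_lin 0 (\<lambda>x. gbr x y)"
  and filt_lin_gbr_right: "filt_lin 0 (gbr x)"
  by (rule filt_linI; simp add: gbr_linear; auto simp: gbr_def Let_def ncfilt_def intro!: sum.neutral)+

lemma gbr_zero [simp]: "gbr 0 y = 0" "gbr x 0 = 0"
  using filt_lin_zero[OF filt_lin_gbr_left] filt_lin_zero[OF filt_lin_gbr_right] by auto

lemma gbr_span_closed:
  assumes "x \<in> ncs.span A" "y \<in> ncs.span B" "ncs.subspace C"
    "\<And>a b. a \<in> A \<Longrightarrow> b \<in> B \<Longrightarrow> gbr a b \<in> C"
  shows "gbr x y \<in> C"
proof -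
  have C: "0 \<in> C" "\<And>x y. x \<in> C \<Longrightarrow> y \<in> C \<Longrightarrow> x + y \<in> C" "\<And>q x. x \<in> C \<Longrightarrow> q *\<^sub>Q x \<in> C"
    using assms(3) by (auto simp: ncs.subspace_def)
  have 1: "gbr a y \<in> C" if a: "a \<in> A" for a
    using assms(2)
    by (induction rule: ncs.span_induct_alt) (auto simp: gbr_linear C assms(4)[OF a])
  show ?thesis
    using assms(1)
    by (induction rule: ncs.span_induct_alt) (auto simp: gbr_linear C 1)
qed

text \<open>On homogeneous series \<open>gbr\<close> is the supercommutator of an associative product, whence antisymmetry
  and the Jacobi identity; different degrees are independent because their supports are disjoint.\<close>

lemma graded_lie_algebra_gbr:
  assumes V: "\<And>n. ncs.subspace (V n)" "\<And>n x. x \<in> V n \<Longrightarrow> homog n x"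
    and br: "\<And>p q u v. u \<in> V p \<Longrightarrow> v \<in> V q \<Longrightarrow> gbr u v \<in> V (p + q)"
  shows "graded_lie_algebra scaleQ V gbr"
proof unfold_locales
  fix N :: "int set" and c k assume N: "finite N" "\<And>n. n \<in> N \<Longrightarrow> c n \<in> V n" "(\<Sum>n\<in>N. c n) = 0" "k \<in> N"
  show "c k = 0"
  proof (rule ncseries_eqI)
    fix w
    show "coeff (c k) w = coeff 0 w"
    proof (cases "list_deg w = k")
      case True
      have "coeff (c n) w = 0" if "n \<in> N - {k}" for n
        using V(2)[OF N(2), of n] that True by (auto simp: ncsupp_def)
      hence "(\<Sum>n\<in>N. coeff (c n) w) = (\<Sum>n\<in>{k}. coeff (c n) w)"
        using N by (intro sum.mono_neutral_right) auto
      moreover have "(\<Sum>n\<in>N. coeff (c n) w) = 0" using arg_cong[OF N(3), of "\<lambda>x. coeff x w"] by simp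
      ultimately show ?thesis by simp
    next
      case False
      thus ?thesis using V(2)[OF N(2)[OF N(4)]] by (auto simp: ncsupp_def)
    qed
  qed
next
  fix u v p q assume "u \<in> V p" "v \<in> V q"
  hence h: "homog p u" "homog q v" using V by auto
  show "gbr v u = - (koszul_sign p q *\<^sub>Q gbr u v)"
    unfolding gbr_homog[OF h] gbr_homog[OF h(2,1)]
    by (auto simp: koszul_sign_def mult.commute algebra_simps)
next
  fix u v w p q s assume "u \<in> V p" "v \<in> V q" "w \<in> V s"
  hence h: "homog p u" "homog q v" "homog s w" using V by auto
  show "gbr (gbr u v) w = gbr u (gbr v w) - koszul_sign p q *\<^sub>Q gbr v (gbr u w)"
    unfolding gbr_homog[OF homog_gbr[OF h(1,2)] h(3)] gbr_homog[OF h(1) homog_gbr[OF h(2,3)]]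
      gbr_homog[OF h(2) homog_gbr[OF h(1,3)]]
    unfolding gbr_homog[OF h(1,2)] gbr_homog[OF h(2,3)] gbr_homog[OF h(1,3)]
    by (cases "even p"; cases "even q"; cases "even s")
      (simp_all add: koszul_sign_def algebra_simps)
qed (use V br in \<open>auto simp: gbr_linear\<close>)


subsection \<open>Lie words and the completion\<close>

lemma ncsupp_eval_word:
  "ncsupp (eval_word gbr gen t) \<subseteq> {w. list_deg w = word_degree cell_deg t \<and>
     length w = Suc (brackets t) \<and> set w \<subseteq> set_lie_word t}"
proof (induction t)
  case (Gen s) show ?case by (auto simp: ncsupp_def coeff_gen)
next
  case (Br s t) show ?case
    unfolding eval_word.simps by (rule ncsupp_gbr[OF Br.IH]) auto
qed

lemma ncsupp_lie_part:
  assumes "x \<in> lie_part S n m"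
  shows "ncsupp x \<subseteq> {w. list_deg w = n \<and> length w = Suc m \<and> set w \<subseteq> S}"
proof -
  let ?C = "{x. ncsupp x \<subseteq> {w. list_deg w = n \<and> length w = Suc m \<and> set w \<subseteq> S}}"
  have "lie_part S n m \<subseteq> ?C"
    unfolding lie_part_def
  proof (rule ncs.span_minimal[OF _ subspace_ncsupp], safe)
    fix t w assume "set_lie_word t \<subseteq> S" "w \<in> ncsupp (eval_word gbr gen t)"
    thus "list_deg w = word_degree cell_deg t" "length w = Suc (brackets t)"
      "\<And>x. x \<in> set w \<Longrightarrow> x \<in> S"
      using ncsupp_eval_word[of t] by auto
  qed
  thus ?thesis using assms by auto
qed

lemma subspace_lie_part: "ncs.subspace (lie_part S n m)"
  by (simp add: lie_part_def)

lemma gbr_lie_part: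
  assumes "x \<in> lie_part S p i" "y \<in> lie_part S q j"
  shows "gbr x y \<in> lie_part S (p + q) (Suc (i + j))"
  using assms unfolding lie_part_def[of S p] lie_part_def[of S q]
proof (rule gbr_span_closed[OF _ _ subspace_lie_part], clarify)
  fix s t :: "cell lie_word"
  assume "set_lie_word s \<subseteq> S" "set_lie_word t \<subseteq> S"
  hence "eval_word gbr gen (Br s t) \<in> lie_part S (word_degree cell_deg (Br s t)) (brackets (Br s t))"
    unfolding lie_part_def by (intro ncs.span_base CollectI exI[of _ "Br s t"]) simp
  thus "gbr (eval_word gbr gen s) (eval_word gbr gen t)
      \<in> lie_part S (word_degree cell_deg s + word_degree cell_deg t) (Suc (brackets s + brackets t))"
    by simp
qed

lemma gen_lie_part: "s \<in> S \<Longrightarrow> gen s \<in> lie_part S (cell_deg s) 0"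
  unfolding lie_part_def by (intro ncs.span_base CollectI exI[of _ "Gen s"]) simp

lemma lie_part_mono: "S \<subseteq> S' \<Longrightarrow> lie_part S n m \<subseteq> lie_part S' n m"
  unfolding lie_part_def by (rule ncs.span_mono) auto

lemma filt_lin_length_part: "filt_lin 0 (length_part k)"
  by (rule filt_linI) (auto intro!: ncseries_eqI simp: coeff_length_part ncfilt_def)

lemma length_part_filt: "x \<in> ncfilt (Suc k) \<Longrightarrow> length_part k x = 0"
  by (rule ncseries_eqI) (simp add: coeff_length_part ncfilt_def)

lemma length_part_cong: "x - y \<in> ncfilt (Suc k) \<Longrightarrow> length_part k x = length_part k y"
  using length_part_filt[of "x - y" k] by (simp add: filt_lin_diff[OF filt_lin_length_part])

lemma length_part_pure:
  "ncsupp x \<subseteq> {w. length w = j} \<Longrightarrow> length_part k x = (if k = j then x else 0)"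
  by (rule ncseries_eqI) (auto simp: coeff_length_part ncsupp_def)

lemma truncation: "x - (\<Sum>k\<le>n. length_part k x) \<in> ncfilt (Suc n)"
  by (rule ncfiltI) (simp add: coeff_length_part)

lemma subspace_completed_lie: "ncs.subspace (completed_lie S n)"
proof (rule ncs.subspaceI)
  note l = filt_lin_length_part and s = subspace_lie_part
  show "0 \<in> completed_lie S n"
    using ncs.subspace_0[OF s] by (simp add: completed_lie_def filt_lin_zero[OF l])
  fix x y assume xy: "x \<in> completed_lie S n" "y \<in> completed_lie S n"
  thus "x + y \<in> completed_lie S n"
    using ncs.subspace_add[OF s] by (simp add: completed_lie_def filt_lin_add[OF l])
  fix q show "q *\<^sub>Q x \<in> completed_lie S n"
    using xy ncs.subspace_scale[OF s] by (simp add: completed_lie_def filt_lin_scale[OF l])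
qed

lemmas cl_zero = ncs.subspace_0[OF subspace_completed_lie]
  and cl_add = ncs.subspace_add[OF subspace_completed_lie]
  and cl_diff = ncs.subspace_diff[OF subspace_completed_lie]
  and cl_scale = ncs.subspace_scale[OF subspace_completed_lie]
  and cl_uminus = ncs.subspace_neg[OF subspace_completed_lie]
  and cl_sum = ncs.subspace_sum[OF subspace_completed_lie]

lemma cl_Nil: "x \<in> completed_lie S n \<Longrightarrow> coeff x [] = 0"
  by (simp add: completed_lie_def)

lemma cl_part: "x \<in> completed_lie S n \<Longrightarrow> length_part (Suc m) x \<in> lie_part S n m"
  by (simp add: completed_lie_def)

lemma cl_part_0: "x \<in> completed_lie S n \<Longrightarrow> length_part 0 x = 0"
  by (rule ncseries_eqI) (simp add: completed_lie_def coeff_length_part)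

lemma lie_part_cl: "lie_part S n m \<subseteq> completed_lie S n"
proof
  fix x assume x: "x \<in> lie_part S n m"
  note supp = ncsupp_lie_part[OF x]
  have "length_part k x = (if k = Suc m then x else 0)" for k
    by (rule length_part_pure) (use supp in auto)
  moreover have "coeff x [] = 0" using supp by (auto simp: ncsupp_def)
  ultimately show "x \<in> completed_lie S n"
    using x ncs.subspace_0[OF subspace_lie_part] by (simp add: completed_lie_def)
qed

lemma cl_gen: "s \<in> S \<Longrightarrow> gen s \<in> completed_lie S (cell_deg s)"
  using gen_lie_part lie_part_cl by blast

lemma cl_mono: "S \<subseteq> S' \<Longrightarrow> completed_lie S n \<subseteq> completed_lie S' n"
  using lie_part_mono[of S S' n] by (auto simp: completed_lie_def)

text \<open>Each condition on an element of the completion involves a single length, so membership can be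
  tested on approximations. This is how closure under infinite sums is proved.\<close>

lemma cl_closed:
  assumes "\<And>k. \<exists>y\<in>completed_lie S n. x - y \<in> ncfilt (Suc k)"
  shows "x \<in> completed_lie S n"
  unfolding completed_lie_def
proof (intro CollectI conjI allI)
  obtain y where "y \<in> completed_lie S n" "x - y \<in> ncfilt (Suc 0)" using assms by blast
  thus "coeff x [] = 0" by (simp add: ncfilt_1 cl_Nil)
  fix m obtain y where "y \<in> completed_lie S n" "x - y \<in> ncfilt (Suc (Suc m))" using assms by blast
  thus "length_part (Suc m) x \<in> lie_part S n m" using length_part_cong cl_part by metis
qed

lemma cl_supp:
  assumes "x \<in> completed_lie S n"
  shows "ncsupp x \<subseteq> {w. list_deg w = n \<and> set w \<subseteq> S}"
proof
  fix w assume w: "w \<in> ncsupp x"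
  then obtain m where m: "length w = Suc m"
    using cl_Nil[OF assms] by (cases w) (auto simp: ncsupp_def)
  have "w \<in> ncsupp (length_part (Suc m) x)" using w m by (simp add: ncsupp_def coeff_length_part)
  thus "w \<in> {w. list_deg w = n \<and> set w \<subseteq> S}" using ncsupp_lie_part[OF cl_part[OF assms]] by blast
qed

lemma cl_homog: "x \<in> completed_lie S n \<Longrightarrow> homog n x"
  using cl_supp by blast

lemma gbr_cl:
  assumes x: "x \<in> completed_lie S p" and y: "y \<in> completed_lie S q"
  shows "gbr x y \<in> completed_lie S (p + q)"
proof (rule cl_closed)
  fix k
  let ?x = "\<Sum>i\<le>k. length_part i x" and ?y = "\<Sum>i\<le>k. length_part i y"
  have p: "gbr (length_part i x) (length_part j y) \<in> completed_lie S (p + q)" for i j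
  proof (cases i; cases j)
    fix i' j' assume "i = Suc i'" "j = Suc j'"
    thus ?thesis using gbr_lie_part[OF cl_part[OF x] cl_part[OF y]] lie_part_cl by blast
  qed (simp_all add: cl_part_0[OF x] cl_part_0[OF y] cl_zero)
  have "gbr ?x ?y \<in> completed_lie S (p + q)"
    unfolding filt_lin_sum[OF filt_lin_gbr_left] filt_lin_sum[OF filt_lin_gbr_right]
    by (intro cl_sum p)
  moreover have "gbr x y - gbr ?x ?y = gbr (x - ?x) y + gbr ?x (y - ?y)"
    by (simp add: filt_lin_diff[OF filt_lin_gbr_left] filt_lin_diff[OF filt_lin_gbr_right])
  moreover have "\<dots> \<in> ncfilt (Suc k)"
    using filt_lin_filt[OF filt_lin_gbr_left truncation] filt_lin_filt[OF filt_lin_gbr_right truncation]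
    by (intro ncfilt_add) simp_all
  ultimately show "\<exists>z\<in>completed_lie S (p + q). gbr x y - z \<in> ncfilt (Suc k)"
    by (intro bexI[of _ "gbr ?x ?y"]) simp_all
qed

lemma gbr_cl_even: "y \<in> completed_lie S 0 \<Longrightarrow> gbr y = comm y"
  using gbr_even[OF cl_homog] by blast

lemma fps_op_cl:
  assumes y: "y \<in> completed_lie S 0" and v: "v \<in> completed_lie S n"
  shows "fps_op F (comm y) v \<in> completed_lie S n"
proof (rule cl_closed)
  fix k
  have "(comm y ^^ j) v \<in> completed_lie S n" for j
  proof (induction j)
    case (Suc j) thus ?case using gbr_cl[OF y Suc] gbr_cl_even[OF y] by simp
  qed (simp add: v)
  hence "(\<Sum>j\<le>k. fps_nth F j *\<^sub>Q (comm y ^^ j) v) \<in> completed_lie S n" by (intro cl_sum cl_scale)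
  thus "\<exists>z\<in>completed_lie S n. fps_op F (comm y) v - z \<in> ncfilt (Suc k)"
    using fps_op_approx[OF filt_lin_comm[OF cl_Nil[OF y]]] by blast
qed


subsection \<open>The Baker--Campbell--Hausdorff theorem\<close>

definition euler :: "'x ncseries \<Rightarrow> 'x ncseries" where
  "euler z = NCSeries (\<lambda>w. of_nat (length w) * coeff z w)"

lemma filt_lin_euler: "filt_lin 0 euler"
  by (rule filt_linI) (auto intro!: ncseries_eqI simp: euler_def ncfilt_def algebra_simps)

lemma euler_mult: "euler (x * y) = euler x * y + x * euler y"
proof (rule ncseries_eqI)
  fix w
  have "of_nat (length w) * (coeff x (take i w) * coeff y (drop i w))
      = of_nat (length (take i w)) * coeff x (take i w) * coeff y (drop i w)
      + coeff x (take i w) * (of_nat (length (drop i w)) * coeff y (drop i w))" if "i \<le> length w" for i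
    using that by (simp add: min_def of_nat_diff algebra_simps)
  thus "coeff (euler (x * y)) w = coeff (euler x * y + x * euler y) w"
    unfolding coeff_add coeff_times euler_def ncseries.sel sum_distrib_left sum.distrib[symmetric]
    by (intro sum.cong) auto
qed

lemma euler_1 [simp]: "euler 1 = 0"
  by (rule ncseries_eqI) (simp add: euler_def coeff_1)

lemma length_part_euler: "length_part k (euler x) = of_nat k *\<^sub>Q length_part k x"
  by (rule ncseries_eqI) (simp add: coeff_length_part euler_def)

lemma euler_cl: "x \<in> completed_lie S n \<Longrightarrow> euler x \<in> completed_lie S n"
  using ncs.subspace_scale[OF subspace_lie_part]
  by (auto simp: completed_lie_def length_part_euler) (simp add: euler_def)

lemma fps_op_comm_cong:
  assumes z: "z - z' \<in> ncfilt (Suc m)" and z0: "coeff z [] = 0" "coeff z' [] = 0" and v: "coeff v [] = 0"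
  shows "fps_op F (comm z) v - fps_op F (comm z') v \<in> ncfilt (Suc (Suc m))"
proof -
  have 1: "(comm z ^^ k) v \<in> ncfilt (Suc 0)" for k
    using filt_lin_filt[OF filt_lin_pow[OF filt_lin_comm[OF z0(1)]], of v "Suc 0" k] v
    by (auto simp: ncfilt_def)
  have "(comm z ^^ k) v - (comm z' ^^ k) v \<in> ncfilt (Suc (Suc m))" for k
  proof (induction k)
    case (Suc k)
    let ?a = "(comm z ^^ k) v" and ?b = "(comm z' ^^ k) v"
    have "comm (z - z') ?a \<in> ncfilt (Suc (Suc m))"
      using ncfilt_mult[OF z 1[of k]] ncfilt_mult[OF 1[of k] z] by (auto simp: comm_def intro: ncfilt_diff)
    moreover have "comm z' (?a - ?b) \<in> ncfilt (Suc (Suc m))"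
      using filt_lin_filt[OF filt_lin_weaken[OF filt_lin_comm[OF z0(2)]] Suc.IH] by simp
    moreover have "comm z ?a - comm z' ?b = comm (z - z') ?a + comm z' (?a - ?b)"
      by (simp add: comm_def algebra_simps)
    ultimately show ?case by (simp add: ncfilt_add)
  qed simp
  hence "coeff ((comm z ^^ k) v) w = coeff ((comm z' ^^ k) v) w" if "length w < Suc (Suc m)" for k w
    using ncfiltD[OF _ that] by fastforce
  thus ?thesis by (intro ncfiltI) (simp add: fps_op_def)
qed

text \<open>If \<open>exp z = exp x * exp y\<close>, the Euler derivation, which multiplies a word by its length, gives
  \<open>psi (ad z) (euler z) = exp (- ad y) (psi (ad x) (euler x)) + psi (ad y) (euler y)\<close>. Solved for
  \<open>euler z\<close>, this expresses the part of \<open>z\<close> of length \<open>m\<close> by brackets of its shorter parts and of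
  Lie elements.\<close>

theorem BCH2_cl:
  assumes x: "x \<in> completed_lie S 0" and y: "y \<in> completed_lie S 0"
  shows "BCH [x, y] \<in> completed_lie S 0"
proof -
  define z where "z = BCH [x, y]"
  have z0: "coeff z [] = 0" by (simp add: z_def)
  have z: "ncs_exp z = ncs_exp x * ncs_exp y" by (simp add: z_def exp_BCH)
  note x0 = cl_Nil[OF x] and y0 = cl_Nil[OF y]
  note e = exp_deriv[OF _ filt_lin_euler euler_1 euler_mult]
  define v where "v = fps_op (fps_exp (- 1)) (comm y) (fps_op psi (comm x) (euler x)) + fps_op psi (comm y) (euler y)"
  have v: "v \<in> completed_lie S 0"
    unfolding v_def by (intro cl_add fps_op_cl euler_cl x y)
  have "ncs_exp z * fps_op psi (comm z) (euler z) = euler (ncs_exp x * ncs_exp y)"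
    using e[OF z0] z by simp
  also have "\<dots> = ncs_exp z * v"
    unfolding euler_mult e[OF x0] e[OF y0] z v_def exp_ad[OF y0]
    using y0 by (simp add: algebra_simps)
  finally have "ncs_exp (- z) * (ncs_exp z * fps_op psi (comm z) (euler z)) = ncs_exp (- z) * (ncs_exp z * v)"
    by simp
  hence psi: "fps_op psi (comm z) (euler z) = v" using z0 by simp
  have Ez: "euler z = fps_op (inverse psi) (comm z) v"
    using fps_op_mult[OF filt_lin_comm[OF z0], of "inverse psi" psi "euler z"]
    by (simp add: psi inverse_mult_eq_1 psi_nth)
  have "length_part (Suc m) z \<in> lie_part S 0 m" for m
  proof (induction m rule: less_induct)
    case (less m)
    \<comment> \<open>As \<open>v\<close> has positive order, the part of length \<open>m + 1\<close> of a series in \<open>ad z\<close> applied to \<open>v\<close> sees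
      only the parts of \<open>z\<close> of length at most \<open>m\<close>.\<close>
    define z' where "z' = (\<Sum>k\<le>m. length_part k z)"
    have "length_part k z \<in> completed_lie S 0" if "k \<le> m" for k
    proof (cases k)
      case 0
      have "length_part 0 z = 0" by (rule ncseries_eqI) (simp add: coeff_length_part z0)
      thus ?thesis by (simp add: 0 cl_zero)
    next
      case (Suc j)
      thus ?thesis using less[of j] that subsetD[OF lie_part_cl] by simp
    qed
    hence z': "z' \<in> completed_lie S 0" unfolding z'_def by (intro cl_sum) auto
    have "length_part (Suc m) (euler z) = length_part (Suc m) (fps_op (inverse psi) (comm z') v)"
      unfolding Ez by (intro length_part_cong fps_op_comm_cong)
        (use truncation[of z m] z0 cl_Nil[OF z'] cl_Nil[OF v] in \<open>simp_all add: z'_def\<close>)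
    hence "length_part (Suc m) (euler z) \<in> lie_part S 0 m"
      using cl_part[OF fps_op_cl[OF z' v]] by simp
    hence "(1 / of_nat (Suc m)) *\<^sub>Q length_part (Suc m) (euler z) \<in> lie_part S 0 m"
      by (rule ncs.subspace_scale[OF subspace_lie_part])
    thus ?case by (simp add: length_part_euler del: of_nat_Suc)
  qed
  thus ?thesis using z0 by (simp add: completed_lie_def z_def)
qed

lemma BCH_Cons: "BCH (x # xs) = BCH [x, BCH xs]"
  unfolding BCH_def[of "x # xs"] BCH_def[of "[x, BCH xs]"] by (simp add: exp_BCH)

lemma BCH_cl: "set xs \<subseteq> completed_lie S 0 \<Longrightarrow> BCH xs \<in> completed_lie S 0"
proof (induction xs)
  case Nil
  have "BCH [] = (0 :: cell ncseries)" using log_exp[of 0] by (simp add: BCH_def)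
  thus ?case by (simp add: cl_zero)
next
  case (Cons x xs) thus ?case by (subst BCH_Cons) (auto intro: BCH2_cl)
qed


section \<open>Derivations of the completed free Lie algebra\<close>

definition parity_sign :: "cell \<Rightarrow> rat" where
  "parity_sign s = (if even (cell_deg s) then 1 else - 1)"

abbreviation parity :: "cell ncseries \<Rightarrow> cell ncseries" where
  "parity \<equiv> monom_act parity_sign (\<lambda>s. s)"

lemma prod_parity_sign: "prod_list (map parity_sign w) = (if even (list_deg w) then 1 else - 1)"
  by (induction w) (auto simp: parity_sign_def)

lemma parity_homog: "homog p x \<Longrightarrow> parity x = (if even p then 1 else - 1) *\<^sub>Q x"
  by (rule ncseries_eqI) (auto simp: coeff_monom_act prod_parity_sign ncsupp_def)

lemma homog_lquot: "homog n z \<Longrightarrow> homog (n - cell_deg s) (lquot s z)"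
  by (force simp: ncsupp_def)

lemma homog_der:
  assumes \<delta>: "\<And>s. homog (cell_deg s - 1) (\<delta> s)" and z: "homog n z"
  shows "homog (n - 1) (der \<epsilon> \<delta> z)"
proof -
  have "list_deg w = n - 1" if "der_coeff \<epsilon> \<delta> w z \<noteq> 0" for w
    using that z
  proof (induction w arbitrary: z n)
    case (Cons t w)
    have "homog (n - 1) (\<Sum>s\<in>UNIV. \<delta> s * lquot s z)"
    proof (rule ncs.subspace_sum[OF subspace_ncsupp, unfolded mem_Collect_eq])
      fix s show "homog (n - 1) (\<delta> s * lquot s z)"
        using homog_mult[OF \<delta> homog_lquot[OF Cons.prems(2)], of s s] by simp
    qed
    moreover have "coeff (\<Sum>s\<in>UNIV. \<delta> s * lquot s z) (t # w) \<noteq> 0 \<or> der_coeff \<epsilon> \<delta> w (lquot t z) \<noteq> 0"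
      using Cons.prems(1) by (auto simp del: coeff_sum)
    ultimately show ?case
      using Cons.IH[OF _ homog_lquot[OF Cons.prems(2)], of t] by (auto simp: ncsupp_def simp del: coeff_sum)
  qed simp
  thus ?thesis by (auto simp: der_def ncsupp_def)
qed

lemma eval_word_cl:
  "set_lie_word t \<subseteq> S \<Longrightarrow> eval_word gbr gen t \<in> completed_lie S (word_degree cell_deg t)"
  by (induction t) (auto intro: cl_gen gbr_cl)

lemma cl_truncation: "x \<in> completed_lie S n \<Longrightarrow> (\<Sum>k\<le>N. length_part k x) \<in> completed_lie S n"
proof (intro cl_sum)
  fix k assume x: "x \<in> completed_lie S n"
  show "length_part k x \<in> completed_lie S n"
    using subsetD[OF lie_part_cl cl_part[OF x]] by (cases k) (auto simp: cl_part_0[OF x] cl_zero)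
qed

lemma length_part_eqI:
  assumes "\<And>k. length_part k x = length_part k y" shows "x = y"
proof (rule ncseries_eqI)
  fix w
  show "coeff x w = coeff y w"
    using arg_cong[OF assms[of "length w"], of "\<lambda>z. coeff z w"] by (simp add: coeff_length_part)
qed

lemma filt_lin_cl:
  assumes T: "filt_lin 0 T"
    and word: "\<And>t. set_lie_word t \<subseteq> S \<Longrightarrow> T (eval_word gbr gen t) \<in> completed_lie S' (word_degree cell_deg t + r)"
    and x: "x \<in> completed_lie S n"
  shows "T x \<in> completed_lie S' (n + r)"
proof (rule cl_closed)
  fix k
  have part: "T y \<in> completed_lie S' (n + r)" if "y \<in> lie_part S n m" for y m
    using that unfolding lie_part_def
  proof (induction rule: ncs.span_induct_alt)
    case base thus ?case using filt_lin_zero[OF T] cl_zero by simp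
  next
    case (step c y z) thus ?case
      using word by (auto simp: filt_lin_add[OF T] filt_lin_scale[OF T] intro!: cl_add cl_scale)
  qed
  have "T (length_part j x) \<in> completed_lie S' (n + r)" for j
    using part[OF cl_part[OF x]] filt_lin_zero[OF T] cl_zero by (cases j) (auto simp: cl_part_0[OF x])
  hence "T (\<Sum>j\<le>k. length_part j x) \<in> completed_lie S' (n + r)"
    unfolding filt_lin_sum[OF T] by (intro cl_sum)
  thus "\<exists>y\<in>completed_lie S' (n + r). T x - y \<in> ncfilt (Suc k)"
    using filt_lin_filt[OF T truncation, of x k]
    by (intro bexI[of _ "T (\<Sum>j\<le>k. length_part j x)"]) (simp_all add: filt_lin_diff[OF T])
qed

lemma total_Abar: "graded_lie_algebra.total scaleQ Abar = Abar_total"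
  and graded_lie_algebra_Abar: "graded_lie_algebra scaleQ Abar gbr"
proof -
  show *: "graded_lie_algebra scaleQ Abar gbr"
    unfolding Abar_def by (rule graded_lie_algebra_gbr) (auto intro: subspace_completed_lie gbr_cl dest: cl_homog)
  show "graded_lie_algebra.total scaleQ Abar = Abar_total"
    using graded_lie_algebra.total_def[OF *]
    by (simp only: Abar_total_def completed_lie_total_def Abar_def)
qed

lemma Abar_subset_total: "Abar n \<subseteq> Abar_total"
  unfolding Abar_total_def completed_lie_total_def Abar_def by (auto intro: ncs.span_base)

lemma cl_Abar: "completed_lie S n \<subseteq> Abar n"
  unfolding Abar_def by (rule cl_mono) simp

text \<open>The letters are sent into the completed Lie algebra, with degree lowered by one; then the signed
  derivation of the associative algebra restricts to a derivation of the completed Lie algebra.\<close>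

locale cell_derivation =
  fixes \<delta> :: "cell \<Rightarrow> cell ncseries"
  assumes \<delta>: "\<delta> s \<in> completed_lie UNIV (cell_deg s - 1)"
begin

definition D :: "cell ncseries \<Rightarrow> cell ncseries" where "D = der parity_sign \<delta>"

lemma filt_lin_D: "filt_lin 0 D"
  unfolding D_def using filt_lin_der cl_Nil[OF \<delta>] .

lemmas D_add = filt_lin_add[OF filt_lin_D]
  and D_diff = filt_lin_diff[OF filt_lin_D]
  and D_uminus = filt_lin_uminus[OF filt_lin_D]
  and D_scale = filt_lin_scale[OF filt_lin_D]

lemma D_1 [simp]: "D 1 = 0" by (simp add: D_def)

lemma D_gen: "D (gen s) = \<delta> s"
  unfolding D_def by (rule der_gen[OF cl_Nil[OF \<delta>]])

lemma D_mult: "D (x * y) = D x * y + parity x * D y"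
  unfolding D_def by (rule der_mult[OF cl_Nil[OF \<delta>]])

lemma D_homog: "homog n z \<Longrightarrow> homog (n - 1) (D z)"
  unfolding D_def by (rule homog_der[OF cl_homog[OF \<delta>]])

lemma D_gbr:
  assumes "homog p u" "homog q v"
  shows "D (gbr u v) = gbr (D u) v + (if even p then 1 else - 1) *\<^sub>Q gbr u (D v)"
  unfolding gbr_homog[OF assms] gbr_homog[OF D_homog[OF assms(1)] assms(2)]
    gbr_homog[OF assms(1) D_homog[OF assms(2)]] D_diff D_scale D_mult
    parity_homog[OF assms(1)] parity_homog[OF assms(2)]
  by (cases "even p"; cases "even q") (simp_all add: koszul_sign_def algebra_simps scaleQ_add)

lemma D_cl:
  assumes S: "\<And>s. s \<in> S \<Longrightarrow> \<delta> s \<in> completed_lie S (cell_deg s - 1)" and x: "x \<in> completed_lie S n"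
  shows "D x \<in> completed_lie S (n - 1)"
proof -
  have "D (eval_word gbr gen t) \<in> completed_lie S (word_degree cell_deg t + - 1)"
    if "set_lie_word t \<subseteq> S" for t
    using that
  proof (induction t)
    case (Gen s) thus ?case using S by (simp add: D_gen)
  next
    case (Br s t)
    note w = eval_word_cl[of s S] eval_word_cl[of t S]
    show ?case
      unfolding eval_word.simps word_degree.simps D_gbr[OF cl_homog[OF eval_word_cl[OF subset_UNIV]] cl_homog[OF eval_word_cl[OF subset_UNIV]]]
      using gbr_cl[OF Br.IH(1) w(2)] gbr_cl[OF w(1) Br.IH(2)] Br.prems
      by (intro cl_add cl_scale) (simp_all add: algebra_simps)
  qed
  from filt_lin_cl[OF filt_lin_D this x] show ?thesis by simp
qed

lemma lie_derivation_D: "lie_derivation scaleQ Abar gbr D"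
proof -
  interpret graded_lie_algebra scaleQ Abar gbr by (rule graded_lie_algebra_Abar)
  show ?thesis
  proof unfold_locales
    fix u v p q assume "u \<in> Abar p" "v \<in> Abar q"
    thus "D (gbr u v) = gbr (D u) v + (if even p then 1 else - 1) *\<^sub>Q gbr u (D v)"
      unfolding Abar_def by (intro D_gbr cl_homog)
  qed (auto simp: D_add D_scale Abar_def intro: D_cl \<delta>)
qed

lemma continuous_D: "continuous_on_Abar D"
  unfolding continuous_on_Abar_def
proof (intro allI exI ballI impI)
  fix n M k and x :: "cell ncseries" assume x: "\<forall>k\<le>M. length_part k x = 0" and k: "k \<le> M"
  have "x \<in> ncfilt (Suc M)"
  proof (rule ncfiltI)
    fix w :: "cell list" assume "length w < Suc M"
    hence "length_part (length w) x = 0" using x by simp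
    from arg_cong[OF this, of "\<lambda>y. coeff y w"] show "coeff x w = 0" by (simp add: coeff_length_part)
  qed
  hence "D x \<in> ncfilt (Suc k)"
    using filt_lin_filt[OF filt_lin_D] k by (fastforce simp: ncfilt_def)
  thus "length_part k (D x) = 0" by (rule length_part_filt)
qed

end

text \<open>Lie words are dense, so a continuous derivation is determined by its values on generators.\<close>

lemma derivations_agree:
  assumes d: "lie_derivation scaleQ Abar gbr d" "continuous_on_Abar d"
    and d': "lie_derivation scaleQ Abar gbr d'" "continuous_on_Abar d'"
    and gen: "\<And>s. s \<in> S \<Longrightarrow> d (gen s) = d' (gen s)" and x: "x \<in> completed_lie S n"
  shows "d x = d' x"
proof -
  interpret d: lie_derivation scaleQ Abar gbr d by fact
  interpret d': lie_derivation scaleQ Abar gbr d' by fact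
  have T: "Abar k \<subseteq> d.total" for k
    using Abar_subset_total total_Abar by simp
  have lin: "d (u + v) = d u + d v" "d' (u + v) = d' u + d' v" "d (q *\<^sub>Q u) = q *\<^sub>Q d u"
      "d' (q *\<^sub>Q u) = q *\<^sub>Q d' u" if "u \<in> Abar k" "v \<in> Abar k" for u v q k
    using d.d_add[of u v] d'.d_add[of u v] d.d_scale[of u] d'.d_scale[of u] T[of k] that by auto
  have zero: "d 0 = 0" "d' 0 = 0"
    using lin(3,4)[of 0 0 0 0] cl_zero by (auto simp: Abar_def)
  have word: "d (eval_word gbr gen t) = d' (eval_word gbr gen t)" if "set_lie_word t \<subseteq> S" for t
    using that
  proof (induction t)
    case (Br s t)
    have "eval_word gbr gen s \<in> Abar (word_degree cell_deg s)" "eval_word gbr gen t \<in> Abar (word_degree cell_deg t)"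
      using eval_word_cl[of _ S] cl_Abar Br.prems by auto
    thus ?case using Br by (simp add: d.d_br d'.d_br)
  qed (simp add: gen)
  have part: "y \<in> Abar n \<and> d y = d' y" if "y \<in> lie_part S n m" for y m
    using that unfolding lie_part_def
  proof (induction rule: ncs.span_induct_alt)
    case base thus ?case by (simp add: zero Abar_def cl_zero)
  next
    case (step c y z)
    then obtain t where t: "y = eval_word gbr gen t" "set_lie_word t \<subseteq> S" "word_degree cell_deg t = n" by auto
    have y: "y \<in> Abar n" "c *\<^sub>Q y \<in> Abar n"
      using eval_word_cl[OF t(2)] cl_Abar[of S n] t cl_scale by (auto simp: Abar_def)
    have "c *\<^sub>Q y + z \<in> Abar n" using y step by (auto simp: Abar_def intro: cl_add)
    thus ?case using y step by (simp add: lin[where k = n] word t)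
  qed
  have trunc: "d (\<Sum>j\<le>N. length_part j x) = d' (\<Sum>j\<le>N. length_part j x)" for N
  proof -
    have "length_part j x \<in> Abar n \<and> d (length_part j x) = d' (length_part j x)" for j
      using part[OF cl_part[OF x]] by (cases j) (auto simp: cl_part_0[OF x] zero Abar_def cl_zero)
    moreover have "(\<Sum>j\<le>N. length_part j x) \<in> Abar n" for N
      using cl_truncation[OF x] cl_Abar by blast
    ultimately show ?thesis by (induction N) (auto simp: lin[where k = n])
  qed
  have "length_part k (d x) = length_part k (d' x)" for k
  proof -
    obtain N where N: "\<And>y. y \<in> Abar n \<Longrightarrow> \<forall>j\<le>N. length_part j y = 0 \<Longrightarrow> length_part k (d y) = 0"
      using d(2) unfolding continuous_on_Abar_def by (meson order.refl)
    obtain N' where N': "\<And>y. y \<in> Abar n \<Longrightarrow> \<forall>j\<le>N'. length_part j y = 0 \<Longrightarrow> length_part k (d' y) = 0"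
      using d'(2) unfolding continuous_on_Abar_def by (meson order.refl)
    define x' where "x' = (\<Sum>j\<le>max N N'. length_part j x)"
    have x': "x' \<in> Abar n" "x - x' \<in> Abar n" and "x - x' \<in> ncfilt (Suc (max N N'))"
      using cl_truncation[OF x] cl_Abar[of S n] cl_diff[OF x cl_truncation[OF x]] truncation[of x]
      by (auto simp: x'_def)
    hence "\<forall>j\<le>max N N'. length_part j (x - x') = 0"
      by (intro allI impI ncseries_eqI) (simp add: coeff_length_part ncfilt_def)
    hence "length_part k (d (x - x')) = 0" "length_part k (d' (x - x')) = 0"
      using N[OF x'(2)] N'[OF x'(2)] by auto
    moreover have "d x = d x' + d (x - x')" "d' x = d' x' + d' (x - x')"
      using lin(1,2)[OF x'] by simp_all
    ultimately show ?thesis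
      using trunc[of "max N N'"] by (simp add: filt_lin_add[OF filt_lin_length_part] x'_def)
  qed
  thus ?thesis by (rule length_part_eqI)
qed

lemma derivations_agree_total:
  assumes d: "lie_derivation scaleQ Abar gbr d" "continuous_on_Abar d"
    and d': "lie_derivation scaleQ Abar gbr d'" "continuous_on_Abar d'"
    and gen: "\<And>s. d (gen s) = d' (gen s)" and x: "x \<in> Abar_total"
  shows "d x = d' x"
proof -
  interpret d: lie_derivation scaleQ Abar gbr d by fact
  interpret d': lie_derivation scaleQ Abar gbr d' by fact
  have sub: "ncs.subspace Abar_total" by (simp add: Abar_total_def completed_lie_total_def)
  have lin: "d (u + v) = d u + d v" "d' (u + v) = d' u + d' v" "d (q *\<^sub>Q u) = q *\<^sub>Q d u"
      "d' (q *\<^sub>Q u) = q *\<^sub>Q d' u" if "u \<in> Abar_total" "v \<in> Abar_total" for u v q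
    using d.d_add[of u v] d'.d_add[of u v] d.d_scale[of u] d'.d_scale[of u] total_Abar that by auto
  have "x \<in> Abar_total \<and> d x = d' x"
    using x unfolding Abar_total_def completed_lie_total_def
  proof (induction rule: ncs.span_induct_alt)
    case base thus ?case
      using lin(3,4)[of 0 0 0] ncs.subspace_0[OF sub] by (auto simp: Abar_total_def completed_lie_total_def)
  next
    case (step c y z)
    then obtain n where n: "y \<in> completed_lie UNIV n" by auto
    have y: "y \<in> Abar_total" "z \<in> Abar_total" "c *\<^sub>Q y \<in> Abar_total"
      using n Abar_subset_total step ncs.subspace_scale[OF sub]
      by (auto simp: Abar_def Abar_total_def completed_lie_total_def)
    moreover have "d y = d' y" by (rule derivations_agree[OF d d' gen n])
    ultimately show ?case
      using step ncs.subspace_add[OF sub] by (auto simp: lin Abar_total_def completed_lie_total_def)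
  qed
  thus ?thesis ..
qed


section \<open>Right-normed brackets and freeness\<close>

text \<open>In the induction step the maps in question are additive only on the span, so membership of the
  partial sum has to be available.\<close>

lemma (in module) span_induct_mem [consumes 1, case_names base step]:
  assumes "x \<in> span S" "h 0"
    "\<And>c x y. x \<in> S \<Longrightarrow> y \<in> span S \<Longrightarrow> h y \<Longrightarrow> h (scale c x + y)"
  shows "h x"
proof -
  have "x \<in> span S \<and> h x"
    using assms(1) by (induction rule: span_induct_alt)
      (auto intro: assms(2,3) span_zero span_add span_scale span_base)
  thus ?thesis ..
qed

text \<open>The free associative algebra acts on a graded Lie algebra with chosen images of the letters by
  iterated adjoint maps (\<open>act\<close>), and right-normed bracketing (\<open>dyn\<close>) is compatible with this action.
  Both are defined on associative series, before it is known that a Lie word has a well-defined value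
  in the target.\<close>

locale lie_target = graded_lie_algebra sc W br'
  for sc :: "rat \<Rightarrow> 'm::ab_group_add \<Rightarrow> 'm" and W and br' +
  fixes \<phi> :: "cell \<Rightarrow> 'm"
  assumes \<phi>: "\<phi> s \<in> W (cell_deg s)"
begin

primrec rnorm :: "cell list \<Rightarrow> 'm" where
  "rnorm [] = 0"
| "rnorm (s # w) = (if w = [] then \<phi> s else br' (\<phi> s) (rnorm w))"

primrec ad_word :: "cell list \<Rightarrow> 'm \<Rightarrow> 'm" where
  "ad_word [] v = v"
| "ad_word (s # w) v = br' (\<phi> s) (ad_word w v)"

definition dyn :: "nat \<Rightarrow> cell ncseries \<Rightarrow> 'm" where
  "dyn n x = (\<Sum>w | length w = n. sc (coeff x w) (rnorm w))"

definition act :: "nat \<Rightarrow> cell ncseries \<Rightarrow> 'm \<Rightarrow> 'm" where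
  "act n x v = (\<Sum>w | length w = n. sc (coeff x w) (ad_word w v))"

lemma finite_words: "finite {w :: cell list. length w = n}"
  using finite_lists_length_eq[of "UNIV :: cell set" n] by simp

lemma W_total: "v \<in> W p \<Longrightarrow> v \<in> total"
  unfolding total_def by (blast intro: span_base)

lemma subspace_total: "subspace total"
  by (simp add: total_def)

lemma br_zero: "u \<in> total \<Longrightarrow> br' u 0 = 0" "u \<in> total \<Longrightarrow> br' 0 u = 0"
  using br_scale_right[of u 0 0] br_scale_left[of 0 u 0] subspace_0[OF subspace_total]
  by (simp_all add: total_def)

lemma br_lin:
  assumes "u \<in> total" "u' \<in> total" "v \<in> total"
  shows "br' (u + u') v = br' u v + br' u' v" "br' v (u + u') = br' v u + br' v u'"
    "br' (sc q u) v = sc q (br' u v)" "br' v (sc q u) = sc q (br' v u)"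
  using assms br_add_left br_add_right br_scale_left br_scale_right by (simp_all add: total_def)

lemma br_total:
  assumes u: "u \<in> W p" and v: "v \<in> total" shows "br' u v \<in> total"
  using v unfolding total_def
proof (induction rule: span_induct_mem)
  case base show ?case using br_zero[OF W_total[OF u]] span_zero by simp
next
  case (step c x y)
  then obtain q where x: "x \<in> W q" by auto
  have y: "y \<in> total" using step by (simp add: total_def)
  have "sc c x \<in> total" using W_total[OF x] subspace_scale[OF subspace_total] by blast
  thus ?case
    using br_lin(2)[OF _ y W_total[OF u], of "sc c x"] br_lin(4)[OF W_total[OF x] y W_total[OF u]]
      W_total[OF br_degree[OF u x]] step(3)
    by (auto simp: total_def intro: span_add span_scale)
qed

lemma ad_word_total: "v \<in> total \<Longrightarrow> ad_word w v \<in> total"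
  by (induction w) (auto intro: br_total[OF \<phi>])

lemma ad_word_lin:
  assumes "v \<in> total" "v' \<in> total"
  shows "ad_word w (v + v') = ad_word w v + ad_word w v'" "ad_word w (sc q v) = sc q (ad_word w v)"
  using assms by (induction w) (auto simp: br_lin W_total[OF \<phi>] ad_word_total)

lemma ad_word_sum:
  assumes "finite A" "\<And>i. i \<in> A \<Longrightarrow> f i \<in> total"
  shows "ad_word w (\<Sum>i\<in>A. sc (c i) (f i)) = (\<Sum>i\<in>A. sc (c i) (ad_word w (f i)))
    \<and> (\<Sum>i\<in>A. sc (c i) (f i)) \<in> total"
  using assms
proof (induction A rule: finite_induct)
  case empty show ?case
    using ad_word_lin(2)[of 0 0 w 0] subspace_0[OF subspace_total] by simp
next
  case (insert i A)
  have "sc (c i) (f i) \<in> total" using insert.prems subspace_scale[OF subspace_total] by simp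
  thus ?case
    using insert ad_word_lin subspace_add[OF subspace_total] by simp
qed

lemma rnorm_W: "w \<noteq> [] \<Longrightarrow> rnorm w \<in> W (list_deg w)"
  by (induction w) (auto simp: \<phi> intro: br_degree)

lemma rnorm_total: "rnorm w \<in> total"
  using W_total[OF rnorm_W] subspace_0[OF subspace_total] by (cases "w = []") auto

lemma rnorm_append: "v \<noteq> [] \<Longrightarrow> rnorm (u @ v) = ad_word u (rnorm v)"
  by (induction u) auto

lemma ad_word_append: "ad_word (u @ v) x = ad_word u (ad_word v x)"
  by (induction u) auto

lemma dyn_lin: "dyn n (x + y) = dyn n x + dyn n y" "dyn n (q *\<^sub>Q x) = sc q (dyn n x)"
    "dyn n (x - y) = dyn n x - dyn n y"
  and act_lin: "act n (x + y) v = act n x v + act n y v" "act n (q *\<^sub>Q x) v = sc q (act n x v)"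
    "act n (x - y) v = act n x v - act n y v"
  by (simp_all add: dyn_def act_def scale_left_distrib scale_left_diff_distrib sum.distrib
      sum_subtractf scale_sum_right)

lemma sum_words_append:
  assumes "ncsupp x \<subseteq> {w. length w = m}" "ncsupp y \<subseteq> {w. length w = n}"
  shows "(\<Sum>w | length w = m + n. sc (coeff (x * y) w) (h w))
    = (\<Sum>u | length u = m. \<Sum>v | length v = n. sc (coeff x u) (sc (coeff y v) (h (u @ v))))"
proof -
  have x0: "coeff x p = 0" if "length p \<noteq> m" for p using assms(1) that by (auto simp: ncsupp_def)
  have xy: "coeff (x * y) (u @ v) = coeff x u * coeff y v" if "length u = m" "length v = n" for u v
  proof -
    have "coeff (x * y) (u @ v)
        = (\<Sum>i\<in>{m}. coeff x (take i (u @ v)) * coeff y (drop i (u @ v)))"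
      unfolding coeff_times
    proof (rule sum.mono_neutral_right)
      show "\<forall>i\<in>{..length (u @ v)} - {m}. coeff x (take i (u @ v)) * coeff y (drop i (u @ v)) = 0"
        using that by (intro ballI, subst x0) auto
    qed (use that in auto)
    thus ?thesis using that by simp
  qed
  have "(\<Sum>w | length w = m + n. sc (coeff (x * y) w) (h w))
      = (\<Sum>(u, v)\<in>{u. length u = m} \<times> {v. length v = n}. sc (coeff (x * y) (u @ v)) (h (u @ v)))"
    by (rule sum.reindex_bij_witness[where i = "\<lambda>(u, v). u @ v" and j = "\<lambda>w. (take m w, drop m w)"]) auto
  also have "\<dots> = (\<Sum>(u, v)\<in>{u. length u = m} \<times> {v. length v = n}.
      sc (coeff x u) (sc (coeff y v) (h (u @ v))))"
    by (rule sum.cong) (auto simp: xy)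
  finally show ?thesis by (simp add: sum.cartesian_product)
qed

lemma dyn_mult:
  assumes "ncsupp x \<subseteq> {w. length w = m}" "ncsupp y \<subseteq> {w. length w = n}" "0 < n"
  shows "dyn (m + n) (x * y) = act m x (dyn n y)"
proof -
  have "dyn (m + n) (x * y)
      = (\<Sum>u | length u = m. \<Sum>v | length v = n. sc (coeff x u) (sc (coeff y v) (rnorm (u @ v))))"
    unfolding dyn_def by (rule sum_words_append[OF assms(1,2)])
  also have "\<dots> = (\<Sum>u | length u = m. sc (coeff x u) (\<Sum>v | length v = n. sc (coeff y v) (ad_word u (rnorm v))))"
    using assms(3) by (auto simp: scale_sum_right rnorm_append intro!: sum.cong)
  also have "\<dots> = act m x (dyn n y)"
    unfolding act_def dyn_def using ad_word_sum[OF finite_words rnorm_total] by simp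
  finally show ?thesis .
qed

lemma act_mult:
  assumes "ncsupp x \<subseteq> {w. length w = m}" "ncsupp y \<subseteq> {w. length w = n}" "v \<in> total"
  shows "act (m + n) (x * y) v = act m x (act n y v)"
proof -
  have "act (m + n) (x * y) v
      = (\<Sum>u | length u = m. \<Sum>w | length w = n. sc (coeff x u) (sc (coeff y w) (ad_word (u @ w) v)))"
    unfolding act_def by (rule sum_words_append[OF assms(1,2)])
  also have "\<dots> = act m x (act n y v)"
    unfolding act_def using ad_word_sum[OF finite_words ad_word_total[OF assms(3)]]
    by (simp add: scale_sum_right ad_word_append)
  finally show ?thesis .
qed

lemma eval_word_W: "eval_word br' \<phi> t \<in> W (word_degree cell_deg t)"
  by (induction t) (auto simp: \<phi> intro: br_degree)

lemma eval_word_pure: "ncsupp (eval_word gbr gen t) \<subseteq> {w. length w = Suc (brackets t)}"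
  using ncsupp_eval_word[of t] by auto

lemma eval_word_homog: "homog (word_degree cell_deg t) (eval_word gbr gen t)"
  using ncsupp_eval_word[of t] by auto

lemma eval_word_Br:
  "eval_word gbr gen (Br s t) = eval_word gbr gen s * eval_word gbr gen t
    - koszul_sign (word_degree cell_deg s) (word_degree cell_deg t)
      *\<^sub>Q (eval_word gbr gen t * eval_word gbr gen s)"
  by (simp add: gbr_homog[OF eval_word_homog eval_word_homog])

lemma words_1:
  fixes s :: cell
  shows "(\<Sum>w | length w = Suc 0. sc (coeff (gen s) w) (h w)) = h [s]"
proof -
  have "(\<Sum>w | length w = Suc 0. sc (coeff (gen s) w) (h w)) = (\<Sum>w\<in>{[s]}. sc (coeff (gen s) w) (h w))"
    by (rule sum.mono_neutral_right[OF finite_words]) (auto simp: coeff_gen)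
  thus ?thesis by (simp add: coeff_gen)
qed

text \<open>A Lie word acts through its value in the target, by the Jacobi identity.\<close>

lemma act_eval_word:
  assumes "v \<in> W p"
  shows "act (Suc (brackets t)) (eval_word gbr gen t) v = br' (eval_word br' \<phi> t) v"
  using assms
proof (induction t arbitrary: v p)
  case (Gen s) show ?case by (simp add: act_def words_1)
next
  case (Br s t)
  note W = eval_word_W
  let ?m = "Suc (brackets s)" and ?n = "Suc (brackets t)"
  note vs = W_total[OF br_degree[OF W[of s] Br.prems]] and vt = W_total[OF br_degree[OF W[of t] Br.prems]]
  have "act (?m + ?n) (eval_word gbr gen s * eval_word gbr gen t) v
      = br' (eval_word br' \<phi> s) (br' (eval_word br' \<phi> t) v)"
    using Br.IH(2)[OF Br.prems] Br.IH(1)[OF br_degree[OF W[of t] Br.prems]]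
    by (simp add: act_mult[OF eval_word_pure eval_word_pure W_total[OF Br.prems]] del: add_Suc add_Suc_right)
  moreover have "act (?n + ?m) (eval_word gbr gen t * eval_word gbr gen s) v
      = br' (eval_word br' \<phi> t) (br' (eval_word br' \<phi> s) v)"
    using Br.IH(1)[OF Br.prems] Br.IH(2)[OF br_degree[OF W[of s] Br.prems]]
    by (simp add: act_mult[OF eval_word_pure eval_word_pure W_total[OF Br.prems]] del: add_Suc add_Suc_right)
  moreover have "Suc (brackets (Br s t)) = ?m + ?n" by simp
  ultimately show ?case
    unfolding eval_word_Br act_lin by (simp add: br_jacobi[OF W W Br.prems] add.commute)
qed

text \<open>The Dynkin--Specht--Wever identity: the right-normed bracketing multiplies a Lie word by its
  length. Since the left-hand side depends only on the associative series of \<open>t\<close>, so does the value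
  of \<open>t\<close> in the target, which is freeness.\<close>

lemma dyn_eval_word:
  "dyn (Suc (brackets t)) (eval_word gbr gen t) = sc (of_nat (Suc (brackets t))) (eval_word br' \<phi> t)"
proof (induction t)
  case (Gen s) show ?case by (simp add: dyn_def words_1)
next
  case (Br s t)
  note W = eval_word_W
  let ?m = "Suc (brackets s)" and ?n = "Suc (brackets t)"
  let ?s = "eval_word br' \<phi> s" and ?t = "eval_word br' \<phi> t"
  let ?k = "koszul_sign (word_degree cell_deg s) (word_degree cell_deg t)"
  have scW: "sc q (eval_word br' \<phi> t) \<in> W (word_degree cell_deg t)" for q t
    using subspace_scale[OF subspace_V W] .
  have "dyn (?m + ?n) (eval_word gbr gen s * eval_word gbr gen t) = sc (of_nat ?n) (br' ?s ?t)"
    using br_lin(4)[OF W_total[OF W] W_total[OF W] W_total[OF W]]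
    by (simp add: dyn_mult[OF eval_word_pure eval_word_pure] Br.IH act_eval_word[OF scW]
        del: add_Suc add_Suc_right of_nat_Suc)
  moreover have "dyn (?n + ?m) (eval_word gbr gen t * eval_word gbr gen s) = sc (of_nat ?m) (br' ?t ?s)"
    using br_lin(4)[OF W_total[OF W] W_total[OF W] W_total[OF W]]
    by (simp add: dyn_mult[OF eval_word_pure eval_word_pure] Br.IH act_eval_word[OF scW]
        del: add_Suc add_Suc_right of_nat_Suc)
  moreover have "br' ?t ?s = - sc ?k (br' ?s ?t)" by (rule br_antisym[OF W W])
  moreover have "?k * (of_nat ?m * ?k) = of_nat ?m" by (simp add: koszul_sign_def)
  ultimately have "dyn (?m + ?n) (eval_word gbr gen (Br s t))
      = sc (of_nat ?n) (br' ?s ?t) + sc (of_nat ?m) (br' ?s ?t)"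
    unfolding eval_word_Br dyn_lin by (simp add: add.commute del: of_nat_Suc)
  also have "\<dots> = sc (of_nat ?n + of_nat ?m) (br' ?s ?t)" by (simp only: scale_left_distrib)
  finally show ?case by (simp add: algebra_simps)
qed

text \<open>Division by the length turns the Dynkin map into the homomorphism that extends \<open>\<phi>\<close>.\<close>

definition lie_hom :: "cell ncseries \<Rightarrow> 'm" where
  "lie_hom x = (\<Sum>w\<in>ncsupp x. sc (coeff x w / of_nat (length w)) (rnorm w))"

lemma lie_hom_eq:
  assumes "finite A" "ncsupp x \<subseteq> A"
  shows "lie_hom x = (\<Sum>w\<in>A. sc (coeff x w / of_nat (length w)) (rnorm w))"
  unfolding lie_hom_def using assms by (intro sum.mono_neutral_left) (auto simp: ncsupp_def)

lemma lie_hom_lin: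
  assumes "finite (ncsupp x)" "finite (ncsupp y)"
  shows "lie_hom (x + y) = lie_hom x + lie_hom y" "lie_hom (sc' *\<^sub>Q x) = sc sc' (lie_hom x)"
proof -
  have sub: "ncsupp (x + y) \<subseteq> ncsupp x \<union> ncsupp y" "ncsupp (sc' *\<^sub>Q x) \<subseteq> ncsupp x"
    by (auto simp: ncsupp_def)
  show "lie_hom (x + y) = lie_hom x + lie_hom y"
    using lie_hom_eq[OF _ sub(1)] lie_hom_eq[of "ncsupp x \<union> ncsupp y" x] lie_hom_eq[of "ncsupp x \<union> ncsupp y" y] assms
    by (simp add: add_divide_distrib scale_left_distrib sum.distrib)
  show "lie_hom (sc' *\<^sub>Q x) = sc sc' (lie_hom x)"
    using lie_hom_eq[OF assms(1) sub(2)] by (simp add: lie_hom_def scale_sum_right)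
qed

lemma finite_ncsupp_word: "finite (ncsupp (eval_word gbr gen t))"
  using finite_subset[OF eval_word_pure finite_words] .

lemma lie_hom_word: "lie_hom (eval_word gbr gen t) = eval_word br' \<phi> t"
proof -
  let ?n = "Suc (brackets t)"
  have "lie_hom (eval_word gbr gen t) = sc (1 / of_nat ?n) (dyn ?n (eval_word gbr gen t))"
    unfolding lie_hom_eq[OF finite_words eval_word_pure] dyn_def scale_sum_right
    by (intro sum.cong) auto
  thus ?thesis by (simp add: dyn_eval_word del: of_nat_Suc)
qed

end

lemma free_lie_span: "free_lie n = ncs.span {eval_word gbr gen t |t. word_degree cell_deg t = n}"
proof (rule equalityI)
  show "free_lie n \<subseteq> ncs.span {eval_word gbr gen t |t. word_degree cell_deg t = n}"
    unfolding free_lie_def lie_part_def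
    by (intro ncs.span_minimal UN_least ncs.subspace_span ncs.span_mono) auto
  show "ncs.span {eval_word gbr gen t |t. word_degree cell_deg t = n} \<subseteq> free_lie n"
    unfolding free_lie_def lie_part_def by (intro ncs.span_mono) (force intro: ncs.span_base)
qed

lemma graded_lie_algebra_free_lie: "graded_lie_algebra scaleQ free_lie gbr"
proof (rule graded_lie_algebra_gbr)
  fix n x assume "x \<in> free_lie n"
  moreover have "free_lie n \<subseteq> {x. homog n x}"
    unfolding free_lie_span
    by (rule ncs.span_minimal[OF _ subspace_ncsupp]) (use ncsupp_eval_word in blast)
  ultimately show "homog n x" by blast
next
  fix p q u v assume "u \<in> free_lie p" "v \<in> free_lie q"
  thus "gbr u v \<in> free_lie (p + q)"
    unfolding free_lie_span
  proof (rule gbr_span_closed[OF _ _ ncs.subspace_span], safe)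
    fix s t
    show "gbr (eval_word gbr gen s) (eval_word gbr gen t) \<in> ncs.span {eval_word gbr gen ta |ta.
        word_degree cell_deg ta = word_degree cell_deg s + word_degree cell_deg t}"
      by (rule ncs.span_base, rule CollectI, rule exI[of _ "Br s t"]) simp
  qed
qed (simp add: free_lie_def)

lemma total_free_lie: "graded_lie_algebra.total scaleQ free_lie = ncs.span (range (eval_word gbr gen))"
proof -
  have "ncs.span (\<Union>n. free_lie n) = ncs.span (range (eval_word gbr gen))"
  proof (rule equalityI)
    show "ncs.span (\<Union>n. free_lie n) \<subseteq> ncs.span (range (eval_word gbr gen))"
      unfolding free_lie_span
      by (intro ncs.span_minimal UN_least ncs.subspace_span ncs.span_mono) auto
    show "ncs.span (range (eval_word gbr gen)) \<subseteq> ncs.span (\<Union>n. free_lie n)"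
      unfolding free_lie_span by (intro ncs.span_mono) (force intro: ncs.span_base)
  qed
  thus ?thesis by (simp add: graded_lie_algebra.total_def[OF graded_lie_algebra_free_lie])
qed

theorem free_lie_free: "free_graded_lie_algebra TYPE('m::ab_group_add) scaleQ free_lie gbr cell_deg gen"
  unfolding free_graded_lie_algebra_def
proof (intro conjI allI impI graded_lie_algebra_free_lie)
  fix s show "gen s \<in> free_lie (cell_deg s)"
    unfolding free_lie_span by (intro ncs.span_base CollectI exI[of _ "Gen s"]) simp
next
  fix sc :: "rat \<Rightarrow> 'm \<Rightarrow> 'm" and W br' \<phi>
  assume "graded_lie_algebra sc W br' \<and> (\<forall>i. \<phi> i \<in> W (cell_deg i))"
  then interpret lie_target sc W br' \<phi> by (simp add: lie_target_def lie_target_axioms_def)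
  let ?T = "ncs.span (range (eval_word gbr gen))"
  note T = total_free_lie
  have wT: "eval_word gbr gen t \<in> ?T" for t by (simp add: ncs.span_base)
  have fin: "finite (ncsupp x)" if "x \<in> ?T" for x
    using that
  proof (induction rule: ncs.span_induct_mem)
    case (step c x y)
    have "ncsupp (c *\<^sub>Q x + y) \<subseteq> ncsupp x \<union> ncsupp y" by (auto simp: ncsupp_def)
    thus ?case using step finite_ncsupp_word finite_subset by fastforce
  qed (simp add: ncsupp_def)
  have lin: "lie_hom (x + y) = lie_hom x + lie_hom y" "lie_hom (q *\<^sub>Q x) = sc q (lie_hom x)"
    if "x \<in> ?T" "y \<in> ?T" for x y q
    using lie_hom_lin[OF fin fin, OF that] by auto
  have hom_total: "lie_hom x \<in> total" if "x \<in> ?T" for x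
    using that
  proof (induction rule: ncs.span_induct_mem)
    case base show ?case using subspace_0[OF subspace_total] by (simp add: lie_hom_def ncsupp_def)
  next
    case (step c x y)
    then obtain t where x: "x = eval_word gbr gen t" by auto
    have "c *\<^sub>Q x \<in> ?T" using wT[of t] x ncs.span_scale by blast
    thus ?case
      using step wT[of t] W_total[OF eval_word_W[of t]] x subspace_add[OF subspace_total]
        subspace_scale[OF subspace_total] by (simp add: lin lie_hom_word)
  qed
  have zero: "lie_hom 0 = 0" by (simp add: lie_hom_def ncsupp_def)
  have hom_br_word: "gbr (eval_word gbr gen s) y \<in> ?T \<and>
      lie_hom (gbr (eval_word gbr gen s) y) = br' (eval_word br' \<phi> s) (lie_hom y)" if "y \<in> ?T" for s y
    using that
  proof (induction rule: ncs.span_induct_mem)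
    case base show ?case
      using br_zero[OF W_total[OF eval_word_W]] by (simp add: zero ncs.span_zero)
  next
    case (step c x y)
    then obtain t where x: "x = eval_word gbr gen t" by auto
    have st: "gbr (eval_word gbr gen s) x = eval_word gbr gen (Br s t)" by (simp add: x)
    have st_T: "eval_word gbr gen (Br s t) \<in> ?T" "c *\<^sub>Q eval_word gbr gen (Br s t) \<in> ?T" "x \<in> ?T" "c *\<^sub>Q x \<in> ?T"
      unfolding x by (intro ncs.span_scale wT)+
    have "lie_hom (gbr (eval_word gbr gen s) (c *\<^sub>Q x + y))
        = sc c (br' (eval_word br' \<phi> s) (eval_word br' \<phi> t)) + br' (eval_word br' \<phi> s) (lie_hom y)"
      unfolding gbr_linear st using st_T step lie_hom_word[of "Br s t"] by (simp add: lin)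
    also have "\<dots> = br' (eval_word br' \<phi> s) (lie_hom (c *\<^sub>Q x + y))"
      using st_T step hom_total[OF step(2)] W_total[OF eval_word_W] subspace_scale[OF subspace_total]
      by (simp add: lin x lie_hom_word br_lin(2,4))
    finally show ?case
      unfolding gbr_linear st using st_T step by (auto intro: ncs.span_add)
  qed
  have hom_br: "lie_hom (gbr x y) = br' (lie_hom x) (lie_hom y)" if "x \<in> ?T" "y \<in> ?T" for x y
  proof -
    have "gbr x y \<in> ?T \<and> lie_hom (gbr x y) = br' (lie_hom x) (lie_hom y)"
      using that(1)
    proof (induction rule: ncs.span_induct_mem)
      case base show ?case
        using br_zero[OF hom_total[OF that(2)]] by (simp add: zero ncs.span_zero)
    next
      case (step c x z)
      then obtain s where x: "x = eval_word gbr gen s" by auto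
      note w = hom_br_word[OF that(2), of s]
      have xT: "x \<in> ?T" "c *\<^sub>Q x \<in> ?T" and wT': "c *\<^sub>Q gbr x y \<in> ?T"
        using wT[of s] w x by (auto intro: ncs.span_scale)
      have "lie_hom (gbr (c *\<^sub>Q x + z) y) = sc c (lie_hom (gbr x y)) + lie_hom (gbr z y)"
        unfolding gbr_linear using wT' w x step by (simp add: lin)
      also have "\<dots> = br' (lie_hom (c *\<^sub>Q x + z)) (lie_hom y)"
        using w xT step hom_total[OF step(2)] hom_total[OF that(2)] W_total[OF eval_word_W]
          subspace_scale[OF subspace_total]
        by (simp add: lin x lie_hom_word br_lin(1,3))
      finally show ?case
        unfolding gbr_linear using wT' step by (auto intro: ncs.span_add)
    qed
    thus ?thesis ..
  qed
  have hom_deg: "lie_hom x \<in> W n" if "x \<in> free_lie n" for x n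
  proof -
    have "x \<in> ?T \<and> lie_hom x \<in> W n"
      using that unfolding free_lie_span
    proof (induction rule: ncs.span_induct_mem)
      case base show ?case using subspace_0[OF subspace_V] by (simp add: zero ncs.span_zero)
    next
      case (step c x y)
      then obtain t where x: "x = eval_word gbr gen t" "word_degree cell_deg t = n" by auto
      have "x \<in> ?T" "c *\<^sub>Q x \<in> ?T" using wT[of t] x by (auto intro: ncs.span_scale)
      moreover have "lie_hom x \<in> W n" using eval_word_W[of t] x lie_hom_word[of t] by simp
      ultimately show ?case
        using step subspace_add[OF subspace_V] subspace_scale[OF subspace_V]
        by (auto simp: lin intro: ncs.span_add)
    qed
    thus ?thesis ..
  qed
  have brT: "gbr x y \<in> ?T" if "x \<in> ?T" "y \<in> ?T" for x y
    using that
  proof (rule gbr_span_closed[OF _ _ ncs.subspace_span], clarify)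
    fix s t show "gbr (eval_word gbr gen s) (eval_word gbr gen t) \<in> ?T"
      using wT[of "Br s t"] by simp
  qed
  have FT: "free_lie n \<subseteq> ?T" for n
    unfolding free_lie_span by (rule ncs.span_mono) auto
  show "\<exists>!\<psi>. \<psi> \<in> extensional (graded_lie_algebra.total scaleQ free_lie) \<and>
      graded_lie_hom scaleQ free_lie gbr sc W br' \<psi> \<and> (\<forall>i. \<psi> (gen i) = \<phi> i)"
    unfolding T graded_lie_hom_def Let_def
  proof (rule ex1I[of _ "restrict lie_hom ?T"])
    have "gen i \<in> ?T" "lie_hom (gen i) = \<phi> i" for i
      using wT[of "Gen i"] lie_hom_word[of "Gen i"] by auto
    thus "restrict lie_hom ?T \<in> extensional ?T \<and>
      ((\<forall>u\<in>?T. \<forall>v\<in>?T. restrict lie_hom ?T (u + v) = restrict lie_hom ?T u + restrict lie_hom ?T v \<and>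
          restrict lie_hom ?T (gbr u v) = br' (restrict lie_hom ?T u) (restrict lie_hom ?T v)) \<and>
       (\<forall>q. \<forall>u\<in>?T. restrict lie_hom ?T (q *\<^sub>Q u) = sc q (restrict lie_hom ?T u)) \<and>
       (\<forall>n. \<forall>u\<in>free_lie n. restrict lie_hom ?T u \<in> W n)) \<and>
      (\<forall>i. restrict lie_hom ?T (gen i) = \<phi> i)"
      using FT by (auto simp: lin hom_br hom_deg brT ncs.span_add ncs.span_scale subset_iff)
  next
    fix \<psi>
    assume \<psi>: "\<psi> \<in> extensional ?T \<and>
      ((\<forall>u\<in>?T. \<forall>v\<in>?T. \<psi> (u + v) = \<psi> u + \<psi> v \<and> \<psi> (gbr u v) = br' (\<psi> u) (\<psi> v)) \<and>
       (\<forall>q. \<forall>u\<in>?T. \<psi> (q *\<^sub>Q u) = sc q (\<psi> u)) \<and> (\<forall>n. \<forall>u\<in>free_lie n. \<psi> u \<in> W n)) \<and>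
      (\<forall>i. \<psi> (gen i) = \<phi> i)"
    have word: "\<psi> (eval_word gbr gen t) = eval_word br' \<phi> t" for t
      by (induction t) (use \<psi> wT in auto)
    have "\<psi> x = lie_hom x" if "x \<in> ?T" for x
      using that
    proof (induction rule: ncs.span_induct_mem)
      case base
      have "\<psi> (0 *\<^sub>Q 0) = sc 0 (\<psi> 0)" using \<psi> ncs.span_zero by blast
      thus ?case by (simp add: zero)
    next
      case (step c x y)
      then obtain t where x: "x = eval_word gbr gen t" by auto
      have "x \<in> ?T" "c *\<^sub>Q x \<in> ?T" using wT[of t] x by (auto intro: ncs.span_scale)
      moreover have "\<psi> x = lie_hom x" by (simp add: x word lie_hom_word)
      ultimately show ?case using step \<psi> by (simp add: lin)
    qed
    thus "\<psi> = restrict lie_hom ?T" using \<psi> by (intro extensionalityI[of _ ?T]) auto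
  qed
qed


subsection \<open>Closure of the completed Lie algebra under limits\<close>

interpretation free_target: lie_target scaleQ free_lie gbr gen
proof (rule lie_target.intro[OF graded_lie_algebra_free_lie], unfold_locales)
  fix s show "gen s \<in> free_lie (cell_deg s)"
    using free_lie_free[where 'm = int] by (simp add: free_graded_lie_algebra_def)
qed

fun right_word :: "cell list \<Rightarrow> cell lie_word" where
  "right_word [s] = Gen s"
| "right_word (s # w) = Br (Gen s) (right_word w)"
| "right_word [] = undefined"

lemma right_word:
  assumes "w \<noteq> []"
  shows "free_target.rnorm w = eval_word gbr gen (right_word w)" "set_lie_word (right_word w) = set w"
    "word_degree cell_deg (right_word w) = list_deg w" "Suc (brackets (right_word w)) = length w"
  using assms by (induction w rule: right_word.induct) auto

text \<open>By the Dynkin--Specht--Wever identity the Lie elements of length \<open>m + 1\<close> are cut out by linear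
  equations with finitely many terms, hence they are closed under limits.\<close>

lemma lie_part_iff_dyn:
  "x \<in> lie_part S n m \<longleftrightarrow> ncsupp x \<subseteq> {w. list_deg w = n \<and> length w = Suc m \<and> set w \<subseteq> S}
    \<and> free_target.dyn (Suc m) x = of_nat (Suc m) *\<^sub>Q x"
proof
  assume x: "x \<in> lie_part S n m"
  have "free_target.dyn (Suc m) x = of_nat (Suc m) *\<^sub>Q x"
    using x unfolding lie_part_def
  proof (induction rule: ncs.span_induct_mem)
    case base show ?case by (simp add: free_target.dyn_def)
  next
    case (step c x y)
    then obtain t where "x = eval_word gbr gen t" "brackets t = m" by auto
    hence "free_target.dyn (Suc m) x = of_nat (Suc m) *\<^sub>Q x"
      using free_target.dyn_eval_word[of t] by simp
    thus ?case using step by (simp add: free_target.dyn_lin scaleQ_add mult.commute del: of_nat_Suc)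
  qed
  thus "ncsupp x \<subseteq> {w. list_deg w = n \<and> length w = Suc m \<and> set w \<subseteq> S}
    \<and> free_target.dyn (Suc m) x = of_nat (Suc m) *\<^sub>Q x" using ncsupp_lie_part[OF x] by blast
next
  assume x: "ncsupp x \<subseteq> {w. list_deg w = n \<and> length w = Suc m \<and> set w \<subseteq> S}
    \<and> free_target.dyn (Suc m) x = of_nat (Suc m) *\<^sub>Q x"
  have "free_target.dyn (Suc m) x \<in> lie_part S n m"
    unfolding free_target.dyn_def
  proof (rule ncs.subspace_sum[OF subspace_lie_part])
    fix w :: "cell list" assume "w \<in> {w. length w = Suc m}"
    hence w: "length w = Suc m" "w \<noteq> []" by auto
    show "coeff x w *\<^sub>Q free_target.rnorm w \<in> lie_part S n m"
    proof (cases "coeff x w = 0")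
      case True thus ?thesis using ncs.subspace_0[OF subspace_lie_part] by simp
    next
      case False
      hence "list_deg w = n" "set w \<subseteq> S" using x by (auto simp: ncsupp_def)
      hence "free_target.rnorm w \<in> lie_part S n m"
        unfolding lie_part_def right_word(1)[OF w(2)] using right_word(2-4)[OF w(2)] w(1)
        by (intro ncs.span_base CollectI exI[of _ "right_word w"]) auto
      thus ?thesis by (rule ncs.subspace_scale[OF subspace_lie_part])
    qed
  qed
  hence "(1 / of_nat (Suc m)) *\<^sub>Q free_target.dyn (Suc m) x \<in> lie_part S n m"
    by (rule ncs.subspace_scale[OF subspace_lie_part])
  thus "x \<in> lie_part S n m" using x by (simp del: of_nat_Suc)
qed

lemma cl_tendsto:
  assumes s: "\<And>k. s k \<in> completed_lie S n" and lim: "ncs_tendsto s x"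
  shows "x \<in> completed_lie S n"
proof -
  have eq: "real_of_rat a = real_of_rat b" if "f \<longlonglongrightarrow> real_of_rat a" "f \<longlonglongrightarrow> real_of_rat b" for f a b
    using LIMSEQ_unique that by blast
  have zero: "coeff x w = 0" if "\<And>k. coeff (s k) w = 0" for w
  proof -
    have "(\<lambda>k. real_of_rat (coeff (s k) w)) \<longlonglongrightarrow> real_of_rat (coeff x w)"
      using lim by (simp add: ncs_tendsto_def)
    thus ?thesis using eq[of "\<lambda>_. 0" "coeff x w" 0] that by simp
  qed
  show ?thesis unfolding completed_lie_def
  proof (intro CollectI conjI allI)
    show "coeff x [] = 0" by (rule zero) (rule cl_Nil[OF s])
    fix m
    have sup: "ncsupp (length_part (Suc m) x) \<subseteq> {w. list_deg w = n \<and> length w = Suc m \<and> set w \<subseteq> S}"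
    proof
      fix w assume w: "w \<in> ncsupp (length_part (Suc m) x)"
      hence len: "length w = Suc m" "coeff x w \<noteq> 0" by (auto simp: ncsupp_def coeff_length_part split: if_splits)
      then obtain k where "coeff (s k) w \<noteq> 0" using zero by blast
      thus "w \<in> {w. list_deg w = n \<and> length w = Suc m \<and> set w \<subseteq> S}"
        using cl_supp[OF s, of k] len by (auto simp: ncsupp_def)
    qed
    have "free_target.dyn (Suc m) (length_part (Suc m) x) = of_nat (Suc m) *\<^sub>Q length_part (Suc m) x"
    proof (rule ncseries_eqI)
      fix v
      let ?d = "\<lambda>y. coeff (free_target.dyn (Suc m) (length_part (Suc m) y)) v"
      let ?e = "\<lambda>y. coeff (of_nat (Suc m) *\<^sub>Q length_part (Suc m) y) v"
      have l: "(\<lambda>k. real_of_rat (coeff (length_part (Suc m) (s k)) w)) \<longlonglongrightarrow> real_of_rat (coeff (length_part (Suc m) x) w)" for w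
        using lim by (auto simp: ncs_tendsto_def coeff_length_part)
      have "(\<lambda>k. real_of_rat (?d (s k))) \<longlonglongrightarrow> real_of_rat (?d x)"
        unfolding free_target.dyn_def coeff_sum coeff_scaleQ of_rat_sum of_rat_mult
        by (intro tendsto_sum tendsto_mult l tendsto_const)
      moreover have "(\<lambda>k. real_of_rat (?e (s k))) \<longlonglongrightarrow> real_of_rat (?e x)"
        unfolding coeff_scaleQ of_rat_mult by (intro tendsto_mult l tendsto_const)
      moreover have "?d (s k) = ?e (s k)" for k
        using cl_part[OF s, of m k] unfolding lie_part_iff_dyn by simp
      ultimately show "?d x = ?e x" using eq by fastforce
    qed
    with sup show "length_part (Suc m) x \<in> lie_part S n m" unfolding lie_part_iff_dyn by blast
  qed
qed


section \<open>Convergence of the path to the centre\<close>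

subsection \<open>Exponential sums\<close>

text \<open>The sequences \<open>n \<mapsto> \<Sum>l. c\<^sub>l l\<^sup>n\<close> with ratios \<open>l\<close> in \<open>K\<close>. Knowing all coefficients of the edges in
  this form gives convergence and, what estimates would not give, rational limits.\<close>

inductive_set exp_sums :: "rat set \<Rightarrow> (nat \<Rightarrow> rat) set" for K where
  zero: "(\<lambda>n. 0) \<in> exp_sums K"
| step: "s \<in> exp_sums K \<Longrightarrow> l \<in> K \<Longrightarrow> (\<lambda>n. s n + c * l ^ n) \<in> exp_sums K"

lemma exp_sums_mono: "s \<in> exp_sums K \<Longrightarrow> K \<subseteq> L \<Longrightarrow> s \<in> exp_sums L"
  by (induction rule: exp_sums.induct) (auto intro: exp_sums.intros)

lemma exp_sums_add: "s \<in> exp_sums K \<Longrightarrow> t \<in> exp_sums K \<Longrightarrow> (\<lambda>n. s n + t n) \<in> exp_sums K"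
proof (induction rule: exp_sums.induct)
  case (step s l c)
  have "(\<lambda>n. (s n + t n) + c * l ^ n) \<in> exp_sums K" by (rule exp_sums.step) (use step in auto)
  thus ?case by (simp add: algebra_simps)
qed simp

lemma exp_sums_scale: "s \<in> exp_sums K \<Longrightarrow> (\<lambda>n. q * s n) \<in> exp_sums K"
proof (induction rule: exp_sums.induct)
  case zero thus ?case using exp_sums.zero by simp
next
  case (step s l c)
  have "(\<lambda>n. q * s n + (q * c) * l ^ n) \<in> exp_sums K" by (rule exp_sums.step) (use step in auto)
  thus ?case by (simp add: algebra_simps)
qed

lemma exp_sums_diff: "s \<in> exp_sums K \<Longrightarrow> t \<in> exp_sums K \<Longrightarrow> (\<lambda>n. s n - t n) \<in> exp_sums K"
  using exp_sums_add[of s K "\<lambda>n. - 1 * t n"] exp_sums_scale[of t K "-1"] by simp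

lemma exp_sums_sum: "(\<And>i. i \<in> A \<Longrightarrow> f i \<in> exp_sums K) \<Longrightarrow> (\<lambda>n. \<Sum>i\<in>A. f i n) \<in> exp_sums K"
  by (induction A rule: infinite_finite_induct) (auto intro: exp_sums.zero exp_sums_add)

lemma exp_sums_mult:
  assumes "s \<in> exp_sums K" "t \<in> exp_sums L" "\<And>k l. k \<in> K \<Longrightarrow> l \<in> L \<Longrightarrow> k * l \<in> M"
  shows "(\<lambda>n. s n * t n) \<in> exp_sums M"
  using assms(1)
proof (induction rule: exp_sums.induct)
  case zero thus ?case using exp_sums.zero by simp
next
  case (step s k c)
  have "(\<lambda>n. c * k ^ n * t n) \<in> exp_sums M"
    using assms(2)
  proof (induction rule: exp_sums.induct)
    case zero thus ?case using exp_sums.zero by simp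
  next
    case (step t l d)
    have "(\<lambda>n. c * k ^ n * t n + (c * d) * (k * l) ^ n) \<in> exp_sums M"
      by (rule exp_sums.step) (use step assms(3) \<open>k \<in> K\<close> in auto)
    thus ?case by (simp add: algebra_simps power_mult_distrib)
  qed
  from exp_sums_add[OF step.IH this] show ?case by (simp add: algebra_simps)
qed

lemma exp_sums_const: "1 \<in> K \<Longrightarrow> (\<lambda>n. c) \<in> exp_sums K"
  using exp_sums.step[OF exp_sums.zero, of 1 K c] by simp

lemma exp_sums_shift: "s \<in> exp_sums K \<Longrightarrow> (\<lambda>n. s (Suc n)) \<in> exp_sums K"
proof (induction rule: exp_sums.induct)
  case zero thus ?case using exp_sums.zero by simp
next
  case (step s l c)
  have "(\<lambda>n. s (Suc n) + (c * l) * l ^ n) \<in> exp_sums K" by (rule exp_sums.step) (use step in auto)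
  thus ?case by (simp add: algebra_simps)
qed

text \<open>A linear recurrence is solved by exponential sums as long as its ratio does not resonate with
  those of the inhomogeneous term.\<close>

lemma exp_sums_recurrence:
  assumes "s \<in> exp_sums K" "\<mu> \<notin> K" "\<And>n. x (Suc n) = \<mu> * x n + s n"
  shows "x \<in> exp_sums (insert \<mu> K)"
  using assms(1,3)
proof (induction arbitrary: x rule: exp_sums.induct)
  case zero
  hence "x n = x 0 * \<mu> ^ n" for n by (induction n) auto
  hence "x = (\<lambda>n. 0 + x 0 * \<mu> ^ n)" unfolding add_0 by (rule ext)
  thus ?case using exp_sums.step[OF exp_sums.zero, of \<mu> "insert \<mu> K" "x 0"] by simp
next
  case (step s l c)
  \<comment> \<open>\<open>d l\<^sup>n\<close> is a particular solution for the inhomogeneous term \<open>c l\<^sup>n\<close>.\<close>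
  define d where "d = c / (l - \<mu>)"
  have "l \<noteq> \<mu>" using step.hyps assms(2) by auto
  hence "d * (l - \<mu>) = c" by (simp add: d_def)
  hence d: "c = d * l - \<mu> * d" by (simp add: algebra_simps)
  have "(\<lambda>n. x n - d * l ^ n) \<in> exp_sums (insert \<mu> K)"
    by (rule step.IH) (simp add: step.prems d algebra_simps)
  from exp_sums.step[OF this, of l d] step.hyps show ?case by simp
qed

lemma exp_sums_tendsto_0:
  assumes "s \<in> exp_sums K" "\<And>l. l \<in> K \<Longrightarrow> \<bar>l\<bar> < 1"
  shows "(\<lambda>n. real_of_rat (s n)) \<longlonglongrightarrow> 0"
  using assms(1)
proof (induction rule: exp_sums.induct)
  case (step s l c)
  have "\<bar>real_of_rat l\<bar> < 1" using assms(2)[OF step(2)] by (metis of_rat_1 of_rat_less abs_of_rat)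
  hence "(\<lambda>n. real_of_rat l ^ n) \<longlonglongrightarrow> 0" by (intro LIMSEQ_power_zero) simp
  from tendsto_add[OF step.IH tendsto_mult_left[OF this, of "real_of_rat c"]] show ?case
    by (simp add: of_rat_add of_rat_mult of_rat_power)
qed simp

lemma exp_sums_convergent:
  assumes "s \<in> exp_sums (insert 1 K)" "\<And>l. l \<in> K \<Longrightarrow> \<bar>l\<bar> < 1"
  shows "\<exists>L. (\<lambda>n. real_of_rat (s n)) \<longlonglongrightarrow> real_of_rat L"
  using assms(1)
proof (induction rule: exp_sums.induct)
  case zero show ?case by (rule exI[of _ 0]) simp
next
  case (step s l c)
  then obtain L where L: "(\<lambda>n. real_of_rat (s n)) \<longlonglongrightarrow> real_of_rat L" by auto
  have "\<exists>M. (\<lambda>n. real_of_rat (c * l ^ n)) \<longlonglongrightarrow> real_of_rat M"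
  proof (cases "l = 1")
    case False
    hence "l \<in> K" using step.hyps by auto
    from exp_sums_tendsto_0[OF exp_sums.step[OF exp_sums.zero this] assms(2), of c]
    show ?thesis by (intro exI[of _ 0]) simp
  qed auto
  then obtain M where "(\<lambda>n. real_of_rat (c * l ^ n)) \<longlonglongrightarrow> real_of_rat M" ..
  from tendsto_add[OF L this] show ?case by (intro exI[of _ "L + M"]) (simp add: of_rat_add)
qed


subsection \<open>Sequences of series with geometrically decreasing coefficients\<close>

definition ratios :: "nat \<Rightarrow> rat set" where
  "ratios p = {l. \<exists>k\<ge>p. \<bar>l\<bar> = 1 / 2 ^ k}"

lemma ratios_mult: "k \<in> ratios p \<Longrightarrow> l \<in> ratios q \<Longrightarrow> k * l \<in> ratios (p + q)"
  unfolding ratios_def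
proof clarify
  fix i j assume "p \<le> i" "q \<le> j" "\<bar>k\<bar> = 1 / 2 ^ i" "\<bar>l\<bar> = 1 / 2 ^ j"
  thus "\<exists>m\<ge>p + q. \<bar>k * l\<bar> = 1 / 2 ^ m"
    by (intro exI[of _ "i + j"]) (simp add: abs_mult power_add)
qed

lemma ratios_mono: "q \<le> p \<Longrightarrow> ratios p \<subseteq> ratios q"
  by (auto simp: ratios_def intro: order.trans)

lemma ratios_less_1: "l \<in> ratios (Suc 0) \<Longrightarrow> \<bar>l\<bar> < 1"
proof -
  assume "l \<in> ratios (Suc 0)"
  then obtain k where k: "Suc 0 \<le> k" "\<bar>l\<bar> = 1 / 2 ^ k" by (auto simp: ratios_def)
  hence "(1 :: rat) < 2 ^ k" by (intro one_less_power) auto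
  thus ?thesis using k by (simp add: divide_less_eq)
qed

lemma half_ratios: "- (1 / 2) \<in> ratios (Suc 0)" "- (1 / 2) \<notin> ratios 2"
proof -
  show "- (1 / 2) \<in> ratios (Suc 0)" by (auto simp: ratios_def intro!: exI[of _ 1])
  show "- (1 / 2) \<notin> ratios 2"
  proof
    assume "- (1 / 2) \<in> ratios 2"
    then obtain k where k: "2 \<le> k" "(1 / 2 :: rat) = 1 / 2 ^ k" by (auto simp: ratios_def)
    hence "(2 :: rat) ^ 1 = 2 ^ k" by (simp add: field_simps)
    hence "k = 1" by (subst (asm) power_inject_exp) auto
    thus False using k by simp
  qed
qed

definition geom :: "rat set \<Rightarrow> nat \<Rightarrow> (nat \<Rightarrow> 'x ncseries) \<Rightarrow> bool" where
  "geom K k s \<longleftrightarrow> (\<forall>w. length w \<le> k \<longrightarrow> (\<lambda>n. coeff (s n) w) \<in> exp_sums K)"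

lemma geomD: "geom K k s \<Longrightarrow> length w \<le> k \<Longrightarrow> (\<lambda>n. coeff (s n) w) \<in> exp_sums K"
  by (simp add: geom_def)

lemma geom_add: "geom K k s \<Longrightarrow> geom K k t \<Longrightarrow> geom K k (\<lambda>n. s n + t n)"
  and geom_diff: "geom K k s \<Longrightarrow> geom K k t \<Longrightarrow> geom K k (\<lambda>n. s n - t n)"
  and geom_scale: "geom K k s \<Longrightarrow> geom K k (\<lambda>n. q *\<^sub>Q s n)"
  by (simp_all add: geom_def exp_sums_add exp_sums_diff exp_sums_scale)

lemma geom_mult_gen:
  assumes "geom K k s" "geom L k t" "\<And>a b. a \<in> K \<Longrightarrow> b \<in> L \<Longrightarrow> a * b \<in> M"
  shows "geom M k (\<lambda>n. s n * t n)"
  unfolding geom_def coeff_times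
proof (intro allI impI exp_sums_sum)
  fix w :: "'a list" and i assume "length w \<le> k"
  thus "(\<lambda>n. coeff (s n) (take i w) * coeff (t n) (drop i w)) \<in> exp_sums M"
    by (intro exp_sums_mult[OF geomD[OF assms(1)] geomD[OF assms(2)] assms(3)]) auto
qed

text \<open>\<open>small k s\<close> controls the coefficients of \<open>s\<close> up to length \<open>k\<close>. A product of two such sequences is
  controlled up to length \<open>k + 1\<close>, and with smaller ratios; \<open>near k\<close> is equality up to such products.\<close>

definition small :: "nat \<Rightarrow> (nat \<Rightarrow> 'x ncseries) \<Rightarrow> bool" where
  "small k s \<longleftrightarrow> geom (ratios 1) k s \<and> (\<forall>n. coeff (s n) [] = 0)"

definition near :: "nat \<Rightarrow> (nat \<Rightarrow> 'x ncseries) \<Rightarrow> (nat \<Rightarrow> 'x ncseries) \<Rightarrow> bool" where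
  "near k s t \<longleftrightarrow> geom (ratios 2) (Suc k) (\<lambda>n. s n - t n)"

lemma small_add: "small k s \<Longrightarrow> small k t \<Longrightarrow> small k (\<lambda>n. s n + t n)"
  and small_scale: "small k s \<Longrightarrow> small k (\<lambda>n. q *\<^sub>Q s n)"
  by (simp_all add: small_def geom_add geom_scale)

lemma small_shift: "small k s \<Longrightarrow> small k (\<lambda>n. s (Suc n))"
  unfolding small_def geom_def using exp_sums_shift[where s = "\<lambda>n. coeff (s n) w" for w] by blast

lemma small_mult: "small k s \<Longrightarrow> small k t \<Longrightarrow> small k (\<lambda>n. s n * t n)"
  unfolding small_def
  using geom_mult_gen[of "ratios 1" k s "ratios 1" t "ratios 1"] ratios_mult[of _ 1 _ 1]
    ratios_mono[of 1 "1 + 1"] by auto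

lemma geom_mult:
  assumes "small k s" "small k t" shows "geom (ratios 2) (Suc k) (\<lambda>n. s n * t n)"
  unfolding geom_def coeff_times
proof (intro allI impI exp_sums_sum)
  fix w :: "'a list" and i assume w: "length w \<le> Suc k" and i: "i \<in> {..length w}"
  show "(\<lambda>n. coeff (s n) (take i w) * coeff (t n) (drop i w)) \<in> exp_sums (ratios 2)"
  proof (cases "i = 0 \<or> i = length w")
    case True
    hence "(\<lambda>n. coeff (s n) (take i w) * coeff (t n) (drop i w)) = (\<lambda>n. 0)"
      using assms by (auto simp: small_def)
    thus ?thesis using exp_sums.zero by simp
  next
    case False
    thus ?thesis
      using assms w i ratios_mult[of _ 1 _ 1] unfolding small_def
      by (intro exp_sums_mult[OF geomD[of "ratios 1" k s] geomD[of "ratios 1" k t]])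
        (auto simp: numeral_2_eq_2)
  qed
qed

lemma near_trans: "near k s t \<Longrightarrow> near k t u \<Longrightarrow> near k s u"
  using geom_add[of "ratios 2" "Suc k" "\<lambda>n. s n - t n" "\<lambda>n. t n - u n"] by (simp add: near_def)

lemma near_add: "near k s t \<Longrightarrow> near k s' t' \<Longrightarrow> near k (\<lambda>n. s n + s' n) (\<lambda>n. t n + t' n)"
  using geom_add[of "ratios 2" "Suc k" "\<lambda>n. s n - t n" "\<lambda>n. s' n - t' n"]
  by (simp add: near_def algebra_simps)

lemma near_mult: "small k s \<Longrightarrow> small k t \<Longrightarrow> near k (\<lambda>n. s n * t n) (\<lambda>n. 0)"
  using geom_mult by (simp add: near_def)

lemma small_near_nceval:
  assumes s: "small k s" and F: "fps_nth F 0 = 0"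
  shows "small k (\<lambda>n. nceval (s n) F)" "near k (\<lambda>n. nceval (s n) F) (\<lambda>n. fps_nth F 1 *\<^sub>Q s n)"
proof -
  have s0: "coeff (s n) [] = 0" for n using s by (simp add: small_def)
  have pow: "small k (\<lambda>n. s n ^ Suc j)" for j
  proof (induction j)
    case 0 show ?case using s by simp
  next
    case (Suc j) thus ?case using small_mult[OF s Suc] by simp
  qed
  show "small k (\<lambda>n. nceval (s n) F)"
    unfolding small_def geom_def
  proof (intro conjI allI impI)
    fix w :: "'a list" assume w: "length w \<le> k"
    have "(\<lambda>n. fps_nth F j * coeff (s n ^ j) w) \<in> exp_sums (ratios 1)" for j
      using pow w F exp_sums.zero by (cases j) (auto simp: small_def geom_def intro!: exp_sums_scale simp del: power_Suc)
    thus "(\<lambda>n. coeff (nceval (s n) F) w) \<in> exp_sums (ratios 1)"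
      unfolding coeff_nceval[OF s0 order.refl] by (intro exp_sums_sum)
  qed (simp add: F)
  show "near k (\<lambda>n. nceval (s n) F) (\<lambda>n. fps_nth F 1 *\<^sub>Q s n)"
    unfolding near_def geom_def
  proof (intro allI impI)
    fix w :: "'a list" assume w: "length w \<le> Suc k"
    have "coeff (nceval (s n) F - fps_nth F 1 *\<^sub>Q s n) w
        = (\<Sum>j\<le>length w. fps_nth F (Suc (Suc j)) * coeff (s n * s n ^ Suc j) w)" for n
    proof -
      have "length w \<le> Suc (Suc (length w))" by simp
      from coeff_nceval[OF s0 this, of n F] show ?thesis
        by (subst (asm) sum.atMost_Suc_shift, subst (asm) sum.atMost_Suc_shift) (simp add: F)
    qed
    moreover have "(\<lambda>n. fps_nth F (Suc (Suc j)) * coeff (s n * s n ^ Suc j) w) \<in> exp_sums (ratios 2)" for j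
      by (rule exp_sums_scale[OF geomD[OF geom_mult[OF s pow] w]])
    ultimately show "(\<lambda>n. coeff (nceval (s n) F - fps_nth F 1 *\<^sub>Q s n) w) \<in> exp_sums (ratios 2)"
      by (simp only:) (rule exp_sums_sum)
  qed
qed

lemma small_near_exp:
  assumes s: "small k s"
  shows "small k (\<lambda>n. ncs_exp (s n) - 1)" "near k (\<lambda>n. ncs_exp (s n) - 1) s"
  using small_near_nceval[OF s, of "fps_exp 1 - 1"] by (simp_all add: nceval_diff ncs_exp_eq)

lemma small_near_exp_mult:
  assumes s: "small k s" and t: "small k t"
  shows "small k (\<lambda>n. ncs_exp (s n) * ncs_exp (t n) - 1)"
    "near k (\<lambda>n. ncs_exp (s n) * ncs_exp (t n) - 1) (\<lambda>n. s n + t n)"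
proof -
  note s' = small_near_exp[OF s] and t' = small_near_exp[OF t]
  have eq: "(\<lambda>n. ncs_exp (s n) * ncs_exp (t n) - 1) = (\<lambda>n. (ncs_exp (s n) - 1) + (ncs_exp (t n) - 1)
      + (ncs_exp (s n) - 1) * (ncs_exp (t n) - 1))"
    by (simp add: algebra_simps del: one_add_one)
  show "small k (\<lambda>n. ncs_exp (s n) * ncs_exp (t n) - 1)"
    unfolding eq by (intro small_add small_mult s' t')
  show "near k (\<lambda>n. ncs_exp (s n) * ncs_exp (t n) - 1) (\<lambda>n. s n + t n)"
    unfolding eq using near_add[OF near_add[OF s'(2) t'(2)] near_mult[OF s'(1) t'(1)]] by simp
qed

lemma near_BCH:
  assumes s: "small k s" and t: "small k t"
  shows "near k (\<lambda>n. BCH [s n, t n]) (\<lambda>n. s n + t n)"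
proof -
  have "near k (\<lambda>n. BCH [s n, t n]) (\<lambda>n. ncs_exp (s n) * ncs_exp (t n) - 1)"
    using small_near_nceval(2)[OF small_near_exp_mult(1)[OF s t], of "fps_ln 1"]
    by (simp add: fps_ln_nth BCH_def ncs_log_eq)
  thus ?thesis using small_near_exp_mult(2)[OF s t] by (rule near_trans)
qed


subsection \<open>The edges of the inner triangles\<close>

definition e_seq :: "nat \<Rightarrow> cell ncseries" where
  "e_seq n = fst (edges n)"

lemma edge_seq_0:
  "e_seq 0 = BCH [(- 1/3) *\<^sub>Q BCH [e_gen, f_gen, g_gen], e_gen]"
  "f_seq 0 = BCH [(- 1/3) *\<^sub>Q BCH [f_gen, g_gen, e_gen], f_gen]"
  "g_seq 0 = BCH [(- 1/3) *\<^sub>Q BCH [g_gen, e_gen, f_gen], g_gen]"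
  by (simp_all add: e_seq_def f_seq_def g_seq_def)

lemma edge_seq_Suc:
  "e_seq (Suc n) = BCH [(1/2) *\<^sub>Q f_seq n, (1/2) *\<^sub>Q g_seq n]"
  "f_seq (Suc n) = BCH [(1/2) *\<^sub>Q g_seq n, (1/2) *\<^sub>Q e_seq n]"
  "g_seq (Suc n) = BCH [(1/2) *\<^sub>Q e_seq n, (1/2) *\<^sub>Q f_seq n]"
  by (simp_all add: e_seq_def f_seq_def g_seq_def split: prod.split)

lemma edge_seq_Nil [simp]: "coeff (e_seq n) [] = 0" "coeff (f_seq n) [] = 0" "coeff (g_seq n) [] = 0"
  by (cases n; simp add: edge_seq_0 edge_seq_Suc)+

lemma conj_exp:
  assumes "P * P' = 1" "P' * P = 1" "coeff x [] = 0"
  shows "ncs_exp (P * x * P') = P * ncs_exp x * P'"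
proof -
  let ?Q = "\<lambda>v. P * v * P'"
  have lin: "filt_lin 0 ?Q"
    using filt_lin_comp[OF filt_lin_mult_left0[of P] filt_lin_mult_right[of P']] by (simp add: mult.assoc)
  have Q: "?Q (x * v) = ?Q x * ?Q v" for v
  proof -
    have "?Q x * ?Q v = P * x * (P' * P) * v * P'" by (simp add: mult.assoc)
    thus ?thesis by (simp add: assms mult.assoc)
  qed
  have "?Q (fps_op (fps_exp 1) ((*) x) 1) = fps_op (fps_exp 1) ((*) (?Q x)) (?Q 1)"
    by (rule filt_lin_fps_op_commute[where Q = ?Q and T' = "(*) (?Q x)"])
      (simp_all add: filt_lin_mult_left[unfolded One_nat_def] assms(3) lin Q)
  thus ?thesis by (simp add: ncs_exp_def assms)
qed

text \<open>Taking logarithms, conjugation by \<open>exp p\<close> carries \<open>x\<close> to \<open>y\<close>, hence every multiple of \<open>x\<close> to the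
  same multiple of \<open>y\<close>.\<close>

lemma exp_conj_scale:
  assumes p: "coeff p [] = 0" and x: "coeff x [] = 0" and y: "coeff y [] = 0"
    and eq: "ncs_exp p * ncs_exp x = ncs_exp y * ncs_exp p"
  shows "ncs_exp p * ncs_exp (c *\<^sub>Q x) = ncs_exp (c *\<^sub>Q y) * ncs_exp p"
proof -
  note conj = conj_exp[OF exp_mult_minus[OF p] exp_minus_mult[OF p]]
  have "ncs_exp (ncs_exp p * x * ncs_exp (- p)) = ncs_exp y"
    unfolding conj[OF x] using arg_cong[OF eq, of "\<lambda>z. z * ncs_exp (- p)"] p by (simp add: mult.assoc)
  hence "ncs_exp p * x * ncs_exp (- p) = y" by (rule exp_eqD) (use x y in simp_all)
  hence "ncs_exp (c *\<^sub>Q y) = ncs_exp p * ncs_exp (c *\<^sub>Q x) * ncs_exp (- p)"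
    using conj[of "c *\<^sub>Q x"] x by simp
  thus ?thesis using p by (simp add: mult.assoc)
qed

text \<open>For the first triangle, the three factors that are minus one third of the boundary loop based at
  different vertices can be moved to the front, where they combine to the inverse of the loop. For the
  next triangle, the half edges recombine to a conjugate of the previous loop.\<close>

lemma edge_loop: "ncs_exp (g_seq n) * ncs_exp (e_seq n) * ncs_exp (f_seq n) = 1"
proof (induction n)
  case 0
  define t where "t = (\<lambda>x :: cell ncseries. ncs_exp ((- 1/3) *\<^sub>Q x))"
  let ?e = "BCH [e_gen, f_gen, g_gen]" and ?f = "BCH [f_gen, g_gen, e_gen]" and ?g = "BCH [g_gen, e_gen, f_gen]"
  have ge: "ncs_exp g_gen * t ?e = t ?g * ncs_exp g_gen" and ef: "ncs_exp e_gen * t ?f = t ?e * ncs_exp e_gen"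
    unfolding t_def by (rule exp_conj_scale; simp add: exp_BCH mult.assoc)+
  have ttt: "t ?g * (t ?g * t ?g) = ncs_exp (- ?g)"
    using exp_scale_add[of ?g "- 1/3" "- 1/3"] exp_scale_add[of ?g "- 1/3" "- 2/3"] by (simp add: t_def)
  have "ncs_exp (g_seq 0) * ncs_exp (e_seq 0) * ncs_exp (f_seq 0)
      = t ?g * (ncs_exp g_gen * t ?e) * ncs_exp e_gen * t ?f * ncs_exp f_gen"
    by (simp add: edge_seq_0 exp_BCH t_def mult.assoc)
  also have "\<dots> = t ?g * t ?g * ncs_exp g_gen * (ncs_exp e_gen * t ?f) * ncs_exp f_gen"
    unfolding ge by (simp add: mult.assoc)
  also have "\<dots> = t ?g * t ?g * (ncs_exp g_gen * t ?e) * ncs_exp e_gen * ncs_exp f_gen"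
    unfolding ef by (simp add: mult.assoc)
  also have "\<dots> = t ?g * (t ?g * t ?g) * (ncs_exp g_gen * ncs_exp e_gen * ncs_exp f_gen)"
    unfolding ge by (simp add: mult.assoc)
  also have "\<dots> = ncs_exp (- ?g) * ncs_exp ?g" unfolding ttt by (simp add: exp_BCH mult.assoc)
  finally show ?case by simp
next
  case (Suc n)
  let ?h = "\<lambda>x :: cell ncseries. ncs_exp ((1/2) *\<^sub>Q x)"
  let ?E = "ncs_exp (e_seq n)" and ?F = "ncs_exp (f_seq n)" and ?G = "ncs_exp (g_seq n)"
  have hh: "?h x * (?h x * z) = ncs_exp x * z" if "coeff x [] = 0" for x z
    using exp_half_half[OF that] by (simp flip: mult.assoc)
  have "?F * ?G = ncs_exp (- e_seq n) * (ncs_exp (- g_seq n) * (?G * ?E * ?F) * ?G)"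
    by (simp add: mult.assoc)
  also have "\<dots> = ncs_exp (- e_seq n)" unfolding Suc by simp
  also have "\<dots> = ncs_exp ((- 1/2) *\<^sub>Q e_seq n) * ncs_exp ((- 1/2) *\<^sub>Q e_seq n)"
    using exp_scale_add[of "e_seq n" "- 1/2" "- 1/2"] by simp
  finally have FG: "?F * (?G * z) = ncs_exp (- ((1/2) *\<^sub>Q e_seq n)) * (ncs_exp (- ((1/2) *\<^sub>Q e_seq n)) * z)" for z
    by (simp flip: mult.assoc)
  show ?case by (simp add: edge_seq_Suc exp_BCH mult.assoc hh FG)
qed

text \<open>Modulo products of shorter parts \<open>e\<^sub>n + f\<^sub>n + g\<^sub>n = 0\<close> and \<open>e\<^sub>n\<^sub>+\<^sub>1 = (f\<^sub>n + g\<^sub>n) / 2\<close>, so every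
  coefficient satisfies a recurrence with ratio \<open>- 1/2\<close>; products have ratios of absolute value at
  most \<open>1/4\<close>, so there is no resonance.\<close>

lemma small_edges: "small k e_seq \<and> small k f_seq \<and> small k g_seq"
proof (induction k)
  case 0
  have "small 0 s" if "\<And>n. coeff (s n) [] = 0" for s :: "nat \<Rightarrow> cell ncseries"
    using that exp_sums.zero by (simp add: small_def geom_def)
  thus ?case by simp
next
  case (Suc k)
  hence e: "small k e_seq" and f: "small k f_seq" and g: "small k g_seq" by auto
  have sum: "near k (\<lambda>n. e_seq n + f_seq n + g_seq n) (\<lambda>n. 0)"
  proof -
    let ?e = "\<lambda>n. ncs_exp (e_seq n) - 1" and ?f = "\<lambda>n. ncs_exp (f_seq n) - 1"
    let ?ge = "\<lambda>n. ncs_exp (g_seq n) * ncs_exp (e_seq n) - 1"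
    note ge = small_near_exp_mult[OF g e] and f' = small_near_exp[OF f]
    have "?ge n + ?f n + ?ge n * ?f n = 0" for n using edge_loop[of n] by (simp add: algebra_simps)
    hence "near k (\<lambda>n. 0) (\<lambda>n. g_seq n + e_seq n + f_seq n + 0)"
      using near_add[OF near_add[OF ge(2) f'(2)] near_mult[OF ge(1) f'(1)]] by simp
    hence "geom (ratios 2) (Suc k) (\<lambda>n. (- 1) *\<^sub>Q (0 - (g_seq n + e_seq n + f_seq n + 0)))"
      unfolding near_def by (rule geom_scale)
    thus ?thesis by (simp add: near_def algebra_simps)
  qed
  have step: "small (Suc k) x"
    if x: "\<And>n. x (Suc n) = BCH [(1/2) *\<^sub>Q y n, (1/2) *\<^sub>Q z n]" "\<And>n. coeff (x n) [] = 0"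
      and y: "small k y" and z: "small k z" and xyz: "\<And>n. x n + y n + z n = e_seq n + f_seq n + g_seq n"
    for x y z
    unfolding small_def geom_def
  proof (intro conjI allI impI)
    fix w :: "cell list" assume w: "length w \<le> Suc k"
    have 1: "geom (ratios 2) (Suc k) (\<lambda>n. x (Suc n) - ((1/2) *\<^sub>Q y n + (1/2) *\<^sub>Q z n))"
      using near_BCH[OF small_scale[OF y, of "1/2"] small_scale[OF z, of "1/2"]] by (simp add: near_def x)
    have 2: "geom (ratios 2) (Suc k) (\<lambda>n. (1/2) *\<^sub>Q (x n + y n + z n))"
      using sum by (intro geom_scale) (simp add: near_def xyz)
    have "(\<lambda>n. coeff (x (Suc n)) w + (1/2) * coeff (x n) w) \<in> exp_sums (ratios 2)"
      using geomD[OF geom_add[OF 1 2] w] by (simp add: algebra_simps)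
    hence "(\<lambda>n. coeff (x n) w) \<in> exp_sums (insert (- (1 / 2)) (ratios 2))"
      by (rule exp_sums_recurrence[OF _ half_ratios(2)]) simp
    thus "(\<lambda>n. coeff (x n) w) \<in> exp_sums (ratios 1)"
      by (rule exp_sums_mono) (use half_ratios(1) ratios_mono[of 1 2] in auto)
  qed (simp add: x(2))
  show ?case
    by (intro conjI step[OF edge_seq_Suc(1) _ f g] step[OF edge_seq_Suc(2) _ g e] step[OF edge_seq_Suc(3) _ e f])
      (simp_all add: algebra_simps)
qed


subsection \<open>Limits\<close>

lemma ncs_tendsto_mult:
  "ncs_tendsto s x \<Longrightarrow> ncs_tendsto t y \<Longrightarrow> ncs_tendsto (\<lambda>n. s n * t n) (x * y)"
  unfolding ncs_tendsto_def coeff_times of_rat_sum of_rat_mult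
  by (intro allI tendsto_sum tendsto_mult) auto

lemma ncs_tendsto_const: "ncs_tendsto (\<lambda>n. x) x"
  by (simp add: ncs_tendsto_def)

lemma ncs_tendsto_exp:
  assumes "ncs_tendsto s x" "\<And>n. coeff (s n) [] = 0" "coeff x [] = 0"
  shows "ncs_tendsto (\<lambda>n. ncs_exp (s n)) (ncs_exp x)"
proof -
  have "ncs_tendsto (\<lambda>n. s n ^ k) (x ^ k)" for k
    by (induction k) (simp_all add: ncs_tendsto_const ncs_tendsto_mult[OF assms(1)])
  thus ?thesis
    unfolding ncs_tendsto_def ncs_exp_eq coeff_nceval[OF assms(2) order.refl] coeff_nceval[OF assms(3) order.refl]
      of_rat_sum of_rat_mult
    by (intro allI tendsto_sum tendsto_mult tendsto_const) auto
qed

lemma ncs_tendsto_monom_act: "ncs_tendsto s x \<Longrightarrow> ncs_tendsto (\<lambda>n. monom_act \<sigma> p (s n)) (monom_act \<sigma> p x)"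
  unfolding ncs_tendsto_def coeff_monom_act of_rat_mult
  by (intro allI tendsto_mult tendsto_const) auto

lemma ncs_tendsto_unique:
  assumes "ncs_tendsto s x" "ncs_tendsto s y" shows "x = y"
proof (rule ncseries_eqI)
  fix w
  have "real_of_rat (coeff x w) = real_of_rat (coeff y w)"
    using assms unfolding ncs_tendsto_def by (blast intro: LIMSEQ_unique)
  thus "coeff x w = coeff y w" by simp
qed

lemma g_seq_tendsto: "ncs_tendsto g_seq 0"
  unfolding ncs_tendsto_def
proof
  fix w :: "cell list"
  have "(\<lambda>n. coeff (g_seq n) w) \<in> exp_sums (ratios 1)"
    using small_edges[of "length w"] by (simp add: small_def geom_def)
  thus "(\<lambda>n. real_of_rat (coeff (g_seq n) w)) \<longlonglongrightarrow> real_of_rat (coeff 0 w)"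
    using exp_sums_tendsto_0 ratios_less_1 by fastforce
qed

lemma alpha_seq_Nil [simp]: "coeff (alpha_seq n) [] = 0"
  by (cases n) auto

lemma exp_alpha_seq_Suc:
  "ncs_exp (alpha_seq (Suc n)) = ncs_exp (alpha_seq n) * (ncs_exp ((1/2) *\<^sub>Q g_seq n) * ncs_exp (f_seq (Suc n)))"
  by (simp add: exp_BCH mult.assoc)

text \<open>The exponentials satisfy a linear recurrence in which each step is a factor \<open>1 + P\<close> with
  \<open>P\<close> small: the coefficient at a word changes by a sum of products of a coefficient of \<open>exp \<alpha>\<^sub>n\<close> at
  a shorter word with a decreasing sequence. The ratio \<open>1\<close> accounts for the limit.\<close>

lemma geom_exp_alpha_seq: "geom (insert 1 (ratios 1)) k (\<lambda>n. ncs_exp (alpha_seq n))"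
  unfolding geom_def
proof (intro allI impI)
  fix w :: "cell list"
  show "(\<lambda>n. coeff (ncs_exp (alpha_seq n)) w) \<in> exp_sums (insert 1 (ratios 1))"
  proof (induction w rule: length_induct)
    case (1 w)
    let ?P = "\<lambda>n. ncs_exp ((1/2) *\<^sub>Q g_seq n) * ncs_exp (f_seq (Suc n)) - 1"
    let ?A = "\<lambda>n. ncs_exp (alpha_seq n)"
    have "small (length w) (\<lambda>n. f_seq (Suc n))"
      using small_edges[of "length w"] small_shift by blast
    hence P: "small (length w) ?P"
      using small_edges by (intro small_near_exp_mult small_scale) auto
    have "(\<lambda>n. coeff (?A n * ?P n) w) \<in> exp_sums (ratios 1)"
      unfolding coeff_times
    proof (rule exp_sums_sum)
      fix i assume i: "i \<in> {..length w}"
      show "(\<lambda>n. coeff (?A n) (take i w) * coeff (?P n) (drop i w)) \<in> exp_sums (ratios 1)"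
      proof (cases "i = length w")
        case True
        thus ?thesis using exp_sums.zero by simp
      next
        case False
        show ?thesis
        proof (rule exp_sums_mult)
          show "(\<lambda>n. coeff (?A n) (take i w)) \<in> exp_sums (insert 1 (ratios 1))"
            using 1 False i by auto
          show "(\<lambda>n. coeff (?P n) (drop i w)) \<in> exp_sums (ratios 1)"
            using P i by (simp add: small_def geom_def)
        qed (use ratios_mult[of _ 1 _ 1] ratios_mono[of 1 "1 + 1"] in auto)
      qed
    qed
    thus ?case
    proof (rule exp_sums_recurrence)
      show "1 \<notin> ratios 1" using ratios_less_1[of 1] by auto
      fix n
      have "?A (Suc n) = ?A n + ?A n * ?P n"
        unfolding exp_alpha_seq_Suc by (simp add: algebra_simps)
      thus "coeff (?A (Suc n)) w = 1 * coeff (?A n) w + coeff (?A n * ?P n) w" by simp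
    qed
  qed
qed

lemma alpha_tendsto: "ncs_tendsto alpha_seq alpha"
proof -
  let ?K = "insert 1 (ratios 1)" and ?A = "\<lambda>n. ncs_exp (alpha_seq n) - 1"
  have K: "a * b \<in> ?K" if "a \<in> ?K" "b \<in> ?K" for a b
    using that ratios_mult[of a 1 b 1] ratios_mono[of 1 "1 + 1"] by auto
  have one: "geom ?K k (\<lambda>n. 1 :: cell ncseries)" for k
    by (auto simp: geom_def intro: exp_sums_const)
  have pow: "geom ?K k (\<lambda>n. ?A n ^ j)" for j k
  proof (induction j)
    case 0 show ?case unfolding power_0 by (rule one)
  next
    case (Suc j) show ?case
      unfolding power_Suc by (rule geom_mult_gen[OF geom_diff[OF geom_exp_alpha_seq one] Suc K])
  qed
  have "\<exists>L. (\<lambda>n. real_of_rat (coeff (alpha_seq n) w)) \<longlonglongrightarrow> real_of_rat L" for w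
  proof (rule exp_sums_convergent[OF _ ratios_less_1])
    have "coeff (alpha_seq n) w = coeff (nceval (?A n) (fps_ln 1)) w" for n
      using log_exp[of "alpha_seq n"] by (simp add: ncs_log_eq)
    also have "\<dots> n = (\<Sum>j\<le>length w. fps_nth (fps_ln 1) j * coeff (?A n ^ j) w)" for n
      by (rule coeff_nceval) simp_all
    finally show "(\<lambda>n. coeff (alpha_seq n) w) \<in> exp_sums (insert 1 (ratios (Suc 0)))"
      using geomD[OF pow order.refl] by (simp add: exp_sums_sum exp_sums_scale)
  qed
  then obtain x where "\<And>w. (\<lambda>n. real_of_rat (coeff (alpha_seq n) w)) \<longlonglongrightarrow> real_of_rat (x w)" by metis
  hence "ncs_tendsto alpha_seq (NCSeries x)" by (simp add: ncs_tendsto_def)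
  thus ?thesis unfolding alpha_def using ncs_tendsto_unique by (rule_tac theI)
qed

lemma edge_seq_cl:
  "e_seq n \<in> completed_lie (range Edge) 0 \<and> f_seq n \<in> completed_lie (range Edge) 0
    \<and> g_seq n \<in> completed_lie (range Edge) 0"
proof (induction n)
  case 0
  have "gen (Edge v) \<in> completed_lie (range Edge) 0" for v
    using cl_gen[of "Edge v" "range Edge"] by (simp add: cell_deg_def)
  thus ?case unfolding edge_seq_0 by (auto intro!: BCH_cl cl_scale cl_uminus)
next
  case (Suc n) thus ?case unfolding edge_seq_Suc by (auto intro!: BCH_cl cl_scale)
qed

lemma alpha_cl: "alpha \<in> completed_lie (range Edge) 0"
proof (rule cl_tendsto[OF _ alpha_tendsto])
  fix n show "alpha_seq n \<in> completed_lie (range Edge) 0"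
    by (induction n) (use edge_seq_cl in \<open>auto intro!: BCH_cl cl_scale cl_zero\<close>)
qed


section \<open>Flows as gauge transformations\<close>

text \<open>The two series in the differential of an edge are \<open>- exp (- X) / psi\<close> and \<open>1 / psi\<close>; this is why
  the flow of an edge carries its first end point to the second.\<close>

lemma fps_quotients:
  defines "F \<equiv> fps_X / (1 - fps_exp 1) :: rat fps" and "G \<equiv> fps_X / (1 - fps_exp (- 1)) :: rat fps"
  shows "psi * F = - fps_exp (- 1)" "psi * G = 1" "fps_nth F 0 = - 1" "fps_nth G 0 = 1"
proof -
  have nz: "1 - fps_exp c \<noteq> 0" "subdegree (1 - fps_exp c) \<le> 1" if "c \<noteq> 0" for c :: rat
  proof -
    have "fps_nth (1 - fps_exp c) 1 \<noteq> 0" using that by simp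
    thus "1 - fps_exp c \<noteq> 0" "subdegree (1 - fps_exp c) \<le> 1"
      by (auto simp del: fps_exp_nth simp: subdegree_leI)
  qed
  have FG: "F * (1 - fps_exp 1) = fps_X" "G * (1 - fps_exp (- 1)) = fps_X"
    unfolding F_def G_def using nz[of 1] nz[of "-1"] by (simp_all add: fps_dvd_iff)
  have X: "(fps_X :: rat fps) \<noteq> 0" by simp
  have "(psi * G) * fps_X = G * (psi * fps_X)" by (simp add: mult_ac)
  hence "(psi * G) * fps_X = 1 * fps_X" by (simp add: psi_X FG)
  thus "psi * G = 1" using X mult_right_cancel by blast
  have "1 - fps_exp (- 1) = - (fps_exp (- 1) * (1 - fps_exp 1) :: rat fps)"
    using fps_exp_add_mult[of "-1 :: rat" 1] by (simp add: algebra_simps)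
  hence "(psi * F) * fps_X = - fps_exp (- 1) * (F * (1 - fps_exp 1))"
    using psi_X by (simp add: mult_ac)
  thus "psi * F = - fps_exp (- 1)" unfolding FG using X mult_right_cancel by blast
  have "fps_nth (F * (1 - fps_exp 1)) 1 = 1" "fps_nth (G * (1 - fps_exp (- 1))) 1 = 1"
    unfolding FG by simp_all
  thus "fps_nth F 0 = - 1" "fps_nth G 0 = 1" by (simp_all add: fps_mult_nth)
qed

lemma edge_differential_cl:
  assumes "y \<in> completed_lie S 0" "p \<in> completed_lie S n" "q \<in> completed_lie S n"
  shows "edge_differential y p q \<in> completed_lie S n"
  unfolding edge_differential_def gbr_cl_even[OF assms(1)]
  by (intro cl_add fps_op_cl assms)

lemma parity_mult: "parity (x * y) = parity x * parity y"
  by (rule monom_act_mult)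

lemma parity_parity [simp]: "parity (parity z) = z"
proof (rule ncseries_eqI)
  fix w show "coeff (parity (parity z)) w = coeff z w"
    by (simp add: coeff_monom_act prod_parity_sign)
qed

lemma parity_gen: "parity (gen s) = parity_sign s *\<^sub>Q gen s"
  using parity_homog[OF homog_gen, of s] by (simp add: parity_sign_def)

lemma parity_even: "homog 0 y \<Longrightarrow> parity y = y"
  using parity_homog[where p = 0] by simp

lemma parity_exp: "homog 0 y \<Longrightarrow> coeff y [] = 0 \<Longrightarrow> parity (ncs_exp y) = ncs_exp y"
  by (simp add: monom_act_exp parity_even)

context cell_derivation
begin

text \<open>\<open>P\<close> transports \<open>p\<close> to \<open>q\<close>: for invertible \<open>P\<close> this says that \<open>q\<close> is the gauge transform
  \<open>P\<^sup>-\<^sup>1 p P + P\<^sup>-\<^sup>1 D P\<close>. In this form it is evidently compatible with composition of paths.\<close>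

definition transports :: "cell ncseries \<Rightarrow> cell ncseries \<Rightarrow> cell ncseries \<Rightarrow> bool" where
  "transports p P q \<longleftrightarrow> parity P = P \<and> D P = P * q - p * P"

lemma transports_mult: "transports p P q \<Longrightarrow> transports q R r \<Longrightarrow> transports p (P * R) r"
  by (simp add: transports_def parity_mult D_mult left_diff_distrib right_diff_distrib mult.assoc)

lemma transports_inverse:
  assumes P: "transports p P q" and inv: "P * P' = 1" "P' * P = 1" and P': "parity P' = P'"
  shows "transports q P' p"
proof -
  have "D (P * P') = 0" by (simp add: inv)
  hence "P' * (D P * P' + P * D P') = 0" using P by (simp add: D_mult transports_def)
  hence "D P' = - (P' * (D P * P'))" using inv by (simp add: distrib_left add_eq_0_iff2 flip: mult.assoc)
  also have "\<dots> = - ((P' * P) * q * P' - P' * p * (P * P'))"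
    using P by (simp add: transports_def left_diff_distrib right_diff_distrib mult.assoc)
  finally show ?thesis by (simp add: transports_def inv P')
qed

lemma transports_target_unique:
  "transports p P q \<Longrightarrow> transports p P q' \<Longrightarrow> P' * P = 1 \<Longrightarrow> q = q'"
proof -
  assume "transports p P q" "transports p P q'" and inv: "P' * P = 1"
  hence "P' * (P * q) = P' * (P * q')" by (simp add: transports_def)
  thus "q = q'" by (simp add: inv flip: mult.assoc)
qed

lemma D_exp:
  assumes y: "homog 0 y" "coeff y [] = 0"
  shows "D (ncs_exp y) = ncs_exp y * fps_op psi (comm y) (D y)"
  by (rule exp_deriv[OF y(2) filt_lin_D]) (simp_all add: D_mult parity_even[OF y(1)])

lemma transports_exp_minus:
  "homog 0 y \<Longrightarrow> coeff y [] = 0 \<Longrightarrow> transports p (ncs_exp y) q \<Longrightarrow> transports q (ncs_exp (- y)) p"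
  by (erule transports_inverse) (simp_all add: parity_exp[of "- y"] ncsupp_def)

lemma transports_iff_edge_differential:
  assumes y: "homog 0 y" "coeff y [] = 0"
  shows "transports p (ncs_exp y) q \<longleftrightarrow> D y = edge_differential y p q"
proof -
  note A = filt_lin_comm[OF y(2)]
  let ?d = "edge_differential y p q"
  have d: "fps_op psi (comm y) ?d = q - ncs_exp (- y) * p * ncs_exp y"
    unfolding edge_differential_def gbr_even[OF y(1), abs_def] fps_op_linear(1)[OF A]
      fps_op_mult[OF A, symmetric] fps_quotients
    by (simp add: fps_op_uminus exp_ad[OF y(2)])
  have "ncs_exp y * fps_op psi (comm y) ?d = ncs_exp y * q - p * ncs_exp y"
    unfolding d using y(2) by (simp add: right_diff_distrib mult.assoc)
  hence "transports p (ncs_exp y) q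
      \<longleftrightarrow> ncs_exp y * fps_op psi (comm y) (D y) = ncs_exp y * fps_op psi (comm y) ?d"
    by (simp add: transports_def parity_exp y D_exp)
  also have "\<dots> \<longleftrightarrow> fps_op psi (comm y) (D y) = fps_op psi (comm y) ?d"
    using y(2) by (metis exp_minus_mult2(1))
  also have "\<dots> \<longleftrightarrow> fps_op psi (comm y) (D y - ?d) = 0"
    by (simp add: fps_op_linear(3)[OF A])
  also have "\<dots> \<longleftrightarrow> D y = ?d"
    using fps_op_invertible[OF A, of psi "D y - ?d"] by (auto simp: psi_nth fps_op_linear(5)[OF A])
  finally show ?thesis .
qed

lemma transports_flow:
  assumes y: "homog 0 y" "coeff y [] = 0"
  shows "transports p (ncs_exp y) (flow D y p)"
proof -
  have "flow D y p = ncs_exp (- y) * p * ncs_exp y + fps_op psi (comm y) (D y)"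
    by (simp add: flow_def gbr_even[OF y(1), abs_def] exp_ad[OF y(2)] psi_def)
  hence "ncs_exp y * flow D y p = p * ncs_exp y + D (ncs_exp y)"
    using y(2) by (simp add: distrib_left mult.assoc D_exp[OF y])
  thus ?thesis by (simp add: transports_def parity_exp y)
qed

text \<open>The map \<open>z \<mapsto> D z - [z, p]\<close> obeys the Leibniz rule for left multiplication by even elements and
  kills \<open>exp y\<close> precisely when it kills \<open>y\<close>. Consequently loops may be scaled.\<close>

lemma transports_loop_iff:
  assumes y: "homog 0 y" "coeff y [] = 0"
  shows "transports p (ncs_exp y) p \<longleftrightarrow> D y = y * p - p * y"
proof -
  let ?Q = "\<lambda>z. D z - (z * p - p * z)"
  have "filt_lin 0 ?Q" by (intro filt_lin_minus filt_lin_D filt_lin_mult_right filt_lin_mult_left0)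
  hence "?Q (ncs_exp y) = 0 \<longleftrightarrow> ?Q y = 0"
    by (rule exp_deriv_eq_zero_iff[OF y(2)]) (simp_all add: D_mult parity_even[OF y(1)] algebra_simps)
  thus ?thesis by (simp add: transports_def parity_exp y)
qed

lemma transports_loop_scale:
  assumes y: "homog 0 y" "coeff y [] = 0" and l: "transports p (ncs_exp y) p"
  shows "transports p (ncs_exp (c *\<^sub>Q y)) p"
proof -
  have "D (c *\<^sub>Q y) = (c *\<^sub>Q y) * p - p * (c *\<^sub>Q y)"
    using l transports_loop_iff[OF y] by (simp add: D_scale scaleQ_diff)
  thus ?thesis using transports_loop_iff[of "c *\<^sub>Q y" p] y homog_scale by simp
qed

text \<open>\<open>D\<close> is odd; therefore the mixed terms cancel in \<open>D\<^sup>2\<close>, which is an ordinary derivation.\<close>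

lemma parity_D: "parity (D z) = - D (parity z)"
proof -
  let ?Q = "\<lambda>z. parity (D z) + D (parity z)"
  have P: "filt_lin 0 parity" by (rule filt_lin_monom_act)
  have \<delta>p: "parity (\<delta> s) = - parity_sign s *\<^sub>Q \<delta> s" for s
    using parity_homog[OF cl_homog[OF \<delta>], of s] by (auto simp: parity_sign_def)
  have sq: "parity_sign s * parity_sign s = 1" for s by (simp add: parity_sign_def)
  have "?Q z = 0"
  proof (rule twisted_derivation_zero[where Q = ?Q and c = gen])
    show "?Q (x + y) = ?Q x + ?Q y" for x y
      by (simp add: D_add filt_lin_add[OF P])
    show "?Q (q *\<^sub>Q 1) = 0" for q
      by (simp add: D_scale filt_lin_scale[OF P] filt_lin_zero[OF P])
    show "?Q (gen s * z) = gen s * ?Q z" for s z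
      by (simp add: D_mult parity_mult D_gen parity_gen filt_lin_add[OF P] filt_lin_scale[OF P]
          D_scale D_add \<delta>p sq algebra_simps scaleQ_add)
  qed simp
  thus ?thesis by (simp add: eq_neg_iff_add_eq_0)
qed

lemma DD_mult: "D (D (x * y)) = D (D x) * y + x * D (D y)"
  by (simp add: D_mult D_add parity_D)

lemma filt_lin_DD: "filt_lin 0 (\<lambda>z. D (D z))"
  using filt_lin_comp[OF filt_lin_D filt_lin_D] by simp

lemma DD_zero:
  assumes "\<And>s. D (D (gen s)) = 0" shows "D (D z) = 0"
proof (rule twisted_derivation_zero[of "\<lambda>z. D (D z)"])
  show "D (D (gen s * z)) = gen s * D (D z)" for s z by (simp add: DD_mult assms)
qed (simp_all add: D_add D_scale filt_lin_zero[OF filt_lin_D])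

text \<open>The Maurer--Cartan equation \<open>D p + [p, p] / 2 = 0\<close>, written with the associative product.\<close>

definition flat :: "cell ncseries \<Rightarrow> bool" where
  "flat p \<longleftrightarrow> homog (- 1) p \<and> D p = - (p * p)"

lemma flat_parity: "homog (- 1) p \<Longrightarrow> parity p = - p"
  using parity_homog[where p = "- 1"] by simp

lemma flat_DD: "flat p \<Longrightarrow> D (D p) = 0"
  by (simp add: flat_def D_uminus D_mult flat_parity mult.assoc)

text \<open>Parallel transport carries curvature to curvature, up to \<open>D\<^sup>2\<close> of the transporting element. Thus
  \<open>D\<^sup>2 e = 0\<close> because both end points of the edge are flat, and conversely \<open>D\<^sup>2 \<alpha> = 0\<close> makes
  \<open>x\<close> flat.\<close>

lemma DD_transports:
  assumes "transports p P q" "homog (- 1) p"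
  shows "D (D P) = P * (q * q + D q) - (p * p + D p) * P"
proof -
  have P: "parity P = P" "D P = P * q - p * P" using assms by (auto simp: transports_def)
  show ?thesis
    unfolding P(2) D_diff D_mult P(1) flat_parity[OF assms(2)] by (simp add: P(2) algebra_simps)
qed

lemma DD_exp_iff:
  assumes y: "coeff y [] = 0" shows "D (D (ncs_exp y)) = 0 \<longleftrightarrow> D (D y) = 0"
  by (rule exp_deriv_eq_zero_iff[OF y filt_lin_DD]) (simp_all add: DD_mult filt_lin_zero[OF filt_lin_D])

lemma DD_of_flat_ends:
  "coeff y [] = 0 \<Longrightarrow> transports p (ncs_exp y) q \<Longrightarrow> flat p \<Longrightarrow> flat q \<Longrightarrow> D (D y) = 0"
  using DD_transports[of p "ncs_exp y" q] DD_exp_iff[of y] by (simp add: flat_def)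

lemma flat_transport:
  assumes y: "coeff y [] = 0" and t: "transports p (ncs_exp y) q" and p: "flat p"
    and q: "homog (- 1) q" and dd: "D (D y) = 0"
  shows "flat q"
proof -
  have "ncs_exp y * (q * q + D q) = 0"
    using DD_transports[OF t] p DD_exp_iff[OF y] dd by (simp add: flat_def)
  hence "ncs_exp (- y) * (ncs_exp y * (q * q + D q)) = 0" by simp
  hence "D q = - (q * q)" using y by (simp add: add_eq_0_iff2)
  thus ?thesis using q by (simp add: flat_def)
qed

text \<open>The defect \<open>D T - T D\<close> is a twisted derivation.\<close>

lemma D_commutes:
  assumes T: "filt_lin 0 T" "T 1 = 1" "\<And>x y. T (x * y) = T x * T y"
    and hom: "\<And>s. homog (cell_deg s) (T (gen s))" and nil: "\<And>s. coeff (T (gen s)) [] = 0"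
    and gen: "\<And>s. D (T (gen s)) = T (D (gen s))"
  shows "D (T z) = T (D z)"
proof -
  let ?Q = "\<lambda>z. D (T z) - T (D z)"
  note lin = filt_lin_add[OF T(1)] filt_lin_scale[OF T(1)] filt_lin_zero[OF T(1)]
  have "?Q z = 0"
  proof (rule twisted_derivation_zero[where Q = ?Q and c = "\<lambda>s. parity_sign s *\<^sub>Q T (gen s)"])
    show "?Q (x + y) = ?Q x + ?Q y" for x y by (simp add: D_add lin)
    show "?Q (q *\<^sub>Q 1) = 0" for q by (simp add: D_scale lin T)
    fix s z
    have "parity (T (gen s)) = parity_sign s *\<^sub>Q T (gen s)"
      using parity_homog[OF hom] by (simp add: parity_sign_def)
    thus "?Q (gen s * z) = (parity_sign s *\<^sub>Q T (gen s)) * ?Q z"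
      by (simp add: T(3) D_mult lin gen[unfolded D_gen] D_gen parity_gen algebra_simps scaleQ_diff gen)
  qed (simp add: nil)
  thus ?thesis by simp
qed

lemma transports_image:
  assumes "transports p P q" "\<And>z. D (T z) = T (D z)" "filt_lin 0 T" "\<And>x y. T (x * y) = T x * T y"
    "parity (T P) = T (parity P)"
  shows "transports (T p) (T P) (T q)"
  using assms by (simp add: transports_def filt_lin_diff[OF assms(3)])

end


section \<open>The triangle\<close>

definition skeleton :: "cell set" where "skeleton = - {Face}"

locale triangle_derivation = cell_derivation +
  assumes \<delta>_vert: "\<delta> (Vert v) = (- 1/2) *\<^sub>Q gbr (gen (Vert v)) (gen (Vert v))"
    and \<delta>_edge: "\<delta> (Edge Va) = edge_differential e_gen b_gen c_gen"
      "\<delta> (Edge Vb) = edge_differential f_gen c_gen a_gen"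
      "\<delta> (Edge Vc) = edge_differential g_gen a_gen b_gen"
begin

lemma flat_vert: "flat (gen (Vert v))"
proof -
  have h: "homog (- 1) (gen (Vert v))" using homog_gen[of "Vert v"] by (simp add: cell_deg_def)
  thus ?thesis
    unfolding flat_def D_gen \<delta>_vert gbr_homog[OF h h] by (simp add: koszul_sign_def scaleQ_add)
       (rule ncseries_eqI, simp)
qed

lemma homog_edge: "homog 0 (gen (Edge v))"
  using homog_gen[of "Edge v"] by (simp add: cell_deg_def)

lemma transports_edges:
  "transports b_gen (ncs_exp e_gen) c_gen" "transports c_gen (ncs_exp f_gen) a_gen"
  "transports a_gen (ncs_exp g_gen) b_gen"
  by (simp_all add: transports_iff_edge_differential homog_edge D_gen \<delta>_edge)

lemma DD_skeleton: "s \<noteq> Face \<Longrightarrow> D (D (gen s)) = 0"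
proof (cases s)
  case (Edge v)
  thus ?thesis
    using DD_of_flat_ends[OF _ transports_edges(1)] DD_of_flat_ends[OF _ transports_edges(2)]
      DD_of_flat_ends[OF _ transports_edges(3)] flat_vert by (cases v) auto
qed (use flat_DD[OF flat_vert] in auto)

end

subsection \<open>The symmetries\<close>

definition rot :: "vertex \<Rightarrow> vertex" where "rot = Transposition.transpose Va Vb \<circ> Transposition.transpose Vb Vc"
definition mirror :: "vertex \<Rightarrow> vertex" where "mirror = Transposition.transpose Vb Vc"

lemma rot_simps [simp]: "rot Va = Vb" "rot Vb = Vc" "rot Vc = Va"
  and mirror_simps [simp]: "mirror Va = Va" "mirror Vb = Vc" "mirror Vc = Vb"
  by (simp_all add: rot_def mirror_def Transposition.transpose_def)

lemma bij_rot: "bij rot" and bij_mirror: "bij mirror"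
  by (simp_all add: rot_def mirror_def bij_comp)

lemma sign_rot: "sign rot = 1" and sign_mirror: "sign mirror = - 1"
  by (simp_all add: rot_def mirror_def sign_compose sign_swap_id permutation_swap_id)

lemma S3_act_monom_act: "S3_act \<pi> = monom_act (cell_sign \<pi>) (cell_perm (inv \<pi>))"
  by (rule ext, rule ncseries_eqI) (simp add: S3_act_def coeff_monom_act)

lemma S3_lin: "filt_lin 0 (S3_act \<pi>)"
  and S3_mult: "S3_act \<pi> (x * y) = S3_act \<pi> x * S3_act \<pi> y"
  and S3_1: "S3_act \<pi> 1 = 1"
  and S3_Nil [simp]: "coeff (S3_act \<pi> x) [] = coeff x []"
  and S3_exp: "coeff x [] = 0 \<Longrightarrow> S3_act \<pi> (ncs_exp x) = ncs_exp (S3_act \<pi> x)"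
  and S3_BCH: "\<forall>x\<in>set xs. coeff x [] = 0 \<Longrightarrow> S3_act \<pi> (BCH xs) = BCH (map (S3_act \<pi>) xs)"
  and S3_tendsto: "ncs_tendsto s x \<Longrightarrow> ncs_tendsto (\<lambda>n. S3_act \<pi> (s n)) (S3_act \<pi> x)"
  unfolding S3_act_monom_act
  by (simp_all add: filt_lin_monom_act monom_act_mult monom_act_exp monom_act_BCH ncs_tendsto_monom_act)

lemmas S3_simps = S3_act_add S3_act_scale filt_lin_diff[OF S3_lin] filt_lin_uminus[OF S3_lin]
  filt_lin_zero[OF S3_lin]

lemma cell_deg_perm [simp]: "cell_deg (cell_perm \<pi> s) = cell_deg s"
  by (cases s) (auto simp: cell_deg_def)

lemma list_deg_perm [simp]: "list_deg (map (cell_perm \<pi>) w) = list_deg w"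
  by (simp add: list_deg_def comp_def)

lemma S3_parity: "parity (S3_act \<pi> x) = S3_act \<pi> (parity x)"
  by (rule ncseries_eqI)
    (simp add: S3_act_def coeff_monom_act prod_parity_sign del: map_map)

lemma S3_edge_differential:
  assumes y: "homog 0 y" "coeff y [] = 0" and y': "homog 0 (S3_act \<pi> y)"
  shows "S3_act \<pi> (edge_differential y p q) = edge_differential (S3_act \<pi> y) (S3_act \<pi> p) (S3_act \<pi> q)"
proof -
  have "S3_act \<pi> (fps_op F (comm y) v) = fps_op F (comm (S3_act \<pi> y)) (S3_act \<pi> v)" for F v
    by (rule filt_lin_fps_op_commute[OF filt_lin_comm filt_lin_comm S3_lin])
      (simp_all add: y comm_def S3_mult S3_simps)
  thus ?thesis
    unfolding edge_differential_def gbr_even[OF y(1), abs_def] gbr_even[OF y', abs_def]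
    by (simp add: S3_simps)
qed

lemma S3_rot: "S3_act rot (gen (Vert v)) = gen (Vert (rot v))" "S3_act rot (gen (Edge v)) = gen (Edge (rot v))"
    "S3_act rot h_gen = h_gen"
  and S3_mirror: "S3_act mirror (gen (Vert v)) = gen (Vert (mirror v))" "S3_act mirror (gen (Edge v)) = - gen (Edge (mirror v))"
    "S3_act mirror h_gen = - h_gen"
  by (simp_all add: S3_act_gen bij_rot bij_mirror sign_rot sign_mirror)

context triangle_derivation
begin

lemma skeleton_commutes:
  assumes \<pi>: "\<pi> = rot \<or> \<pi> = mirror" and s: "s \<noteq> Face"
  shows "D (S3_act \<pi> (gen s)) = S3_act \<pi> (D (gen s))"
proof (cases s)
  case (Vert v)
  show ?thesis using \<pi> unfolding Vert
    by (elim disjE) (simp_all add: S3_rot S3_mirror D_gen \<delta>_vert S3_simps S3_act_gbr)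
next
  case (Edge v)
  have m: "homog 0 (- gen (Edge v))" for v using homog_edge[of v] by (simp add: ncsupp_def)
  note e = S3_edge_differential[OF homog_edge coeff_1_Nil(2)]
  have "transports c_gen (ncs_exp (- e_gen)) b_gen" "transports a_gen (ncs_exp (- f_gen)) c_gen"
    "transports b_gen (ncs_exp (- g_gen)) a_gen"
    using transports_exp_minus[OF homog_edge coeff_1_Nil(2)] transports_edges by auto
  hence "D (- e_gen) = edge_differential (- e_gen) c_gen b_gen" "D (- f_gen) = edge_differential (- f_gen) a_gen c_gen"
    "D (- g_gen) = edge_differential (- g_gen) b_gen a_gen"
    by (simp_all add: transports_iff_edge_differential m)
  thus ?thesis using \<pi> unfolding Edge
    by (elim disjE; cases v) (simp_all add: D_gen \<delta>_edge e S3_rot S3_mirror homog_edge m)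
qed (use s in simp)

lemma S3_commutes:
  assumes "bij \<pi>" "\<And>s. D (S3_act \<pi> (gen s)) = S3_act \<pi> (D (gen s))"
  shows "D (S3_act \<pi> z) = S3_act \<pi> (D z)"
  by (rule D_commutes[OF S3_lin S3_1 S3_mult _ _ assms(2)])
    (use homog_scale[OF homog_gen] cell_deg_perm in \<open>metis S3_act_gen[OF assms(1)]\<close>, simp)

end

lemma rot_edges: "S3_act rot (e_seq n) = f_seq n \<and> S3_act rot (f_seq n) = g_seq n \<and> S3_act rot (g_seq n) = e_seq n"
  by (induction n) (simp_all add: edge_seq_0 edge_seq_Suc S3_BCH S3_simps S3_rot)

lemma exp_inverse_unique:
  "P * ncs_exp z = 1 \<Longrightarrow> coeff z [] = 0 \<Longrightarrow> P = ncs_exp (- z)"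
  by (metis exp_mult_minus mult.assoc mult_1 mult_1_right)

text \<open>The form in which the reflection acts on the edges of the first triangle: it turns \<open>e\<^sub>0\<close> into the
  left-hand side, where the base point of the loop has moved to the other end of the edge.\<close>

lemma exp_conj_minus:
  assumes "coeff p [] = 0" "coeff x [] = 0" "coeff y [] = 0"
    "ncs_exp p * ncs_exp x = ncs_exp y * ncs_exp p"
  shows "BCH [c *\<^sub>Q x, - p] = - BCH [(- c) *\<^sub>Q y, p]"
proof (rule exp_eqD)
  have eq: "ncs_exp p * ncs_exp (c *\<^sub>Q x) = ncs_exp (c *\<^sub>Q y) * ncs_exp p"
    by (rule exp_conj_scale[OF assms])
  have "ncs_exp (c *\<^sub>Q x) * ncs_exp (- p) = ncs_exp (- p) * (ncs_exp p * ncs_exp (c *\<^sub>Q x)) * ncs_exp (- p)"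
    using assms(1) by simp
  also have "\<dots> = ncs_exp (- p) * ncs_exp (c *\<^sub>Q y)"
    unfolding eq using assms(1) by (simp add: mult.assoc)
  finally have 1: "ncs_exp (BCH [c *\<^sub>Q x, - p]) = ncs_exp (- p) * ncs_exp (c *\<^sub>Q y)" by (simp add: exp_BCH)
  let ?z = "BCH [(- c) *\<^sub>Q y, p]"
  have z: "ncs_exp ?z = ncs_exp (- (c *\<^sub>Q y)) * ncs_exp p" by (simp add: exp_BCH)
  have "ncs_exp (- p) * ncs_exp (c *\<^sub>Q y) * ncs_exp ?z = 1"
    unfolding z using assms(1,3) by (simp add: mult.assoc)
  hence "ncs_exp (- p) * ncs_exp (c *\<^sub>Q y) = ncs_exp (- ?z)"
    by (rule exp_inverse_unique) simp
  thus "ncs_exp (BCH [c *\<^sub>Q x, - p]) = ncs_exp (- BCH [(- c) *\<^sub>Q y, p])" using 1 by simp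
qed (use assms in simp_all)

lemma BCH_uminus_rev:
  assumes "\<forall>x\<in>set xs. coeff x [] = 0" shows "BCH (map uminus xs) = - BCH (rev xs)"
proof (rule exp_eqD)
  have "prod_list (map (\<lambda>x. ncs_exp (- x)) xs) * prod_list (map ncs_exp (rev xs)) = 1"
    using assms by (induction xs) (simp_all add: mult.assoc, simp flip: mult.assoc)
  hence "ncs_exp (BCH (map uminus xs)) * ncs_exp (BCH (rev xs)) = 1"
    by (simp add: exp_BCH comp_def)
  thus "ncs_exp (BCH (map uminus xs)) = ncs_exp (- BCH (rev xs))"
    by (rule exp_inverse_unique) simp
qed simp_all

lemmas BCH_uminus_rev2 = BCH_uminus_rev[of "[x, y]" for x y, simplified]
  and BCH_uminus_rev3 = BCH_uminus_rev[of "[x, y, z]" for x y z, simplified]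


subsection \<open>The differential of the skeleton and of the full triangle\<close>

text \<open>The element \<open>x\<close> in the differential of the face is itself formed with the differential. It is
  constructed with the differential of the skeleton, extended by \<open>0\<close> to the face; this changes nothing
  since \<open>\<alpha>\<close> contains only edges.\<close>

fun skeleton_differential :: "cell \<Rightarrow> cell ncseries" where
  "skeleton_differential (Vert v) = (- 1/2) *\<^sub>Q gbr (gen (Vert v)) (gen (Vert v))"
| "skeleton_differential (Edge Va) = edge_differential e_gen b_gen c_gen"
| "skeleton_differential (Edge Vb) = edge_differential f_gen c_gen a_gen"
| "skeleton_differential (Edge Vc) = edge_differential g_gen a_gen b_gen"
| "skeleton_differential Face = 0"

lemma gen_vert_cl: "Vert v \<in> S \<Longrightarrow> gen (Vert v) \<in> completed_lie S (- 1)"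
  and gen_edge_cl: "Edge v \<in> S \<Longrightarrow> gen (Edge v) \<in> completed_lie S 0"
  using cl_gen[of "Vert v" S] cl_gen[of "Edge v" S] by (simp_all add: cell_deg_def)

lemma skeleton_differential_closure:
  "skeleton_differential s \<in> completed_lie (closure_cells s) (cell_deg s - 1)"
proof (cases s rule: skeleton_differential.cases)
  case (1 v)
  have "gbr (gen (Vert v)) (gen (Vert v)) \<in> completed_lie {Vert v} (- 1 + - 1)"
    by (intro gbr_cl gen_vert_cl) simp_all
  from cl_scale[OF this, of "- 1/2"] show ?thesis unfolding 1 by (simp add: cell_deg_def)
qed (auto simp: cell_deg_def cl_zero intro!: edge_differential_cl gen_vert_cl gen_edge_cl)

lemma skeleton_differential_cl:
  "s \<in> skeleton \<Longrightarrow> skeleton_differential s \<in> completed_lie skeleton (cell_deg s - 1)"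
  using skeleton_differential_closure[of s] cl_mono[of "closure_cells s" skeleton]
  by (cases s rule: skeleton_differential.cases) (auto simp: skeleton_def)

interpretation skel: triangle_derivation skeleton_differential
proof unfold_locales
  fix s show "skeleton_differential s \<in> completed_lie UNIV (cell_deg s - 1)"
    using skeleton_differential_closure[of s] cl_mono[OF subset_UNIV] by blast
qed simp_all

lemma skel_DD: "skel.D (skel.D z) = 0"
proof (rule skel.DD_zero)
  fix s show "skel.D (skel.D (gen s)) = 0"
    using skel.DD_skeleton[of s] filt_lin_zero[OF skel.filt_lin_D] by (cases "s = Face") (auto simp: skel.D_gen)
qed

definition centre :: "cell ncseries" where "centre = flow skel.D alpha a_gen"

definition loop :: "cell ncseries" where "loop = BCH [- alpha, g_gen, e_gen, f_gen, alpha]"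

lemma alpha_skeleton: "alpha \<in> completed_lie skeleton 0"
  using alpha_cl cl_mono[of "range Edge" skeleton] by (auto simp: skeleton_def)

lemmas homog_alpha = cl_homog[OF alpha_cl] and alpha_Nil [simp] = cl_Nil[OF alpha_cl]

lemma centre_cl: "centre \<in> completed_lie skeleton (- 1)"
proof -
  have "skel.D alpha \<in> completed_lie skeleton (- 1)"
    using skel.D_cl[OF skeleton_differential_cl alpha_skeleton] by simp
  thus ?thesis unfolding centre_def flow_def gbr_cl_even[OF alpha_skeleton]
    by (intro cl_add fps_op_cl alpha_skeleton gen_vert_cl) (auto simp: skeleton_def)
qed

lemma loop_cl: "loop \<in> completed_lie UNIV 0"
  unfolding loop_def using alpha_cl cl_mono[of _ UNIV]
  by (intro BCH_cl) (auto intro!: gen_edge_cl cl_uminus)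

lemma skel_transports_centre: "skel.transports a_gen (ncs_exp alpha) centre"
  unfolding centre_def by (rule skel.transports_flow[OF homog_alpha alpha_Nil])

lemma skel_flat_centre: "skel.flat centre"
  by (rule skel.flat_transport[OF alpha_Nil skel_transports_centre skel.flat_vert cl_homog[OF centre_cl] skel_DD])

definition triangle_diff :: "cell \<Rightarrow> cell ncseries" where
  "triangle_diff s = (if s = Face then loop - gbr centre h_gen else skeleton_differential s)"

lemma triangle_diff_simps [simp]:
  "triangle_diff Face = loop - gbr centre h_gen"
  "s \<noteq> Face \<Longrightarrow> triangle_diff s = skeleton_differential s"
  by (simp_all add: triangle_diff_def)

interpretation full: triangle_derivation triangle_diff
proof unfold_locales
  fix s show "triangle_diff s \<in> completed_lie UNIV (cell_deg s - 1)"
  proof (cases "s = Face")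
    case True
    have "gbr centre h_gen \<in> completed_lie UNIV (- 1 + cell_deg Face)"
      by (intro gbr_cl cl_gen) (use centre_cl cl_mono[OF subset_UNIV] in auto)
    thus ?thesis using True cl_diff[OF loop_cl] by (simp add: cell_deg_def)
  next
    case False thus ?thesis using skel.\<delta> by simp
  qed
qed simp_all

lemma full_eq_skel: "z \<in> completed_lie skeleton n \<Longrightarrow> full.D z = skel.D z"
  unfolding full.D_def skel.D_def
  by (rule der_cong[where U = skeleton]) (use cl_supp in \<open>fastforce simp: ncsupp_def\<close>, simp add: skeleton_def)

lemma full_transports_centre: "full.transports a_gen (ncs_exp alpha) centre"
proof -
  have "flow full.D alpha a_gen = centre"
    by (simp add: centre_def flow_def full_eq_skel[OF alpha_skeleton])
  thus ?thesis using full.transports_flow[OF homog_alpha alpha_Nil, of a_gen] by simp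
qed

lemma full_flat_centre: "full.flat centre"
  using skel_flat_centre by (simp add: full.flat_def skel.flat_def full_eq_skel[OF centre_cl])

text \<open>The path from the centre to \<open>a\<close>, around the triangle and back transports the centre to itself.\<close>

lemma full_D_loop: "full.D loop = loop * centre - centre * loop"
proof -
  have "ncs_exp loop = ncs_exp (- alpha) * (ncs_exp g_gen * (ncs_exp e_gen * (ncs_exp f_gen * ncs_exp alpha)))"
    by (simp add: loop_def exp_BCH)
  moreover have "full.transports centre (ncs_exp (- alpha)) a_gen"
    by (rule full.transports_exp_minus[OF homog_alpha alpha_Nil full_transports_centre])
  ultimately have "full.transports centre (ncs_exp loop) centre"
    by (auto intro!: full.transports_mult[OF _ full.transports_mult[OF full.transports_edges(3)
        full.transports_mult[OF full.transports_edges(1) full.transports_mult[OF full.transports_edges(2)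
          full_transports_centre]]]])
  thus ?thesis by (simp add: full.transports_loop_iff[OF cl_homog[OF loop_cl] cl_Nil[OF loop_cl]])
qed

lemma gbr_centre_h: "gbr centre h_gen = centre * h_gen + h_gen * centre"
  using gbr_homog[OF cl_homog[OF centre_cl] homog_gen[of Face]] by (simp add: koszul_sign_def cell_deg_def)

lemma full_DD: "full.D (full.D z) = 0"
proof (rule full.DD_zero)
  fix s
  show "full.D (full.D (gen s)) = 0"
  proof (cases "s = Face")
    case True
    have c: "full.D centre = - (centre * centre)" "parity centre = - centre"
      using full_flat_centre full.flat_parity by (auto simp: full.flat_def)
    have h: "parity h_gen = - h_gen" by (simp add: parity_gen parity_sign_def cell_deg_def)
    have Dh: "full.D h_gen = loop - (centre * h_gen + h_gen * centre)"
      by (simp add: full.D_gen gbr_centre_h)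
    show ?thesis
      unfolding True Dh
      by (simp add: full.D_diff full.D_add full.D_mult c h full_D_loop Dh left_diff_distrib right_diff_distrib
          distrib_left distrib_right mult.assoc)
  next
    case False thus ?thesis by (rule full.DD_skeleton)
  qed
qed


subsection \<open>Symmetry\<close>

lemma skel_commutes:
  assumes "\<pi> = rot \<or> \<pi> = mirror" shows "skel.D (S3_act \<pi> z) = S3_act \<pi> (skel.D z)"
proof (rule skel.S3_commutes)
  show "bij \<pi>" using assms bij_rot bij_mirror by auto
  fix s show "skel.D (S3_act \<pi> (gen s)) = S3_act \<pi> (skel.D (gen s))"
  proof (cases "s = Face")
    case True
    thus ?thesis using assms
      by (auto simp: S3_rot S3_mirror skel.D_uminus skel.D_gen S3_simps)
  next
    case False thus ?thesis using skel.skeleton_commutes[OF assms] by blast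
  qed
qed

text \<open>Both sides are paths from \<open>a\<close> to the vertex \<open>b\<^sub>n\<close>: the left one along the \<open>a\<^sub>i\<close> and then the edge
  \<open>g\<^sub>n\<close>, the right one along \<open>g\<^sub>0\<close> and then the \<open>b\<^sub>i\<close>. They agree because the region between them is
  tiled by closed triangles. As \<open>g\<^sub>n\<close> tends to zero, the limit compares \<open>\<alpha>\<close> with its rotation.\<close>

lemma exp_alpha_seq_rot:
  "ncs_exp (alpha_seq n) * ncs_exp (g_seq n) = ncs_exp (g_seq 0) * ncs_exp (S3_act rot (alpha_seq n))"
proof (induction n)
  case 0 show ?case by (simp add: S3_simps)
next
  case (Suc n)
  let ?h = "\<lambda>x :: cell ncseries. ncs_exp ((1/2) *\<^sub>Q x)"
  have hh: "?h x * (?h x * z) = ncs_exp x * z" if "coeff x [] = 0" for x z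
    using exp_half_half[OF that] by (simp flip: mult.assoc)
  have "S3_act rot (ncs_exp (alpha_seq (Suc n)))
      = ncs_exp (S3_act rot (alpha_seq n)) * (?h (e_seq n) * ncs_exp (g_seq (Suc n)))"
    unfolding exp_alpha_seq_Suc by (simp add: S3_mult S3_exp S3_simps rot_edges del: alpha_seq.simps)
  hence "ncs_exp (g_seq 0) * ncs_exp (S3_act rot (alpha_seq (Suc n)))
      = ncs_exp (g_seq 0) * ncs_exp (S3_act rot (alpha_seq n)) * (?h (e_seq n) * ncs_exp (g_seq (Suc n)))"
    by (simp add: S3_exp mult.assoc del: alpha_seq.simps)
  also have "\<dots> = ncs_exp (alpha_seq n) * (ncs_exp (g_seq n) * (?h (e_seq n) * ncs_exp (g_seq (Suc n))))"
    unfolding Suc[symmetric] by (simp add: mult.assoc)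
  also have "\<dots> = ncs_exp (alpha_seq (Suc n)) * ncs_exp (g_seq (Suc n))"
    unfolding exp_alpha_seq_Suc by (simp add: edge_seq_Suc exp_BCH mult.assoc hh)
  finally show ?case by simp
qed

lemma exp_alpha_rot: "ncs_exp alpha = ncs_exp (g_seq 0) * ncs_exp (S3_act rot alpha)"
proof (rule ncs_tendsto_unique)
  have "ncs_tendsto (\<lambda>n. ncs_exp (alpha_seq n) * ncs_exp (g_seq n)) (ncs_exp alpha * ncs_exp 0)"
    by (intro ncs_tendsto_mult ncs_tendsto_exp alpha_tendsto g_seq_tendsto) simp_all
  thus "ncs_tendsto (\<lambda>n. ncs_exp (alpha_seq n) * ncs_exp (g_seq n)) (ncs_exp alpha)" by simp
  show "ncs_tendsto (\<lambda>n. ncs_exp (alpha_seq n) * ncs_exp (g_seq n)) (ncs_exp (g_seq 0) * ncs_exp (S3_act rot alpha))"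
    unfolding exp_alpha_seq_rot
    by (intro ncs_tendsto_mult ncs_tendsto_const ncs_tendsto_exp S3_tendsto alpha_tendsto) simp_all
qed

lemma exp_g_seq_0:
  "ncs_exp (g_seq 0) = ncs_exp ((- 1/3) *\<^sub>Q BCH [g_gen, e_gen, f_gen]) * ncs_exp g_gen"
  by (simp add: edge_seq_0 exp_BCH)

lemma loop_a_cl: "BCH [g_gen, e_gen, f_gen] \<in> completed_lie UNIV 0"
  by (intro BCH_cl) (auto intro!: gen_edge_cl)

lemma skel_transports_g_seq_0: "skel.transports a_gen (ncs_exp (g_seq 0)) b_gen"
proof -
  have "skel.transports a_gen (ncs_exp (BCH [g_gen, e_gen, f_gen])) a_gen"
    unfolding exp_BCH using skel.transports_mult[OF skel.transports_edges(3)
        skel.transports_mult[OF skel.transports_edges(1) skel.transports_edges(2)]] by simp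
  from skel.transports_loop_scale[OF cl_homog[OF loop_a_cl] coeff_BCH_Nil this, of "- 1/3"]
  show ?thesis unfolding exp_g_seq_0 using skel.transports_mult skel.transports_edges(3) by blast
qed

lemma skel_transports_S3:
  assumes "\<pi> = rot \<or> \<pi> = mirror" "skel.transports p P q"
  shows "skel.transports (S3_act \<pi> p) (S3_act \<pi> P) (S3_act \<pi> q)"
  by (rule skel.transports_image[OF assms(2) skel_commutes[OF assms(1)] S3_lin S3_mult S3_parity])

text \<open>The rotated centre is reached from \<open>b\<close> along the rotated path, hence from \<open>a\<close> along \<open>\<alpha>\<close>.\<close>

lemma rot_centre: "S3_act rot centre = centre"
proof -
  have "skel.transports b_gen (ncs_exp (S3_act rot alpha)) (S3_act rot centre)"
    using skel_transports_S3[OF _ skel_transports_centre, of rot] by (simp add: S3_rot S3_exp)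
  hence "skel.transports a_gen (ncs_exp alpha) (S3_act rot centre)"
    unfolding exp_alpha_rot by (rule skel.transports_mult[OF skel_transports_g_seq_0])
  from skel.transports_target_unique[OF this skel_transports_centre, of "ncs_exp (- alpha)"]
  show ?thesis by simp
qed

text \<open>Rotation replaces the boundary loop based at \<open>a\<close> by the one based at \<open>b\<close>, which is conjugate by \<open>g\<close>.
  The connecting element \<open>g\<^sub>0\<close> differs from \<open>g\<close> by a multiple of the loop itself, which commutes with it.\<close>

lemma rot_loop: "S3_act rot loop = loop"
proof (rule exp_eqD)
  let ?L = "BCH [g_gen, e_gen, f_gen]"
  let ?t = "ncs_exp ((- 1/3) *\<^sub>Q ?L)" and ?t' = "ncs_exp ((1/3) *\<^sub>Q ?L)"
  let ?r = "S3_act rot alpha"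
  have tLt: "?t * (ncs_exp ?L * (?t' * z)) = ncs_exp ?L * z" for z
  proof -
    have "?t * ncs_exp ?L * ?t' = ncs_exp ((- 1/3 + 1 + 1/3) *\<^sub>Q ?L)"
      using exp_scale_add[of ?L "- 1/3" 1] exp_scale_add[of ?L "- 1/3 + 1" "1/3"] by simp
    thus ?thesis by (simp flip: mult.assoc)
  qed
  have r: "ncs_exp ?r = ncs_exp (- g_gen) * (?t' * ncs_exp alpha)"
    unfolding exp_alpha_rot exp_g_seq_0 by (simp add: mult.assoc)
  have r': "ncs_exp (- ?r) = ncs_exp (- alpha) * (?t * ncs_exp g_gen)"
    by (rule exp_inverse_unique[symmetric]) (simp_all add: r mult.assoc)
  have "ncs_exp (S3_act rot loop)
      = ncs_exp (- ?r) * (ncs_exp e_gen * (ncs_exp f_gen * (ncs_exp g_gen * ncs_exp ?r)))"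
    by (simp add: loop_def S3_BCH S3_rot S3_simps exp_BCH)
  also have "\<dots> = ncs_exp (- alpha) * (?t * (ncs_exp ?L * (?t' * ncs_exp alpha)))"
    unfolding r r' by (simp add: mult.assoc exp_BCH)
  also have "\<dots> = ncs_exp loop" unfolding tLt by (simp add: loop_def exp_BCH mult.assoc)
  finally show "ncs_exp (S3_act rot loop) = ncs_exp loop" .
qed (simp_all add: loop_def)

lemma mirror_edges:
  "S3_act mirror (e_seq n) = - e_seq n \<and> S3_act mirror (f_seq n) = - g_seq n \<and> S3_act mirror (g_seq n) = - f_seq n"
proof (induction n)
  case 0
  have BCH_minus: "BCH [(1/3) *\<^sub>Q BCH [x, y, z], - z] = - BCH [(- 1/3) *\<^sub>Q BCH [z, x, y], z]"
    if "coeff z [] = 0" for x y z :: "cell ncseries"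
    using exp_conj_minus[OF that coeff_BCH_Nil coeff_BCH_Nil, of "[x, y, z]" "[z, x, y]" "1/3"]
    by (simp add: exp_BCH mult.assoc)
  show ?case
    by (simp add: edge_seq_0 S3_BCH S3_simps S3_mirror BCH_uminus_rev3 BCH_minus[simplified])
next
  case (Suc n) thus ?case by (simp add: edge_seq_Suc S3_BCH S3_simps BCH_uminus_rev2)
qed

text \<open>The reflection exchanges the two ways from \<open>a\<^sub>n\<close> to \<open>a\<^sub>n\<^sub>+\<^sub>1\<close>, through \<open>c\<^sub>n\<^sub>+\<^sub>1\<close> and through \<open>b\<^sub>n\<^sub>+\<^sub>1\<close>;
  together they form a loop that is closed since the half edges recombine to the \<open>n\<close>-th triangle.\<close>

lemma mirror_alpha_seq: "S3_act mirror (alpha_seq n) = alpha_seq n"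
proof (induction n)
  case 0 show ?case by (simp add: S3_simps)
next
  case (Suc n)
  let ?h = "\<lambda>x :: cell ncseries. ncs_exp ((1/2) *\<^sub>Q x)"
  have hh: "?h x * (?h x * z) = ncs_exp x * z" if "coeff x [] = 0" for x z
    using exp_half_half[OF that] by (simp flip: mult.assoc)
  have "?h (g_seq n) * ncs_exp (f_seq (Suc n)) * (ncs_exp (g_seq (Suc n)) * ?h (f_seq n))
      = ncs_exp (g_seq n) * ncs_exp (e_seq n) * ncs_exp (f_seq n)"
    by (simp add: edge_seq_Suc exp_BCH mult.assoc hh exp_half_half)
  hence "?h (g_seq n) * ncs_exp (f_seq (Suc n)) * ncs_exp (BCH [g_seq (Suc n), (1/2) *\<^sub>Q f_seq n]) = 1"
    by (simp add: edge_loop exp_BCH)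
  hence "?h (g_seq n) * ncs_exp (f_seq (Suc n)) = ncs_exp (- BCH [g_seq (Suc n), (1/2) *\<^sub>Q f_seq n])"
    by (rule exp_inverse_unique) simp
  also have "\<dots> = ncs_exp (- ((1/2) *\<^sub>Q f_seq n)) * ncs_exp (- g_seq (Suc n))"
    using BCH_uminus_rev2[of "(1/2) *\<^sub>Q f_seq n" "g_seq (Suc n)"] exp_BCH[of "[- ((1/2) *\<^sub>Q f_seq n), - g_seq (Suc n)]"]
    by simp
  finally have *: "?h (g_seq n) * ncs_exp (f_seq (Suc n)) = ncs_exp (- ((1/2) *\<^sub>Q f_seq n)) * ncs_exp (- g_seq (Suc n))" .
  show ?case
  proof (rule exp_eqD)
    show "ncs_exp (S3_act mirror (alpha_seq (Suc n))) = ncs_exp (alpha_seq (Suc n))"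
      using * by (simp add: S3_exp[symmetric] exp_alpha_seq_Suc del: alpha_seq.simps)
        (simp add: S3_mult S3_exp S3_simps mirror_edges Suc)
  qed (simp_all del: alpha_seq.simps)
qed

lemma mirror_alpha: "S3_act mirror alpha = alpha"
  using S3_tendsto[OF alpha_tendsto, of mirror] alpha_tendsto unfolding mirror_alpha_seq by (rule ncs_tendsto_unique)

lemma mirror_centre: "S3_act mirror centre = centre"
proof -
  have "skel.transports a_gen (ncs_exp alpha) (S3_act mirror centre)"
    using skel_transports_S3[OF _ skel_transports_centre, of mirror] by (simp add: S3_mirror S3_exp mirror_alpha)
  from skel.transports_target_unique[OF this skel_transports_centre, of "ncs_exp (- alpha)"]
  show ?thesis by simp
qed

lemma mirror_loop: "S3_act mirror loop = - loop"
proof (rule exp_eqD)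
  show "ncs_exp (S3_act mirror loop) = ncs_exp (- loop)"
    by (rule exp_inverse_unique)
      (simp_all add: loop_def S3_BCH S3_mirror S3_simps mirror_alpha exp_BCH mult.assoc)
qed (simp_all add: loop_def)

lemma full_commutes_generators:
  assumes \<pi>: "\<pi> = rot \<or> \<pi> = mirror"
  shows "full.D (S3_act \<pi> z) = S3_act \<pi> (full.D z)"
proof (rule full.S3_commutes)
  show "bij \<pi>" using \<pi> bij_rot bij_mirror by auto
  fix s show "full.D (S3_act \<pi> (gen s)) = S3_act \<pi> (full.D (gen s))"
  proof (cases "s = Face")
    case True
    thus ?thesis using \<pi>
      by (auto simp: S3_rot S3_mirror full.D_uminus full.D_gen S3_simps S3_act_gbr rot_centre rot_loop
          mirror_centre mirror_loop filt_lin_uminus[OF filt_lin_gbr_right])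
  next
    case False thus ?thesis using full.skeleton_commutes[OF \<pi>] by blast
  qed
qed

lemma S3_act_comp:
  assumes "bij \<pi>" "bij \<rho>" shows "S3_act (\<pi> \<circ> \<rho>) x = S3_act \<pi> (S3_act \<rho> x)"
proof (rule ncseries_eqI)
  fix w
  have "permutation \<pi>" "permutation \<rho>" using assms by (simp_all add: permutation)
  hence s: "cell_sign (\<pi> \<circ> \<rho>) c = cell_sign \<pi> c * cell_sign \<rho> c" for c
    by (cases c) (simp_all add: sign_compose)
  have p: "cell_perm (inv (\<pi> \<circ> \<rho>)) c = cell_perm (inv \<rho>) (cell_perm (inv \<pi>) c)" for c
    using assms by (cases c) (simp_all add: o_inv_distrib)
  have "prod_list (map (cell_sign (\<pi> \<circ> \<rho>)) w)
      = prod_list (map (cell_sign \<pi>) w) * prod_list (map (cell_sign \<rho>) (map (cell_perm (inv \<pi>)) w))"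
    by (induction w) (simp_all add: s[unfolded o_def] cell_sign_perm)
  moreover have "map (cell_perm (inv (\<pi> \<circ> \<rho>))) w = map (cell_perm (inv \<rho>)) (map (cell_perm (inv \<pi>)) w)"
    by (simp add: p)
  ultimately show "coeff (S3_act (\<pi> \<circ> \<rho>) x) w = coeff (S3_act \<pi> (S3_act \<rho> x)) w"
    by (simp only: S3_act_def ncseries.sel mult.assoc)
qed

text \<open>A power of the rotation brings the image of \<open>a\<close> back to \<open>a\<close>, and the stabiliser of \<open>a\<close> consists of
  the identity and the reflection.\<close>

theorem full_commutes:
  assumes "bij \<pi>" shows "full.D (S3_act \<pi> z) = S3_act \<pi> (full.D z)"
proof -
  define ok where "ok = (\<lambda>\<pi>. bij \<pi> \<and> (\<forall>z. full.D (S3_act \<pi> z) = S3_act \<pi> (full.D z)))"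
  have gens: "ok rot" "ok mirror" using full_commutes_generators bij_rot bij_mirror by (auto simp: ok_def)
  have cell_id: "cell_sign id c = 1" "cell_perm id c = c" for c
    by (cases c; simp add: sign_id)+
  have "prod_list (map (cell_sign id) w) = 1" for w
    by (induction w) (simp_all add: cell_id[unfolded id_def])
  hence "S3_act id x = x" for x
    by (intro ncseries_eqI) (simp add: S3_act_def cell_id map_idI)
  hence ok_id: "ok id" by (simp add: ok_def)
  have comp: "ok (\<sigma> \<circ> \<tau>)" if "ok \<sigma>" "ok \<tau>" for \<sigma> \<tau>
    using that by (simp add: ok_def S3_act_comp bij_comp)
  have rot3: "rot \<circ> (rot \<circ> (rot \<circ> \<sigma>)) = \<sigma>" for \<sigma> :: "vertex \<Rightarrow> vertex"
  proof
    fix v show "(rot \<circ> (rot \<circ> (rot \<circ> \<sigma>))) v = \<sigma> v" by (cases "\<sigma> v") auto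
  qed
  have fix_a: "ok \<sigma>" if \<sigma>: "bij \<sigma>" "\<sigma> Va = Va" for \<sigma>
  proof -
    have "\<sigma> Vb \<noteq> Va" "\<sigma> Vc \<noteq> Va" "\<sigma> Vb \<noteq> \<sigma> Vc"
      using bij_is_inj[OF \<sigma>(1)] \<sigma>(2) by (metis injD vertex.distinct)+
    hence "\<sigma> Vb = Vb \<and> \<sigma> Vc = Vc \<or> \<sigma> Vb = Vc \<and> \<sigma> Vc = Vb"
      by (cases "\<sigma> Vb"; cases "\<sigma> Vc") auto
    hence "(\<forall>v. \<sigma> v = id v) \<or> (\<forall>v. \<sigma> v = mirror v)"
      using \<sigma>(2) by (metis id_apply mirror_simps vertex.exhaust)
    hence "\<sigma> = id \<or> \<sigma> = mirror" by (simp add: fun_eq_iff)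
    thus ?thesis using ok_id gens by auto
  qed
  have unrotate: "ok \<sigma>" if "ok (rot \<circ> \<sigma>)" for \<sigma>
    using comp[OF gens(1) comp[OF gens(1) that]] by (simp add: rot3)
  have fix_c: "ok \<sigma>" if "bij \<sigma>" "\<sigma> Va = Vc" for \<sigma>
    by (rule unrotate[OF fix_a]) (use that bij_comp[OF _ bij_rot] in auto)
  have fix_b: "ok \<sigma>" if "bij \<sigma>" "\<sigma> Va = Vb" for \<sigma>
    by (rule unrotate[OF fix_c]) (use that bij_comp[OF _ bij_rot] in auto)
  have "ok \<pi>" using assms fix_a fix_b fix_c by (cases "\<pi> Va") auto
  thus ?thesis by (simp add: ok_def)
qed


subsection \<open>The linear parts\<close>

lemma fps_op_first:
  assumes T: "filt_lin 1 T" and v: "v \<in> ncfilt k"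
  shows "fps_op F T v - fps_nth F 0 *\<^sub>Q v \<in> ncfilt (Suc k)"
proof -
  have "F = fps_const (fps_nth F 0) + fps_shift 1 F * fps_X"
    by (rule fps_ext) auto
  hence "fps_op F T v = fps_nth F 0 *\<^sub>Q v + fps_op (fps_shift 1 F) T (T v)"
    by (metis fps_op_add fps_op_const fps_op_mult[OF T] fps_op_X[OF T])
  moreover have "fps_op (fps_shift 1 F) T (T v) \<in> ncfilt (Suc k)"
    by (rule fps_op_filt[OF T]) (use filt_lin_filt[OF T v] in simp)
  ultimately show ?thesis by simp
qed

lemma length_part_1_edge_differential:
  assumes y: "homog 0 y" "coeff y [] = 0" and p: "coeff p [] = 0" and q: "coeff q [] = 0"
  shows "length_part 1 (edge_differential y p q) = length_part 1 q - length_part 1 p"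
proof -
  note first = length_part_cong[OF fps_op_first[OF filt_lin_comm[OF y(2)], of _ 1], folded One_nat_def]
  show ?thesis
    unfolding edge_differential_def gbr_even[OF y(1), abs_def]
    using first[of p] first[of q] p q
    by (simp add: filt_lin_add[OF filt_lin_length_part] filt_lin_scale[OF filt_lin_length_part] ncfilt_1 fps_quotients)
qed

lemma exp_first:
  assumes "coeff x [] = 0" shows "ncs_exp x - 1 - x \<in> ncfilt 2"
proof -
  note L = filt_lin_mult_left[OF assms]
  have "(fps_exp 1 :: rat fps) = 1 + fps_shift 1 (fps_exp 1) * fps_X" by (rule fps_ext) auto
  hence "ncs_exp x = 1 + fps_op (fps_shift 1 (fps_exp 1)) ((*) x) x"
    unfolding ncs_exp_def by (metis fps_op_add fps_op_1 fps_op_mult[OF L] fps_op_X[OF L] mult_1_right)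
  thus ?thesis using fps_op_first[OF L, of x 1 "fps_shift 1 (fps_exp 1)"] assms
    by (simp add: ncfilt_1 numeral_2_eq_2)
qed

lemma BCH_first:
  "\<forall>x\<in>set xs. coeff x [] = 0 \<Longrightarrow> BCH xs - sum_list xs \<in> ncfilt 2"
proof (induction xs)
  case Nil
  have "BCH [] = (0 :: 'a ncseries)" using log_exp[of 0] by (simp add: BCH_def)
  thus ?case by simp
next
  case (Cons x xs)
  let ?y = "BCH xs" and ?z = "BCH (x # xs)"
  have x: "coeff x [] = 0" using Cons.prems by simp
  have e: "ncs_exp ?z = ncs_exp x * ncs_exp ?y" by (simp add: exp_BCH)
  have "(ncs_exp x - 1) * (ncs_exp ?y - 1) \<in> ncfilt (1 + 1)"
    by (rule ncfilt_mult) (simp_all add: ncfilt_1)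
  hence p: "(ncs_exp x - 1) * (ncs_exp ?y - 1) \<in> ncfilt 2" by (simp add: numeral_2_eq_2)
  have "?z - (x + ?y) = (ncs_exp x - 1 - x) + (ncs_exp ?y - 1 - ?y) + (ncs_exp x - 1) * (ncs_exp ?y - 1)
      - (ncs_exp ?z - 1 - ?z)"
    unfolding e by (simp add: algebra_simps del: one_add_one)
  also have "\<dots> \<in> ncfilt 2" by (intro ncfilt_add ncfilt_diff exp_first x p) simp_all
  finally have "(?z - (x + ?y)) + (?y - sum_list xs) \<in> ncfilt 2" using Cons by (intro ncfilt_add) auto
  thus ?case by (simp add: algebra_simps)
qed

lemma length_part_gen [simp]: "length_part (Suc 0) (gen s) = gen s"
  by (rule ncseries_eqI) (auto simp: coeff_length_part coeff_gen)

lemma full_linear_part: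
  assumes "cell_dim s > 0" shows "length_part 1 (full.D (gen s)) = geometric_boundary s"
proof (cases s rule: skeleton_differential.cases)
  case 5
  have "loop - sum_list [- alpha, g_gen, e_gen, f_gen, alpha] \<in> ncfilt (Suc (Suc 0))"
    unfolding loop_def using BCH_first[of "[- alpha, g_gen, e_gen, f_gen, alpha]"] by (simp add: numeral_2_eq_2)
  hence "length_part (Suc 0) loop = length_part (Suc 0) (sum_list [- alpha, g_gen, e_gen, f_gen, alpha])"
    by (rule length_part_cong)
  also have "sum_list [- alpha, g_gen, e_gen, f_gen, alpha] = e_gen + f_gen + g_gen"
    by (simp add: algebra_simps)
  also have "length_part (Suc 0) \<dots> = e_gen + f_gen + g_gen"
    by (simp add: filt_lin_add[OF filt_lin_length_part])
  finally have 1: "length_part (Suc 0) loop = e_gen + f_gen + g_gen" .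
  have c: "centre \<in> ncfilt 1" "h_gen \<in> ncfilt 1" using cl_Nil[OF centre_cl] by (simp_all add: ncfilt_1)
  have "gbr centre h_gen \<in> ncfilt (Suc (Suc 0))"
    unfolding gbr_centre_h using ncfilt_mult[OF c] ncfilt_mult[OF c(2,1)] by (intro ncfilt_add) simp_all
  hence "length_part (Suc 0) (gbr centre h_gen) = 0" by (rule length_part_filt)
  thus ?thesis using 1 by (simp add: 5 full.D_gen filt_lin_diff[OF filt_lin_length_part])
qed (use assms in \<open>simp_all add: full.D_gen length_part_1_edge_differential[unfolded One_nat_def] full.homog_edge\<close>)


subsection \<open>Existence and uniqueness\<close>

lemma triangle_differential_full: "triangle_differential full.D"
  unfolding triangle_differential_def
  using full.lie_derivation_D full.continuous_D
  by (simp add: full.D_gen loop_def centre_def flow_def full_eq_skel[OF alpha_skeleton])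

text \<open>The value on the face is determined in two steps: the values on vertices and edges determine
  \<open>d \<alpha>\<close>, hence the centre, hence \<open>d h\<close>.\<close>

lemma triangle_differential_agrees:
  assumes d: "triangle_differential d" and x: "x \<in> Abar_total" shows "d x = full.D x"
proof -
  have d': "lie_derivation scaleQ Abar gbr d" "continuous_on_Abar d"
    using d by (auto simp: triangle_differential_def)
  have skel: "d (gen s) = full.D (gen s)" if "s \<in> skeleton" for s
    using d that by (cases s rule: skeleton_differential.cases)
      (auto simp: triangle_differential_def full.D_gen skeleton_def)
  have "d alpha = full.D alpha"
    by (rule derivations_agree[OF d' full.lie_derivation_D full.continuous_D skel alpha_skeleton])
  hence "d h_gen = full.D h_gen"
    using d triangle_differential_full by (simp add: triangle_differential_def flow_def)
  hence "d (gen s) = full.D (gen s)" for s using skel by (cases "s = Face") (auto simp: skeleton_def)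
  from derivations_agree_total[OF d' full.lie_derivation_D full.continuous_D this x] show ?thesis .
qed

text \<open>All conditions concern values on the total space only, so the extensional restriction of a solution
  is a solution.\<close>

lemma triangle_differential_cong:
  assumes d: "triangle_differential d" and eq: "\<And>x. x \<in> Abar_total \<Longrightarrow> d' x = d x"
  shows "triangle_differential d'"
proof -
  interpret d: lie_derivation scaleQ Abar gbr d using d by (simp add: triangle_differential_def)
  have T: "d.total = Abar_total" by (rule total_Abar)
  have A: "u \<in> Abar n \<Longrightarrow> u \<in> Abar_total" for u n using Abar_subset_total by blast
  have sub: "ncs.subspace Abar_total" by (simp add: Abar_total_def completed_lie_total_def)
  have "lie_derivation scaleQ Abar gbr d'"
  proof unfold_locales
    fix u v assume "u \<in> d.total" "v \<in> d.total"
    thus "d' (u + v) = d' u + d' v"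
      using d.d_add[of u v] ncs.subspace_add[OF sub] unfolding T by (simp add: eq)
  next
    fix u r assume "u \<in> d.total"
    thus "d' (r *\<^sub>Q u) = r *\<^sub>Q d' u"
      using d.d_scale[of u r] ncs.subspace_scale[OF sub] unfolding T by (simp add: eq)
  next
    fix u n assume "u \<in> Abar n" thus "d' u \<in> Abar (n - 1)" using d.d_degree A by (simp add: eq)
  next
    fix u v p q assume uv: "u \<in> Abar p" "v \<in> Abar q"
    hence "gbr u v \<in> Abar_total" using d.br_degree A by blast
    thus "d' (gbr u v) = gbr (d' u) v + (if even p then 1 else - 1) *\<^sub>Q gbr u (d' v)"
      using d.d_br[OF uv] uv A by (simp add: eq)
  qed
  moreover have "continuous_on_Abar d'"
    using d A by (simp add: triangle_differential_def continuous_on_Abar_def eq)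
  moreover have "gen s \<in> Abar_total" for s using A cl_gen[of s UNIV] by (simp add: Abar_def)
  moreover have "alpha \<in> Abar_total" using A[of alpha 0] cl_Abar alpha_cl by blast
  ultimately show ?thesis using d by (simp add: triangle_differential_def flow_def eq)
qed

lemma gen_total: "gen s \<in> Abar_total"
  using Abar_subset_total[of "cell_deg s"] cl_gen[of s UNIV] by (auto simp: Abar_def)

lemma S3_total: "bij \<pi> \<Longrightarrow> x \<in> Abar_total \<Longrightarrow> S3_act \<pi> x \<in> Abar_total"
proof -
  assume \<pi>: "bij \<pi>" and x: "x \<in> Abar_total"
  have word: "S3_act \<pi> (eval_word gbr gen t) \<in> completed_lie UNIV (word_degree cell_deg t + 0)" for t
  proof (induction t)
    case (Gen s)
    show ?case using cl_scale[OF cl_gen[of "cell_perm \<pi> s" UNIV]] by (simp add: S3_act_gen[OF \<pi>])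
  next
    case (Br s t) thus ?case using gbr_cl by (simp add: S3_act_gbr)
  qed
  show ?thesis
    using x unfolding Abar_total_def completed_lie_total_def
  proof (induction rule: ncs.span_induct_alt)
    case base show ?case by (simp add: S3_simps ncs.span_zero)
  next
    case (step c y z)
    then obtain n where "y \<in> completed_lie UNIV n" by auto
    hence "S3_act \<pi> y \<in> completed_lie UNIV n" using filt_lin_cl[OF S3_lin word] by simp
    hence "S3_act \<pi> y \<in> ncs.span (\<Union>n. completed_lie UNIV n)" by (auto intro: ncs.span_base)
    thus ?case using step by (auto simp: S3_simps intro: ncs.span_add ncs.span_scale)
  qed
qed

lemma triangle_model_full:
  assumes d: "triangle_differential d" shows "triangle_model TYPE('m::ab_group_add) d"
proof -
  note eq = triangle_differential_agrees[OF d]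
  interpret d: lie_derivation scaleQ Abar gbr d using d by (simp add: triangle_differential_def)
  have dT: "d x \<in> Abar_total" if "x \<in> Abar_total" for x
  proof -
    have "full.D x \<in> Abar_total"
      using that unfolding Abar_total_def completed_lie_total_def
    proof (induction rule: ncs.span_induct_alt)
      case base show ?case using filt_lin_zero[OF full.filt_lin_D] by (simp add: ncs.span_zero)
    next
      case (step c y z)
      then obtain n where "y \<in> completed_lie UNIV n" by auto
      hence "full.D y \<in> completed_lie UNIV (n - 1)" by (rule full.D_cl[OF full.\<delta>])
      hence "full.D y \<in> ncs.span (\<Union>n. completed_lie UNIV n)" by (auto intro: ncs.span_base)
      thus ?case using step by (auto simp: full.D_add full.D_scale intro: ncs.span_add ncs.span_scale)
    qed
    thus ?thesis using eq[OF that] by simp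
  qed
  have "dgla scaleQ Abar gbr d"
    by unfold_locales (use dT in \<open>simp add: total_Abar eq full_DD\<close>)
  moreover have "d (gen (Vert v)) + (1/2) *\<^sub>Q gbr (gen (Vert v)) (gen (Vert v)) = 0" for v
    using d by (simp add: triangle_differential_def)
  moreover have "length_part 1 (d (gen s)) = geometric_boundary s" if "cell_dim s > 0" for s
    using full_linear_part[OF that] by (simp add: eq[OF gen_total])
  moreover have "d (gen s) \<in> completed_lie_total (closure_cells s)" for s
  proof -
    have "full.D (gen s) \<in> completed_lie (closure_cells s) (cell_deg s - 1)"
      using skeleton_differential_closure[of s] full.\<delta>[of s] by (cases "s = Face") (auto simp: full.D_gen)
    thus ?thesis unfolding eq[OF gen_total] completed_lie_total_def by (auto intro: ncs.span_base)
  qed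
  ultimately show ?thesis using free_lie_free by (simp add: triangle_model_def)
qed

lemma triangle_symmetric_full:
  assumes d: "triangle_differential d" shows "triangle_symmetric d"
  unfolding triangle_symmetric_def
  using triangle_differential_agrees[OF d] S3_total full_commutes by simp

theorem mainTheorem1:
  shows "(\<exists>!d. d \<in> extensional Abar_total \<and> triangle_differential d) \<and>
         (\<forall>d. triangle_differential d \<longrightarrow>
            triangle_model TYPE('m::ab_group_add) d \<and> triangle_symmetric d)"
proof
  show "\<exists>!d. d \<in> extensional Abar_total \<and> triangle_differential d"
  proof (rule ex1I[of _ "restrict full.D Abar_total"])
    show "restrict full.D Abar_total \<in> extensional Abar_total \<and> triangle_differential (restrict full.D Abar_total)"
      using triangle_differential_cong[OF triangle_differential_full] by simp
    fix d assume d: "d \<in> extensional Abar_total \<and> triangle_differential d"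
    show "d = restrict full.D Abar_total"
      by (rule extensionalityI[of _ Abar_total]) (use d triangle_differential_agrees in auto)
  qed
qed (use triangle_model_full triangle_symmetric_full in blast)

end
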